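(* (a) Let $M$ be a nilpotent matroid. Then $M$ is realizable over $\mathbb{C}$ and its realization space $\Gamma_M$ is irreducible. (b) Let $M$ be a nilpotent paving matroid in which any three (distinct) dependent hyperplanes have empty intersection. Then the matroid variety and the circuit variety of $M$ coincide: $V_M=V_{\mathcal{C}(M)}$. (c) Let $M$ be a forest configuration. Then $M$ is nilpotent, and $$I(V_M)=\sqrt{I(V_{\mathcal{C}(M)})+G_M}.$$
   Context: Matroids have ground set $[n]=\{1,\dots,n\}$; elements are called points. Subspaces. For a matroid $M$ of rank $r$, two circuits $C_1,C_2$ of size less than $r+1$ are equivalent if they have the same closure. The equivalence classes are called the subspaces of $M$; $\mathfrak{S}_M$ is the set of subspaces. The rank of $l\in\mathfrak{S}_M$ is the common rank of the circuits in $l$. A point $p$ belongs to $l$ (written $p\in l$) if $p\in C$ for some circuit $C\in l$; $l$ is identified with its set of points. $\mathfrak{S}_p$ is the set of subspaces containing $p$, and the degree of $p$ is $|\mathfrak{S}_p|$. A subset $N$ of the ground set is identified with the submatroid $M|N$ (restriction), whose subspaces are those of $M|N$ as a matroid in its own right. Nilpotent. $S_M=\{p:|\mathfrak{S}_p|>1\}$. The nilpotent chain of $M$ is $M_0=M$, $M_1=S_M$, $M_{j+1}=S_{M_j}$ for $j\ge 1$. $M$ is nilpotent if $M_j=\emptyset$ for some $j$. Paving. A matroid of rank $r$ is paving (or $r$-paving) if every circuit has size $r$ or $r+1$. In this case the subspaces are the dependent hyperplanes of $M$: the maximal subsets of points of size at least $r$ in which every subset of $r$ elements is a circuit. Rank-three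 matroids are assumed simple; their dependent hyperplanes are called lines. Realizations. A realization of a matroid $M$ of rank $r$ on $[n]$ is a family $\gamma=(\gamma_1,\dots,\gamma_n)$ of vectors of $\mathbb{C}^r$ such that a subfamily indexed by a set $A$ is linearly dependent if and only if $A$ is dependent in $M$. $\Gamma_M\subset\mathbb{C}^{rn}$ is the set of realizations, $M$ is realizable if $\Gamma_M\ne\emptyset$, and $V_M$ is the Zariski closure of $\Gamma_M$ in $\mathbb{C}^{rn}$. $V_{\mathcal{C}(M)}$ is the set of families $\gamma\in(\mathbb{C}^r)^n$ such that $(\gamma_i)_{i\in A}$ is linearly dependent for every dependent set $A$ of $M$. $I(V)$ is the vanishing ideal of $V$ in the polynomial ring $\mathbb{C}[X]$, where $X$ is an $r\times n$ matrix of indeterminates with columns indexed by $[n]$. Irreducibility is in the Zariski topology, and the empty set is regarded as irreducible. Forest. A rank-three (simple) matroid $M$ on $[n]$ is a forest configuration if there do not exist $k\ge 3$, points $x_1,\dots,x_k\in[n]$ and lines $l_1,\dots,l_{k-1}\in\mathfrak{S}_M$ such that $x_1=x_k$, the points $x_1,\dots,x_{k-1}$ are distinct, $l_j\ne l_{j+1}$ for all $j\in[k-2]$, and $x_j,x_{j+1}\in l_j$ for all $j\in[k-1]$. The ideal $G_M$ (for $M$ of rank three). For points $a,b,c$, $[a,b,c]\in\mathbb{C}[X]$ is the determinant of the corresponding columns of the $3\times n$ matrix $X$. A point $x$ is also identified with its column (a vector of three indeterminates). An elementary replacement at a point $x$ is the following: given distinct lines $l_1\ne l_2\in\mathfrak{S}_x$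 and points $p_1,p_2\in l_1$, $p_3,p_4\in l_2$, replace the column vector $x$ in a polynomial by the vector $[p_1,p_2,p_3]\,p_4-[p_1,p_2,p_4]\,p_3$. Let $X_0$ be the set of brackets $[a,b,c]$ over all circuits $\{a,b,c\}$ of size three of $M$. For $j\ge1$, let $X_j$ be the set of polynomials obtained from those in $X_{j-1}$ by performing such replacements at some (possibly none) of the points. Let $I_j$ be the ideal generated by $X_j$. The chain $I_0\subset I_1\subset\cdots$ stabilizes, and $G_M$ is the stable ideal. *)

theory Defs
  imports
    "HOL-Analysis.Determinants"
    "HOL-Algebra.Ideal"
    "HOL-Library.Poly_Mapping"
    "HOL-Library.FuncSet"
begin

section \<open>Matroids on a finite ground set\<close>

typedef 'a matroid =
  "{(E :: 'a set, I :: 'a set set).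
      finite E \<and> I \<subseteq> Pow E \<and> {} \<in> I \<and>
      (\<forall>A\<in>I. \<forall>B. B \<subseteq> A \<longrightarrow> B \<in> I) \<and>
      (\<forall>A\<in>I. \<forall>B\<in>I. card A < card B \<longrightarrow> (\<exists>x\<in>B - A. insert x A \<in> I))}"
  by (rule exI[of _ "({}, {{}})"]) auto

setup_lifting type_definition_matroid

lift_definition ground :: "'a matroid \<Rightarrow> 'a set" is fst .

lift_definition indep_sets :: "'a matroid \<Rightarrow> 'a set set" is snd .

lift_definition restrict_matroid :: "'a matroid \<Rightarrow> 'a set \<Rightarrow> 'a matroid"
  is "\<lambda>(E, I) N. (E \<inter> N, {A \<in> I. A \<subseteq> N})"
  by (auto simp: Ball_def Bex_def) (metis DiffE subsetD)

definition dep_set :: "'a matroid \<Rightarrow> 'a set \<Rightarrow> bool" where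
  "dep_set M A \<longleftrightarrow> A \<subseteq> ground M \<and> A \<notin> indep_sets M"

definition circuit :: "'a matroid \<Rightarrow> 'a set \<Rightarrow> bool" where
  "circuit M C \<longleftrightarrow> dep_set M C \<and> (\<forall>D. D \<subset> C \<longrightarrow> \<not> dep_set M D)"

definition rank_of :: "'a matroid \<Rightarrow> 'a set \<Rightarrow> nat" where
  "rank_of M A = Max (card ` {B \<in> indep_sets M. B \<subseteq> A})"

definition mrank :: "'a matroid \<Rightarrow> nat" where
  "mrank M = rank_of M (ground M)"

definition mclosure :: "'a matroid \<Rightarrow> 'a set \<Rightarrow> 'a set" where
  "mclosure M A = {x \<in> ground M. rank_of M (insert x A) = rank_of M A}"

definition simple_matroid :: "'a matroid \<Rightarrow> bool" where
  "simple_matroid M \<longleftrightarrow> (\<forall>C. circuit M C \<longrightarrow> 3 \<le> card C)"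

section \<open>Subspaces and nilpotency\<close>

definition small_circuits :: "'a matroid \<Rightarrow> 'a set set" where
  "small_circuits M = {C. circuit M C \<and> card C < mrank M + 1}"

definition closure_rel :: "'a matroid \<Rightarrow> ('a set \<times> 'a set) set" where
  "closure_rel M =
     {(C, D). C \<in> small_circuits M \<and> D \<in> small_circuits M \<and> mclosure M C = mclosure M D}"

text \<open>A subspace is an equivalence class of circuits; its set of points is the union of the class.\<close>

definition subspaces :: "'a matroid \<Rightarrow> 'a set set set" where
  "subspaces M = small_circuits M // closure_rel M"

definition subspaces_at :: "'a matroid \<Rightarrow> 'a \<Rightarrow> 'a set set set" where
  "subspaces_at M p = {l \<in> subspaces M. p \<in> \<Union>l}"

definition high_degree_points :: "'a matroid \<Rightarrow> 'a set" where
  "high_degree_points M = {p \<in> ground M. card (subspaces_at M p) > 1}"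

primrec nil_chain :: "'a matroid \<Rightarrow> nat \<Rightarrow> 'a matroid" where
  "nil_chain M 0 = M"
| "nil_chain M (Suc j) = restrict_matroid (nil_chain M j) (high_degree_points (nil_chain M j))"

definition nilpotent_matroid :: "'a matroid \<Rightarrow> bool" where
  "nilpotent_matroid M \<longleftrightarrow> (\<exists>j. ground (nil_chain M j) = {})"

section \<open>Paving matroids and forest configurations\<close>

definition paving :: "'a matroid \<Rightarrow> bool" where
  "paving M \<longleftrightarrow> (\<forall>C. circuit M C \<longrightarrow> card C = mrank M \<or> card C = mrank M + 1)"

definition all_rank_subsets_circuits :: "'a matroid \<Rightarrow> 'a set \<Rightarrow> bool" where
  "all_rank_subsets_circuits M H \<longleftrightarrow>
     H \<subseteq> ground M \<and> mrank M \<le> card H \<and>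
     (\<forall>C. C \<subseteq> H \<and> card C = mrank M \<longrightarrow> circuit M C)"

definition dependent_hyperplane :: "'a matroid \<Rightarrow> 'a set \<Rightarrow> bool" where
  "dependent_hyperplane M H \<longleftrightarrow>
     all_rank_subsets_circuits M H \<and>
     (\<forall>H'. H \<subset> H' \<longrightarrow> \<not> all_rank_subsets_circuits M H')"

definition forest_configuration :: "'a matroid \<Rightarrow> bool" where
  "forest_configuration M \<longleftrightarrow>
     mrank M = 3 \<and> simple_matroid M \<and>
     \<not> (\<exists>k\<ge>3. \<exists>(x :: nat \<Rightarrow> 'a) (l :: nat \<Rightarrow> 'a set set).
          (\<forall>j\<in>{1..k}. x j \<in> ground M) \<and>
          (\<forall>j\<in>{1..k-1}. l j \<in> subspaces M) \<and>
          x 1 = x k \<and> inj_on x {1..k-1} \<and>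
          (\<forall>j\<in>{1..k-2}. l j \<noteq> l (j + 1)) \<and>
          (\<forall>j\<in>{1..k-1}. x j \<in> \<Union>(l j) \<and> x (j + 1) \<in> \<Union>(l j)))"

section \<open>Polynomials and the Zariski topology\<close>

text \<open>
  Complex polynomials with indeterminates from \<open>'v\<close>: finitely supported maps from monomials
  (finitely supported exponent functions) to coefficients, multiplied by convolution.
\<close>

type_synonym 'v cpoly = "('v \<Rightarrow>\<^sub>0 nat) \<Rightarrow>\<^sub>0 complex"

definition Const :: "complex \<Rightarrow> 'v cpoly" where
  "Const c = Poly_Mapping.single 0 c"

definition Var :: "'v \<Rightarrow> 'v cpoly" where
  "Var v = Poly_Mapping.single (Poly_Mapping.single v 1) 1"

definition indets :: "'v cpoly \<Rightarrow> 'v set" where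
  "indets p = (\<Union>m\<in>Poly_Mapping.keys p. Poly_Mapping.keys m)"

definition peval :: "('v \<Rightarrow> complex) \<Rightarrow> 'v cpoly \<Rightarrow> complex" where
  "peval \<gamma> p = (\<Sum>m\<in>Poly_Mapping.keys p.
     Poly_Mapping.lookup p m * (\<Prod>v\<in>Poly_Mapping.keys m. \<gamma> v ^ Poly_Mapping.lookup m v))"

definition psubst :: "('v \<Rightarrow> 'v cpoly) \<Rightarrow> 'v cpoly \<Rightarrow> 'v cpoly" where
  "psubst \<sigma> p = (\<Sum>m\<in>Poly_Mapping.keys p.
     Const (Poly_Mapping.lookup p m) * (\<Prod>v\<in>Poly_Mapping.keys m. \<sigma> v ^ Poly_Mapping.lookup m v))"

text \<open>The polynomial ring with indeterminates indexed by \<open>J\<close>, and the affine space of its points.\<close>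

definition poly_ring :: "'v set \<Rightarrow> 'v cpoly ring" where
  "poly_ring J = \<lparr>carrier = {p. indets p \<subseteq> J}, monoid.mult = (*), one = 1, zero = 0, add = (+)\<rparr>"

definition affine_space :: "'v set \<Rightarrow> ('v \<Rightarrow> complex) set" where
  "affine_space J = J \<rightarrow>\<^sub>E UNIV"

definition zariski_closed :: "'v set \<Rightarrow> ('v \<Rightarrow> complex) set \<Rightarrow> bool" where
  "zariski_closed J Z \<longleftrightarrow>
     (\<exists>S \<subseteq> carrier (poly_ring J). Z = {\<gamma> \<in> affine_space J. \<forall>p\<in>S. peval \<gamma> p = 0})"

definition zariski_closure :: "'v set \<Rightarrow> ('v \<Rightarrow> complex) set \<Rightarrow> ('v \<Rightarrow> complex) set" where
  "zariski_closure J V = zariski_closed J hull V"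

text \<open>Irreducibility in the subspace topology; the empty set is irreducible.\<close>

definition zariski_irreducible :: "'v set \<Rightarrow> ('v \<Rightarrow> complex) set \<Rightarrow> bool" where
  "zariski_irreducible J V \<longleftrightarrow>
     (\<forall>Z1 Z2. zariski_closed J Z1 \<and> zariski_closed J Z2 \<and> V \<subseteq> Z1 \<union> Z2 \<longrightarrow> V \<subseteq> Z1 \<or> V \<subseteq> Z2)"

definition vanishing_ideal :: "'v set \<Rightarrow> ('v \<Rightarrow> complex) set \<Rightarrow> 'v cpoly set" where
  "vanishing_ideal J V = {p \<in> carrier (poly_ring J). \<forall>\<gamma>\<in>V. peval \<gamma> p = 0}"

definition radical_ideal :: "('a, 'b) ring_scheme \<Rightarrow> 'a set \<Rightarrow> 'a set" where
  "radical_ideal R I = {p \<in> carrier R. \<exists>k::nat. p [^]\<^bsub>R\<^esub> k \<in> I}"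

section \<open>Realization spaces\<close>

text \<open>
  For a matroid of rank \<open>r\<close>, a family of vectors indexed by the ground set is an \<open>r\<close>-rowed matrix:
  \<open>\<gamma> (i, a)\<close> is the \<open>i\<close>-th coordinate of the vector at the point \<open>a\<close>.
\<close>

definition matrix_index :: "'a matroid \<Rightarrow> (nat \<times> 'a) set" where
  "matrix_index M = {1..mrank M} \<times> ground M"

definition family_dependent :: "nat \<Rightarrow> (nat \<times> 'a \<Rightarrow> complex) \<Rightarrow> 'a set \<Rightarrow> bool" where
  "family_dependent r \<gamma> A \<longleftrightarrow>
     (\<exists>c :: 'a \<Rightarrow> complex. (\<exists>a\<in>A. c a \<noteq> 0) \<and> (\<forall>i\<in>{1..r}. (\<Sum>a\<in>A. c a * \<gamma> (i, a)) = 0))"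

definition realizations :: "'a matroid \<Rightarrow> (nat \<times> 'a \<Rightarrow> complex) set" where
  "realizations M = {\<gamma> \<in> affine_space (matrix_index M).
     \<forall>A \<subseteq> ground M. family_dependent (mrank M) \<gamma> A \<longleftrightarrow> dep_set M A}"

definition realizable :: "'a matroid \<Rightarrow> bool" where
  "realizable M \<longleftrightarrow> realizations M \<noteq> {}"

definition matroid_variety :: "'a matroid \<Rightarrow> (nat \<times> 'a \<Rightarrow> complex) set" where
  "matroid_variety M = zariski_closure (matrix_index M) (realizations M)"

definition circuit_variety :: "'a matroid \<Rightarrow> (nat \<times> 'a \<Rightarrow> complex) set" where
  "circuit_variety M = {\<gamma> \<in> affine_space (matrix_index M).
     \<forall>A. dep_set M A \<longrightarrow> family_dependent (mrank M) \<gamma> A}"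

section \<open>The ideal \<open>G\<^sub>M\<close> of a matroid of rank three\<close>

definition bracket :: "'a \<Rightarrow> 'a \<Rightarrow> 'a \<Rightarrow> (nat \<times> 'a) cpoly" where
  "bracket a b c = det (vector
     [vector [Var (1, a), Var (1, b), Var (1, c)],
      vector [Var (2, a), Var (2, b), Var (2, c)],
      vector [Var (3, a), Var (3, b), Var (3, c)]] :: (nat \<times> 'a) cpoly^3^3)"

definition replacement_vectors :: "'a matroid \<Rightarrow> 'a \<Rightarrow> (nat \<Rightarrow> (nat \<times> 'a) cpoly) set" where
  "replacement_vectors M x =
     {(\<lambda>i. bracket p1 p2 p3 * Var (i, p4) - bracket p1 p2 p4 * Var (i, p3)) | p1 p2 p3 p4 l1 l2.
        l1 \<in> subspaces_at M x \<and> l2 \<in> subspaces_at M x \<and> l1 \<noteq> l2 \<and>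
        p1 \<in> \<Union>l1 \<and> p2 \<in> \<Union>l1 \<and> p3 \<in> \<Union>l2 \<and> p4 \<in> \<Union>l2}"

text \<open>
  One substitution replaces the columns of an arbitrary set of points simultaneously, one elementary
  replacement for each of these points, and leaves the other columns unchanged.
\<close>

definition replacement_subst :: "'a matroid \<Rightarrow> (nat \<times> 'a \<Rightarrow> (nat \<times> 'a) cpoly) \<Rightarrow> bool" where
  "replacement_subst M \<sigma> \<longleftrightarrow>
     (\<forall>x. (\<forall>i. \<sigma> (i, x) = Var (i, x)) \<or> (\<lambda>i. \<sigma> (i, x)) \<in> replacement_vectors M x)"

primrec G_gens :: "'a matroid \<Rightarrow> nat \<Rightarrow> (nat \<times> 'a) cpoly set" where
  "G_gens M 0 = {bracket a b c | a b c. circuit M {a, b, c} \<and> card {a, b, c} = 3}"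
| "G_gens M (Suc j) = {psubst \<sigma> P | \<sigma> P. P \<in> G_gens M j \<and> replacement_subst M \<sigma>}"

text \<open>
  The ideals generated by \<open>G_gens M j\<close> form an ascending chain in a Noetherian ring, so their union
  is the ideal at which the chain stabilizes.
\<close>

definition G_ideal :: "'a matroid \<Rightarrow> (nat \<times> 'a) cpoly set" where
  "G_ideal M = (\<Union>j. genideal (poly_ring (matrix_index M)) (G_gens M j))"

end

theory Submission
  imports Defs "HOL-Analysis.Analysis" "HOL-Computational_Algebra.Fundamental_Theorem_Algebra"
begin

text \<open>
  (a) A nilpotent matroid arises by adding its points one at a time, each of them free with respect to
  the earlier points or free on a flat spanned by some of them. Following this order one joins two
  realizations by a polynomial curve almost all of whose points are realizations, so irreducibility
  reduces to the fact that a nonzero polynomial in one variable has finitely many roots.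

  (b) In the nilpotent paving case the dependent hyperplanes can be ordered so that each meets the union
  of the earlier ones in fewer than \<open>r\<close> points. Adding them in this order, a family in the circuit
  variety, together with functionals vanishing on its hyperplanes, is perturbed until the functionals
  are pairwise nonparallel. Over such functionals the families form a bundle with linear fibres, hence
  they are joined to a realization by a polynomial curve.

  (c) By the Nullstellensatz it suffices that every common zero of \<open>G\<^sub>M\<close> lies in the closure of the
  realization space. Zero columns are first filled with small multiples of nonzero replacement
  vectors. Once all replacements at zero columns vanish, the lines through such a column whose planes are
  determined share one plane, and the remaining columns can be filled along the forest. A family without
  zero columns is moved to a realization leaf by leaf.
\<close>

section \<open>Finite families of coordinate vectors\<close>

text \<open>Dependence does not survive perturbation, but a nonzero functional annihilating the
  points of a hyperplane can be deformed together with them, and while it stays nonzero it forces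
  every \<open>r\<close> of these points to be dependent. So hyperplanes are carried through the
  deformations as functionals. A curve then consists of realizations for almost all parameters once
  its functionals are nonzero at one end, its family is a realization at the other, and annihilation
  holds throughout; no intermediate position has to be controlled. A vector can be deformed under
  orthogonality conditions where these are independent. In (b) a point lies on at most two
  hyperplanes, so nonparallel functionals suffice, and making them nonparallel is the main
  difficulty. In (c) a point may lie on many lines and no such condition is available at points; but
  a leaf line meets the others in at most one point, and one vector is independent exactly when it
  is nonzero. This is why zero columns are the obstruction there, and why the replacements are
  needed at them.\<close>

definition dot :: "nat \<Rightarrow> (nat \<Rightarrow> complex) \<Rightarrow> (nat \<Rightarrow> complex) \<Rightarrow> complex" where
  "dot r x y = (\<Sum>i\<in>{1..r}. x i * y i)"

abbreviation nonzero :: "nat \<Rightarrow> (nat \<Rightarrow> complex) \<Rightarrow> bool" where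
  "nonzero r x \<equiv> \<exists>i\<in>{1..r}. x i \<noteq> 0"

definition lindep :: "nat \<Rightarrow> ('a \<Rightarrow> nat \<Rightarrow> complex) \<Rightarrow> 'a set \<Rightarrow> bool" where
  "lindep r g A \<longleftrightarrow> family_dependent r (\<lambda>(i, a). g a i) A"

text \<open>Vectors double as linear functionals through the bilinear form \<open>dot\<close>. There
  is no conjugation, so nonzero vectors may be orthogonal to themselves and every formula below
  stays polynomial.\<close>

definition kills :: "nat \<Rightarrow> (nat \<Rightarrow> complex) \<Rightarrow> ('a \<Rightarrow> nat \<Rightarrow> complex) \<Rightarrow> 'a set \<Rightarrow> bool" where
  "kills r l g A \<longleftrightarrow> (\<forall>a\<in>A. dot r l (g a) = 0)"

lemma lindep_iff:
  "lindep r g A \<longleftrightarrow> (\<exists>c. (\<exists>a\<in>A. c a \<noteq> 0) \<and> (\<forall>i\<in>{1..r}. (\<Sum>a\<in>A. c a * g a i) = 0))"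
  by (simp add: lindep_def family_dependent_def)

lemma dot_commute: "dot r x y = dot r y x"
  by (simp add: dot_def mult.commute)

lemma dot_add_left: "dot r (\<lambda>i. x i + y i) z = dot r x z + dot r y z"
  and dot_add_right: "dot r z (\<lambda>i. x i + y i) = dot r z x + dot r z y"
  and dot_diff_left: "dot r (\<lambda>i. x i - y i) z = dot r x z - dot r y z"
  and dot_diff_right: "dot r z (\<lambda>i. x i - y i) = dot r z x - dot r z y"
  and dot_scale_left: "dot r (\<lambda>i. c * x i) z = c * dot r x z"
  and dot_scale_right: "dot r z (\<lambda>i. c * x i) = c * dot r z x"
  by (simp_all add: dot_def algebra_simps sum.distrib sum_subtractf sum_distrib_left)

lemmas dot_linear =
  dot_add_left dot_add_right dot_diff_left dot_diff_right dot_scale_left dot_scale_right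

lemma dot_sum_right: "dot r z (\<lambda>i. \<Sum>a\<in>A. f a i) = (\<Sum>a\<in>A. dot r z (f a))"
  by (simp add: dot_def sum_distrib_left sum.swap[of _ A])

lemma dot_cong: "(\<And>i. i \<in> {1..r} \<Longrightarrow> x i = x' i) \<Longrightarrow> (\<And>i. i \<in> {1..r} \<Longrightarrow> y i = y' i) \<Longrightarrow> dot r x y = dot r x' y'"
  by (simp add: dot_def)

lemma lindep_cong:
  assumes "\<And>a i. a \<in> A \<Longrightarrow> i \<in> {1..r} \<Longrightarrow> g a i = g' a i"
  shows "lindep r g A = lindep r g' A"
proof -
  have "(\<Sum>a\<in>A. c a * g a i) = (\<Sum>a\<in>A. c a * g' a i)" if "i \<in> {1..r}" for c i
    using assms that by (intro sum.cong) auto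
  then show ?thesis unfolding lindep_iff by auto
qed

text \<open>Elimination: an equation with a coefficient \<open>m i k \<noteq> 0\<close> expresses
  \<open>x k\<close> by the other unknowns and leaves a system with one equation and one unknown
  fewer. The dimension counts below rest on this lemma.\<close>

lemma underdetermined_system:
  fixes m :: "'i \<Rightarrow> 'j \<Rightarrow> 'f::field"
  assumes "finite I" "finite J" "card I < card J"
  shows "\<exists>x. (\<exists>j\<in>J. x j \<noteq> 0) \<and> (\<forall>i\<in>I. (\<Sum>j\<in>J. m i j * x j) = 0)"
  using assms
proof (induction I arbitrary: J m rule: finite_induct)
  case empty
  then have "J \<noteq> {}" by auto
  then show ?case by (intro exI[of _ "\<lambda>_. 1"]) auto
next
  case (insert i I)
  show ?case
  proof (cases "\<forall>j\<in>J. m i j = 0")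
    case True
    have "card I < card J" using insert by simp
    from insert.IH[OF insert.prems(1) this, of m] obtain x where
      "\<exists>j\<in>J. x j \<noteq> 0" "\<forall>i\<in>I. (\<Sum>j\<in>J. m i j * x j) = 0" by blast
    then show ?thesis using True by (intro exI[of _ x]) auto
  next
    case False
    then obtain k where k: "k \<in> J" "m i k \<noteq> 0" by blast
    define J' where "J' = J - {k}"
    have J: "J = insert k J'" "k \<notin> J'" "finite J'" using k insert.prems by (auto simp: J'_def)
    have "card I < card J'" using insert J by simp
    from insert.IH[OF J(3) this, of "\<lambda>h j. m h j - m h k * m i j / m i k"] obtain x where
      x: "\<exists>j\<in>J'. x j \<noteq> 0" "\<forall>h\<in>I. (\<Sum>j\<in>J'. (m h j - m h k * m i j / m i k) * x j) = 0" by blast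
    define s where "s = (\<Sum>j\<in>J'. m i j * x j)"
    define y where "y = (\<lambda>j. if j = k then - s / m i k else x j)"
    have *: "(\<Sum>j\<in>J. m h j * y j) = - m h k * s / m i k + (\<Sum>j\<in>J'. m h j * x j)" for h
    proof -
      have "(\<Sum>j\<in>J'. m h j * y j) = (\<Sum>j\<in>J'. m h j * x j)"
        using J(2) by (intro sum.cong) (auto simp: y_def)
      then show ?thesis using J by (simp add: y_def)
    qed
    have "(\<Sum>j\<in>J. m h j * y j) = 0" if "h \<in> I" for h
    proof -
      have "0 = (\<Sum>j\<in>J'. (m h j - m h k * m i j / m i k) * x j)" using x(2) that by simp
      also have "\<dots> = (\<Sum>j\<in>J'. m h j * x j) - m h k / m i k * s"
        by (simp add: s_def algebra_simps sum_subtractf sum_distrib_left)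
      finally show ?thesis unfolding * by simp
    qed
    moreover have "(\<Sum>j\<in>J. m i j * y j) = 0" unfolding * using k by (simp add: s_def)
    moreover have "\<exists>j\<in>J. y j \<noteq> 0" using x(1) J by (auto simp: y_def)
    ultimately show ?thesis by (intro exI[of _ y]) auto
  qed
qed

lemma card_gt_imp_lindep:
  assumes "finite A" "r < card A"
  shows "lindep r g A"
proof -
  obtain x where "\<exists>a\<in>A. x a \<noteq> 0" "\<forall>i\<in>{1..r}. (\<Sum>a\<in>A. g a i * x a) = 0"
    using underdetermined_system[of "{1..r}" A "\<lambda>i a. g a i"] assms by auto
  then show ?thesis unfolding lindep_iff by (intro exI[of _ x]) (auto simp: mult.commute)
qed

lemma exists_killing:
  assumes "finite A" "card A < r"
  shows "\<exists>l. nonzero r l \<and> kills r l g A"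
proof -
  obtain x where "\<exists>i\<in>{1..r}. x i \<noteq> 0" "\<forall>a\<in>A. (\<Sum>i\<in>{1..r}. g a i * x i) = 0"
    using underdetermined_system[of A "{1..r}" "\<lambda>a i. g a i"] assms by auto
  then show ?thesis unfolding kills_def dot_def by (intro exI[of _ x]) (auto simp: mult.commute)
qed

lemma lindep_mono:
  assumes "lindep r g A" "A \<subseteq> B" "finite B"
  shows "lindep r g B"
proof -
  obtain c where c: "\<exists>a\<in>A. c a \<noteq> 0" "\<forall>i\<in>{1..r}. (\<Sum>a\<in>A. c a * g a i) = 0"
    using assms(1) unfolding lindep_iff by blast
  have "(\<Sum>a\<in>B. (if a \<in> A then c a else 0) * g a i) = (\<Sum>a\<in>A. c a * g a i)" for i
    using assms(2,3) by (intro sum.mono_neutral_cong_right) auto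
  then show ?thesis using c assms(2) unfolding lindep_iff
    by (intro exI[of _ "\<lambda>a. if a \<in> A then c a else 0"]) auto
qed

lemma kills_span:
  assumes "kills r l g A" "\<And>i. i \<in> {1..r} \<Longrightarrow> w i = (\<Sum>a\<in>A. c a * g a i)"
  shows "dot r l w = 0"
proof -
  have "dot r l w = dot r l (\<lambda>i. \<Sum>a\<in>A. c a * g a i)"
    using assms(2) by (intro dot_cong) auto
  also have "\<dots> = 0"
    using assms(1) by (simp add: dot_sum_right dot_scale_right kills_def)
  finally show ?thesis .
qed

text \<open>Induction on the family. If a functional \<open>e\<close> kills \<open>A\<close> but not
  \<open>b\<close>, removing the component of \<open>w\<close> along \<open>g b\<close> reduces to
  \<open>A\<close>, and a functional found there is corrected by a multiple of \<open>e\<close> to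
  kill \<open>b\<close> too. Otherwise \<open>g b\<close> lies in the span of \<open>A\<close> and
  adds nothing.\<close>

lemma span_or_separating:
  assumes "finite A"
  shows "(\<exists>c. \<forall>i\<in>{1..r}. w i = (\<Sum>a\<in>A. c a * g a i)) \<or> (\<exists>l. kills r l g A \<and> dot r l w = 1)"
  using assms
proof (induction A arbitrary: w rule: finite_induct)
  case empty
  show ?case
  proof (cases "nonzero r w")
    case True
    then obtain i where i: "i \<in> {1..r}" "w i \<noteq> 0" by blast
    have "dot r (\<lambda>j. if j = i then 1 / w i else 0) w = (\<Sum>j\<in>{1..r}. if j = i then 1 else 0)"
      unfolding dot_def using i by (intro sum.cong) auto
    also have "\<dots> = 1" using i by simp
    finally have "dot r (\<lambda>j. if j = i then 1 / w i else 0) w = 1" .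
    then show ?thesis unfolding kills_def by blast
  qed auto
next
  case (insert b A)
  show ?case
  proof (cases "\<exists>l. kills r l g A \<and> dot r l (g b) = 1")
    case False
    then obtain c where c: "\<forall>i\<in>{1..r}. g b i = (\<Sum>a\<in>A. c a * g a i)"
      using insert.IH[of "g b"] by blast
    show ?thesis
    proof (cases "\<exists>l. kills r l g A \<and> dot r l w = 1")
      case True
      then obtain l where l: "kills r l g A" "dot r l w = 1" by blast
      have "dot r l (g b) = 0" using kills_span[OF l(1), of "g b" c] c by auto
      then show ?thesis using l unfolding kills_def by auto
    next
      case False
      then obtain d where d: "\<forall>i\<in>{1..r}. w i = (\<Sum>a\<in>A. d a * g a i)"
        using insert.IH[of w] by blast
      have "(\<Sum>a\<in>insert b A. (if a = b then 0 else d a) * g a i) = (\<Sum>a\<in>A. d a * g a i)" for i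
      proof -
        have "(\<Sum>a\<in>A. (if a = b then 0 else d a) * g a i) = (\<Sum>a\<in>A. d a * g a i)"
          using insert.hyps by (intro sum.cong) auto
        then show ?thesis using insert.hyps by simp
      qed
      then show ?thesis using d by (intro disjI1 exI[of _ "\<lambda>a. if a = b then 0 else d a"]) auto
    qed
  next
    case True
    then obtain e where e: "kills r e g A" "dot r e (g b) = 1" by blast
    define w' where "w' = (\<lambda>i. w i - dot r e w * g b i)"
    from insert.IH[of w'] show ?thesis
    proof
      assume "\<exists>l. kills r l g A \<and> dot r l w' = 1"
      then obtain l where l: "kills r l g A" "dot r l w' = 1" by blast
      define l' where "l' = (\<lambda>i. l i - dot r l (g b) * e i)"
      have "kills r l' g (insert b A)"
        using l e by (auto simp: kills_def l'_def dot_linear)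
      moreover have "dot r l' w = 1"
        using l(2) unfolding l'_def w'_def by (simp only: dot_linear) (simp add: mult.commute)
      ultimately show ?thesis by blast
    next
      assume "\<exists>c. \<forall>i\<in>{1..r}. w' i = (\<Sum>a\<in>A. c a * g a i)"
      then obtain d where d: "\<forall>i\<in>{1..r}. w' i = (\<Sum>a\<in>A. d a * g a i)" by blast
      have "w i = (\<Sum>a\<in>insert b A. (if a = b then dot r e w else d a) * g a i)" if "i \<in> {1..r}" for i
      proof -
        have "(\<Sum>a\<in>A. (if a = b then dot r e w else d a) * g a i) = (\<Sum>a\<in>A. d a * g a i)"
          using insert.hyps by (intro sum.cong) auto
        then show ?thesis using insert.hyps d that by (simp add: w'_def algebra_simps)
      qed
      then show ?thesis by (intro disjI1 exI[of _ "\<lambda>a. if a = b then dot r e w else d a"]) auto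
    qed
  qed
qed

lemma lindep_insertI:
  assumes "finite A" "a \<notin> A" "\<And>i. i \<in> {1..r} \<Longrightarrow> g a i = (\<Sum>b\<in>A. c b * g b i)"
  shows "lindep r g (insert a A)"
proof -
  have "(\<Sum>b\<in>insert a A. (if b = a then -1 else c b) * g b i) = 0" if "i \<in> {1..r}" for i
  proof -
    have "(\<Sum>b\<in>A. (if b = a then -1 else c b) * g b i) = (\<Sum>b\<in>A. c b * g b i)"
      using assms(2) by (intro sum.cong) auto
    then show ?thesis using assms(1,2) assms(3)[OF that] by simp
  qed
  then show ?thesis unfolding lindep_iff by (intro exI[of _ "\<lambda>b. if b = a then -1 else c b"]) auto
qed

lemma not_lindep_insertI:
  assumes "finite A" "\<not> lindep r g A" "a \<notin> A" "kills r l g A" "dot r l (g a) \<noteq> 0"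
  shows "\<not> lindep r g (insert a A)"
proof
  assume "lindep r g (insert a A)"
  then obtain c where c: "\<exists>b\<in>insert a A. c b \<noteq> 0" "\<forall>i\<in>{1..r}. (\<Sum>b\<in>insert a A. c b * g b i) = 0"
    unfolding lindep_iff by blast
  have "0 = dot r l (\<lambda>i. \<Sum>b\<in>insert a A. c b * g b i)"
    using c(2) by (simp add: dot_def)
  also have "\<dots> = (\<Sum>b\<in>insert a A. c b * dot r l (g b))"
    by (simp add: dot_sum_right dot_scale_right)
  also have "\<dots> = c a * dot r l (g a)"
    using assms(1,3,4) by (simp add: kills_def)
  finally have "c a = 0" using assms(5) by simp
  then have "\<exists>b\<in>A. c b \<noteq> 0" "\<forall>i\<in>{1..r}. (\<Sum>b\<in>A. c b * g b i) = 0"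
    using c assms(1,3) by auto
  then show False using assms(2) unfolding lindep_iff by blast
qed

lemma span_of_lindep_insert:
  assumes "finite A" "\<not> lindep r g A" "lindep r g (insert a A)"
  shows "\<exists>c. \<forall>i\<in>{1..r}. g a i = (\<Sum>b\<in>A. c b * g b i)"
proof (rule ccontr)
  assume *: "\<not> ?thesis"
  then obtain l where "kills r l g A" "dot r l (g a) = 1"
    using span_or_separating[OF assms(1), of r "g a" g] by blast
  moreover have "a \<notin> A" using assms(2,3) by (auto simp: insert_absorb)
  ultimately show False using not_lindep_insertI[OF assms(1,2)] assms(3) by force
qed

lemma kills_lindep_insert:
  assumes "finite A" "\<not> lindep r g A" "lindep r g (insert a A)" "kills r l g A"
  shows "dot r l (g a) = 0"
  using span_of_lindep_insert[OF assms(1-3)] kills_span[OF assms(4), of "g a"] by blast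

lemma dual_vector:
  assumes "finite A" "\<not> lindep r g A" "a \<in> A"
  shows "\<exists>l. kills r l g (A - {a}) \<and> dot r l (g a) = 1"
proof (rule ccontr)
  assume "\<not> ?thesis"
  then obtain c where "\<forall>i\<in>{1..r}. g a i = (\<Sum>b\<in>A - {a}. c b * g b i)"
    using span_or_separating[of "A - {a}" r "g a" g] assms(1) by blast
  then have "lindep r g (insert a (A - {a}))"
    using assms(1) by (intro lindep_insertI) auto
  then show False using assms by (simp add: insert_absorb)
qed

text \<open>The converse of \<open>dual_vector\<close>. Independence is tested through dual
  functionals rather than minors, since functionals can be continued along a curve or a
  filter.\<close>

lemma not_lindepI_dual:
  assumes "finite A" "\<And>a. a \<in> A \<Longrightarrow> \<exists>l. kills r l g (A - {a}) \<and> dot r l (g a) \<noteq> 0"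
  shows "\<not> lindep r g A"
proof
  assume "lindep r g A"
  then obtain c a where c: "a \<in> A" "c a \<noteq> 0" "\<forall>i\<in>{1..r}. (\<Sum>b\<in>A. c b * g b i) = 0"
    unfolding lindep_iff by blast
  obtain l where l: "kills r l g (A - {a})" "dot r l (g a) \<noteq> 0" using assms(2)[OF c(1)] by blast
  have "0 = dot r l (\<lambda>i. \<Sum>b\<in>A. c b * g b i)"
    using c(3) by (simp add: dot_def)
  also have "\<dots> = (\<Sum>b\<in>A. c b * dot r l (g b))"
    by (simp add: dot_sum_right dot_scale_right)
  also have "\<dots> = c a * dot r l (g a)"
    using assms(1) c(1) l(1) by (simp add: kills_def sum.remove)
  finally show False using c l by simp
qed

lemma lindep_empty [simp]: "\<not> lindep r g {}"
  by (simp add: lindep_iff)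

lemma lindep_singleton: "lindep r g {a} \<longleftrightarrow> \<not> nonzero r (g a)"
  unfolding lindep_iff by (auto intro: exI[of _ "\<lambda>_. 1"])

lemma exists_dot_one:
  assumes "nonzero r l"
  shows "\<exists>e. dot r l e = 1"
  using dual_vector[of "{()}" r "\<lambda>_. l" "()"] assms
  by (auto simp: lindep_singleton dot_commute)

text \<open>Solve the equations of all coordinates except one, \<open>k\<close>, at which
  \<open>l\<close> is nonzero: there are fewer of them than unknowns. The resulting combination is
  annihilated by \<open>l\<close>, which forces its coordinate \<open>k\<close> to vanish as
  well.\<close>

lemma lindep_of_kills:
  assumes "finite A" "r \<le> card A" "nonzero r l" "kills r l g A"
  shows "lindep r g A"
proof -
  obtain k where k: "k \<in> {1..r}" "l k \<noteq> 0" using assms(3) by blast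
  have "card ({1..r} - {k}) < card A" using k assms(2) by (auto simp: card_Diff_singleton)
  then obtain x where x: "\<exists>a\<in>A. x a \<noteq> 0" "\<forall>i\<in>{1..r}-{k}. (\<Sum>a\<in>A. g a i * x a) = 0"
    using underdetermined_system[of "{1..r} - {k}" A "\<lambda>i a. g a i"] assms(1) by auto
  define s where "s = (\<lambda>i. \<Sum>a\<in>A. x a * g a i)"
  have s: "s i = 0" if "i \<in> {1..r}-{k}" for i using x(2) that by (simp add: s_def mult.commute)
  have "dot r l s = 0" unfolding s_def using assms(4)
    by (simp add: dot_sum_right dot_scale_right kills_def)
  moreover have "dot r l s = l k * s k"
    unfolding dot_def using k(1) s by (subst sum.remove[of _ k]) auto
  ultimately have "s k = 0" using k by simp
  then have "\<forall>i\<in>{1..r}. s i = 0" using s by (metis DiffI singletonD)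
  then show ?thesis using x(1) unfolding lindep_iff s_def by blast
qed

lemma maximal_independent:
  assumes "finite A"
  shows "\<exists>B\<subseteq>A. \<not> lindep r g B \<and> (\<forall>a\<in>A. lindep r g (insert a B) \<or> a \<in> B)"
proof -
  define X where "X = {B. B \<subseteq> A \<and> \<not> lindep r g B}"
  have "finite X" using assms by (auto simp: X_def)
  moreover have "X \<noteq> {}" by (auto simp: X_def)
  ultimately obtain B where B: "B \<in> X" "\<forall>C\<in>X. B \<subseteq> C \<longrightarrow> C = B"
    using finite_has_maximal[of X] by (metis)
  have "lindep r g (insert a B) \<or> a \<in> B" if "a \<in> A" for a
    using B that unfolding X_def by blast
  then show ?thesis using B unfolding X_def by blast
qed

lemma kills_of_maximal:
  assumes "finite B" "\<not> lindep r g B" "\<forall>a\<in>A. lindep r g (insert a B) \<or> a \<in> B" "kills r l g B"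
  shows "kills r l g A"
  unfolding kills_def
proof
  fix a assume "a \<in> A"
  then show "dot r l (g a) = 0"
    using assms kills_lindep_insert[OF assms(1,2) _ assms(4)] by (auto simp: kills_def)
qed

text \<open>A maximal independent subfamily has fewer than \<open>r\<close> members, and whatever
  annihilates it annihilates \<open>A\<close>. Dependence is assumed for \<open>r\<close>-subsets
  because this is what a dependent hyperplane provides.\<close>

lemma exists_killing_of_dependent:
  assumes "finite A" "0 < r" "\<And>B. B \<subseteq> A \<Longrightarrow> card B = r \<Longrightarrow> lindep r g B"
  shows "\<exists>l. nonzero r l \<and> kills r l g A"
proof -
  obtain B where B: "B \<subseteq> A" "\<not> lindep r g B" "\<forall>a\<in>A. lindep r g (insert a B) \<or> a \<in> B"
    using maximal_independent[OF assms(1)] by blast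
  have fB: "finite B" using B(1) assms(1) finite_subset by blast
  have "card B < r"
  proof (rule ccontr)
    assume "\<not> card B < r"
    then obtain C where "C \<subseteq> B" "card C = r" by (meson not_less obtain_subset_with_card_n)
    then show False using assms(3)[of C] B lindep_mono[of r g C B] fB by auto
  qed
  then obtain l where l: "nonzero r l" "kills r l g B" using exists_killing[OF fB] by blast
  then show ?thesis using kills_of_maximal[OF fB B(2,3)] by blast
qed

section \<open>Continuation of orthogonal vectors\<close>

text \<open>
  Both polynomial curves and limits along filters need to deform a vector that is orthogonal to
  independent vectors together with these; the formula for the deformation is division free, so one
  statement about an algebra of functions serves both.
\<close>

definition function_algebra :: "('x \<Rightarrow> complex) set \<Rightarrow> bool" where
  "function_algebra R \<longleftrightarrow> (\<forall>c. (\<lambda>_. c) \<in> R) \<and>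
     (\<forall>f\<in>R. \<forall>g\<in>R. (\<lambda>x. f x + g x) \<in> R \<and> (\<lambda>x. f x - g x) \<in> R \<and> (\<lambda>x. f x * g x) \<in> R)"

lemma function_algebra_sum:
  assumes "function_algebra R" "\<And>i. i \<in> I \<Longrightarrow> f i \<in> R"
  shows "(\<lambda>x. \<Sum>i\<in>I. f i x) \<in> R"
  using assms(2)
proof (induction I rule: infinite_finite_induct)
  case (insert i I)
  then show ?case using assms(1) by (auto simp: function_algebra_def)
qed (use assms(1) in \<open>auto simp: function_algebra_def\<close>)

lemma function_algebra_dot:
  assumes "function_algebra R" "\<And>i. (\<lambda>x. v x i) \<in> R" "\<And>i. (\<lambda>x. w x i) \<in> R"
  shows "(\<lambda>x. dot r (v x) (w x)) \<in> R"
  unfolding dot_def using assms by (intro function_algebra_sum) (auto simp: function_algebra_def)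

lemma orthogonal_continuation:
  assumes "function_algebra R" "finite A" "\<And>a i. a \<in> A \<Longrightarrow> (\<lambda>x. v x a i) \<in> R"
    "\<not> lindep r (v x0) A" "kills r w0 (v x0) A"
  shows "\<exists>w. (\<forall>i. (\<lambda>x. w x i) \<in> R) \<and> w x0 = w0 \<and> (\<forall>x. kills r (w x) (v x) A)"
  using assms(2-5)
proof (induction A arbitrary: w0 rule: finite_induct)
  case empty
  show ?case using assms(1)
    by (intro exI[of _ "\<lambda>_. w0"]) (auto simp: function_algebra_def kills_def)
next
  case (insert b A)
  have ind: "\<not> lindep r (v x0) A"
    using insert.prems(2) lindep_mono[of r "v x0" A "insert b A"] insert.hyps by auto
  obtain e0 where e0: "kills r e0 (v x0) A" "dot r e0 (v x0 b) = 1"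
    using dual_vector[of "insert b A" r "v x0" b] insert by auto
  obtain e where e: "\<And>i. (\<lambda>x. e x i) \<in> R" "e x0 = e0" "\<And>x. kills r (e x) (v x) A"
    using insert.IH[OF insert.prems(1) ind e0(1)] by auto
  have "kills r w0 (v x0) A" using insert.prems(3) by (simp add: kills_def)
  from insert.IH[OF insert.prems(1) ind this]
  obtain u where u: "\<And>i. (\<lambda>x. u x i) \<in> R" "u x0 = w0" "\<And>x. kills r (u x) (v x) A" by auto
  \<comment> \<open>Both coefficients are known at \<open>x0\<close>: that of \<open>u\<close> is 1
    because \<open>e0\<close> is dual to \<open>b\<close>, that of \<open>e\<close> is 0 because
    \<open>w0\<close> already kills \<open>b\<close>. Hence \<open>w\<close> starts at
    \<open>w0\<close> although nothing is divided.\<close>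
  define w where "w = (\<lambda>x i. dot r (e x) (v x b) * u x i - dot r (u x) (v x b) * e x i)"
  have "(\<lambda>x. w x i) \<in> R" for i
    unfolding w_def
    using function_algebra_dot[OF assms(1), of e "\<lambda>x. v x b"] function_algebra_dot[OF assms(1), of u "\<lambda>x. v x b"]
      e(1) u(1) insert.prems(1) assms(1) by (auto simp: function_algebra_def)
  moreover have "w x0 = w0"
    using insert.prems(3) e0 by (simp add: w_def e u kills_def fun_eq_iff)
  moreover have "kills r (w x) (v x) (insert b A)" for x
    using e(3)[of x] u(3)[of x] by (auto simp: w_def kills_def dot_linear)
  ultimately show ?case by blast
qed

subsection \<open>Polynomial curves\<close>

abbreviation polyfun :: "(complex \<Rightarrow> complex) \<Rightarrow> bool" where
  "polyfun f \<equiv> f \<in> range poly"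

lemma function_algebra_polyfun: "function_algebra (range poly)"
proof -
  have "(\<lambda>_. c) \<in> range poly" for c :: complex by (intro image_eqI[of _ _ "[:c:]"]) auto
  moreover have "(\<lambda>x. poly p x + poly q x) \<in> range poly" for p q :: "complex poly"
    by (intro image_eqI[of _ _ "p + q"]) auto
  moreover have "(\<lambda>x. poly p x - poly q x) \<in> range poly" for p q :: "complex poly"
    by (intro image_eqI[of _ _ "p - q"]) auto
  moreover have "(\<lambda>x. poly p x * poly q x) \<in> range poly" for p q :: "complex poly"
    by (intro image_eqI[of _ _ "p * q"]) auto
  ultimately show ?thesis unfolding function_algebra_def by auto
qed

lemma polyfun_const: "polyfun (\<lambda>_. c)"
  and polyfun_add: "polyfun f \<Longrightarrow> polyfun g \<Longrightarrow> polyfun (\<lambda>x. f x + g x)"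
  and polyfun_diff: "polyfun f \<Longrightarrow> polyfun g \<Longrightarrow> polyfun (\<lambda>x. f x - g x)"
  and polyfun_mult: "polyfun f \<Longrightarrow> polyfun g \<Longrightarrow> polyfun (\<lambda>x. f x * g x)"
  using function_algebra_polyfun unfolding function_algebra_def by blast+

lemma polyfun_id: "polyfun (\<lambda>x. x)"
  by (intro image_eqI[of _ _ "[:0, 1:]"]) auto

lemma polyfun_sum: "(\<And>i. i \<in> I \<Longrightarrow> polyfun (f i)) \<Longrightarrow> polyfun (\<lambda>x. \<Sum>i\<in>I. f i x)"
  by (rule function_algebra_sum[OF function_algebra_polyfun])

lemma polyfun_power: "polyfun f \<Longrightarrow> polyfun (\<lambda>x. f x ^ n)"
proof (induction n)
  case (Suc n)
  then show ?case unfolding power_Suc by (intro polyfun_mult)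
qed (simp only: power_0 polyfun_const)

lemma polyfun_prod: "(\<And>i. i \<in> I \<Longrightarrow> polyfun (f i)) \<Longrightarrow> polyfun (\<lambda>x. \<Prod>i\<in>I. f i x)"
proof (induction I rule: infinite_finite_induct)
  case (insert i I)
  show ?case unfolding prod.insert[OF insert.hyps]
    by (intro polyfun_mult insert.IH insert.prems) auto
next
  case (infinite I)
  then show ?case by (subst prod.infinite) (auto intro: polyfun_const)
next
  case empty
  show ?case unfolding prod.empty by (rule polyfun_const)
qed

lemma polyfun_dot: "(\<And>i. polyfun (\<lambda>x. v x i)) \<Longrightarrow> (\<And>i. polyfun (\<lambda>x. w x i)) \<Longrightarrow> polyfun (\<lambda>x. dot r (v x) (w x))"
  by (rule function_algebra_dot[OF function_algebra_polyfun])

lemma polyfun_cofinite: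
  assumes "polyfun f" "f t0 \<noteq> 0"
  shows "\<forall>\<^sub>F t in cofinite. f t \<noteq> 0"
proof -
  obtain p where "f = poly p" using assms(1) by blast
  moreover have "p \<noteq> 0" using assms(2) calculation by auto
  ultimately show ?thesis using poly_roots_finite[of p] by (simp add: eventually_cofinite)
qed

lemma cofinite_complex_neq_bot [simp]: "(cofinite :: complex filter) \<noteq> bot"
  by (simp add: infinite_UNIV_char_0)

lemma polyfun_frequently_zero:
  assumes "polyfun f" "\<exists>\<^sub>F t in cofinite. f t = 0"
  shows "f t = 0"
proof (rule ccontr)
  assume "f t \<noteq> 0"
  from polyfun_cofinite[OF assms(1) this] show False
    using assms(2) unfolding frequently_def by simp
qed

text \<open>A dual functional for \<open>a\<close> at \<open>t0\<close> continues to all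
  \<open>t\<close>, and its pairing with \<open>v t a\<close> is a polynomial with value 1 at
  \<open>t0\<close>, hence zero only finitely often.\<close>

lemma independent_cofinite:
  assumes "finite A" "\<And>a i. a \<in> A \<Longrightarrow> polyfun (\<lambda>t. v t a i)" "\<not> lindep r (v t0) A"
  shows "\<forall>\<^sub>F t in cofinite. \<not> lindep r (v t) A"
proof -
  have "\<forall>\<^sub>F t in cofinite. \<exists>l. kills r l (v t) (A - {a}) \<and> dot r l (v t a) \<noteq> 0" if a: "a \<in> A" for a
  proof -
    obtain l0 where l0: "kills r l0 (v t0) (A - {a})" "dot r l0 (v t0 a) = 1"
      using dual_vector[OF assms(1,3) a] by blast
    have "\<not> lindep r (v t0) (A - {a})" using assms(1,3) lindep_mono[of r "v t0" "A - {a}" A] by auto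
    then obtain l where l: "\<And>i. polyfun (\<lambda>t. l t i)" "l t0 = l0" "\<And>t. kills r (l t) (v t) (A - {a})"
      using orthogonal_continuation[OF function_algebra_polyfun, of "A - {a}" v r t0 l0] assms l0 by auto
    have "polyfun (\<lambda>t. dot r (l t) (v t a))" using l(1) assms(2)[OF a] by (intro polyfun_dot)
    then have "\<forall>\<^sub>F t in cofinite. dot r (l t) (v t a) \<noteq> 0"
      using l0 l(2) by (intro polyfun_cofinite[of _ t0]) auto
    then show ?thesis by (rule eventually_mono) (use l(3) in auto)
  qed
  then have "\<forall>\<^sub>F t in cofinite. \<forall>a\<in>A. \<exists>l. kills r l (v t) (A - {a}) \<and> dot r l (v t a) \<noteq> 0"
    using assms(1) by (intro eventually_ball_finite) auto
  then show ?thesis by (rule eventually_mono) (use not_lindepI_dual[OF assms(1)] in blast)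
qed

lemma nonzero_cofinite:
  assumes "\<And>i. polyfun (\<lambda>t. v t i)" "nonzero r (v t0)"
  shows "\<forall>\<^sub>F t in cofinite. nonzero r (v t)"
  using independent_cofinite[of "{()}" "\<lambda>t _. v t" r t0] assms by (simp add: lindep_singleton)

text \<open>One continuation starts at each end. For fixed \<open>t\<close> the orthogonality
  conditions are linear, so the combination with weights \<open>1 - t\<close> and \<open>t\<close>
  satisfies them as well and has both prescribed ends.\<close>

lemma orthogonal_curve:
  assumes "finite A" "\<And>a i. a \<in> A \<Longrightarrow> polyfun (\<lambda>t. v t a i)"
    "\<not> lindep r (v 0) A" "\<not> lindep r (v 1) A" "kills r w0 (v 0) A" "kills r w1 (v 1) A"
  shows "\<exists>w. (\<forall>i. polyfun (\<lambda>t. w t i)) \<and> w 0 = w0 \<and> w 1 = w1 \<and> (\<forall>t. kills r (w t) (v t) A)"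
proof -
  obtain p where p: "\<And>i. polyfun (\<lambda>t. p t i)" "p 0 = w0" "\<And>t. kills r (p t) (v t) A"
    using orthogonal_continuation[OF function_algebra_polyfun, of A v r 0 w0] assms by auto
  obtain q where q: "\<And>i. polyfun (\<lambda>t. q t i)" "q 1 = w1" "\<And>t. kills r (q t) (v t) A"
    using orthogonal_continuation[OF function_algebra_polyfun, of A v r 1 w1] assms by auto
  define w where "w = (\<lambda>t i. (1 - t) * p t i + t * q t i)"
  have "polyfun (\<lambda>t. w t i)" for i unfolding w_def using p(1) q(1)
    by (intro polyfun_add polyfun_mult polyfun_diff polyfun_const polyfun_id)
  moreover have "w 0 = w0" "w 1 = w1" by (simp_all add: w_def p q)
  moreover have "kills r (w t) (v t) A" for t
    using p(3)[of t] q(3)[of t] by (auto simp: w_def kills_def dot_linear)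
  ultimately show ?thesis by blast
qed

section \<open>Evaluation and substitution of polynomials\<close>

definition monomial_value :: "('v \<Rightarrow> 'b::comm_monoid_mult) \<Rightarrow> ('v \<Rightarrow>\<^sub>0 nat) \<Rightarrow> 'b" where
  "monomial_value \<gamma> m = (\<Prod>v\<in>Poly_Mapping.keys m. \<gamma> v ^ Poly_Mapping.lookup m v)"

lemma monomial_value_superset:
  assumes "finite S" "Poly_Mapping.keys m \<subseteq> S"
  shows "monomial_value \<gamma> m = (\<Prod>v\<in>S. \<gamma> v ^ Poly_Mapping.lookup m v)"
  unfolding monomial_value_def using assms
  by (intro prod.mono_neutral_left) (auto simp: in_keys_iff)

lemma monomial_value_add: "monomial_value \<gamma> (m + n) = monomial_value \<gamma> m * monomial_value \<gamma> n"
proof -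
  let ?S = "Poly_Mapping.keys m \<union> Poly_Mapping.keys n"
  have "monomial_value \<gamma> (m + n) = (\<Prod>v\<in>?S. \<gamma> v ^ Poly_Mapping.lookup (m + n) v)"
    by (rule monomial_value_superset) (use Poly_Mapping.keys_add[of m n] in auto)
  also have "\<dots> = (\<Prod>v\<in>?S. \<gamma> v ^ Poly_Mapping.lookup m v) * (\<Prod>v\<in>?S. \<gamma> v ^ Poly_Mapping.lookup n v)"
    by (simp add: lookup_add power_add prod.distrib)
  finally show ?thesis by (simp add: monomial_value_superset[of ?S])
qed

lemma peval_superset:
  assumes "finite S" "Poly_Mapping.keys p \<subseteq> S"
  shows "peval \<gamma> p = (\<Sum>m\<in>S. Poly_Mapping.lookup p m * monomial_value \<gamma> m)"
  unfolding peval_def monomial_value_def using assms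
  by (intro sum.mono_neutral_left) (auto simp: in_keys_iff)

lemma peval_add: "peval \<gamma> (p + q) = peval \<gamma> p + peval \<gamma> q"
proof -
  let ?S = "Poly_Mapping.keys p \<union> Poly_Mapping.keys q"
  have "peval \<gamma> (p + q) = (\<Sum>m\<in>?S. Poly_Mapping.lookup (p + q) m * monomial_value \<gamma> m)"
    by (rule peval_superset) (use Poly_Mapping.keys_add[of p q] in auto)
  then show ?thesis
    by (simp add: lookup_add algebra_simps sum.distrib peval_superset[of ?S])
qed

lemma peval_zero [simp]: "peval \<gamma> 0 = 0"
  by (simp add: peval_def)

lemma peval_sum: "peval \<gamma> (\<Sum>i\<in>I. f i) = (\<Sum>i\<in>I. peval \<gamma> (f i))"
  by (induction I rule: infinite_finite_induct) (simp_all add: peval_add)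

lemma peval_single: "peval \<gamma> (Poly_Mapping.single m c) = c * monomial_value \<gamma> m"
  by (subst peval_superset[of "{m}"]) (auto simp: lookup_single split: if_splits)

lemma poly_mapping_as_sum:
  "p = (\<Sum>m\<in>Poly_Mapping.keys p. Poly_Mapping.single m (Poly_Mapping.lookup p m))"
proof (rule poly_mapping_eqI)
  fix k
  have "(\<Sum>m\<in>Poly_Mapping.keys p. Poly_Mapping.lookup p m when m = k) = Poly_Mapping.lookup p k"
  proof (cases "k \<in> Poly_Mapping.keys p")
    case True
    then show ?thesis by (simp add: sum.remove when_def)
  next
    case False
    then show ?thesis by (auto simp: in_keys_iff when_def intro!: sum.neutral)
  qed
  then show "Poly_Mapping.lookup p k =
      Poly_Mapping.lookup (\<Sum>m\<in>Poly_Mapping.keys p. Poly_Mapping.single m (Poly_Mapping.lookup p m)) k"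
    by (simp add: lookup_sum lookup_single)
qed

lemma peval_mult: "peval \<gamma> (p * q) = peval \<gamma> p * peval \<gamma> q"
proof -
  let ?p = "Poly_Mapping.lookup p" and ?q = "Poly_Mapping.lookup q"
  have "p * q = (\<Sum>m\<in>Poly_Mapping.keys p. \<Sum>n\<in>Poly_Mapping.keys q. Poly_Mapping.single (m + n) (?p m * ?q n))"
    by (subst poly_mapping_as_sum[of p], subst poly_mapping_as_sum[of q])
      (simp add: sum_product mult_single)
  then have "peval \<gamma> (p * q) =
      (\<Sum>m\<in>Poly_Mapping.keys p. \<Sum>n\<in>Poly_Mapping.keys q. (?p m * monomial_value \<gamma> m) * (?q n * monomial_value \<gamma> n))"
    by (simp add: peval_sum peval_single monomial_value_add algebra_simps)
  also have "\<dots> = peval \<gamma> p * peval \<gamma> q"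
    by (simp add: sum_product[symmetric] peval_superset[of "Poly_Mapping.keys p"] peval_superset[of "Poly_Mapping.keys q"])
  finally show ?thesis .
qed

lemma peval_Const [simp]: "peval \<gamma> (Const c) = c"
  by (simp add: Const_def peval_single monomial_value_def)

lemma peval_Var [simp]: "peval \<gamma> (Var v) = \<gamma> v"
  by (simp add: Var_def peval_single monomial_value_def)

lemma Const_one: "Const 1 = 1"
  by (simp add: Const_def)

lemma Const_zero: "Const 0 = 0"
  by (simp add: Const_def)

lemma Const_mult: "Const (a * b) = Const a * Const b"
  by (simp add: Const_def mult_single)

lemma Const_add: "Const (a + b) = Const a + Const b"
  by (simp add: Const_def single_add)

lemma Const_uminus: "Const (- a) = - Const a"
  by (simp add: Const_def single_uminus)

lemma peval_one [simp]: "peval \<gamma> 1 = 1"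
  by (metis Const_one peval_Const)

lemma peval_uminus: "peval \<gamma> (- p) = - peval \<gamma> p"
  using peval_add[of \<gamma> p "- p"] by (simp add: eq_neg_iff_add_eq_0 add.commute)

lemma peval_diff: "peval \<gamma> (p - q) = peval \<gamma> p - peval \<gamma> q"
  using peval_add[of \<gamma> p "- q"] by (simp add: peval_uminus)

lemma peval_power: "peval \<gamma> (p ^ k) = peval \<gamma> p ^ k"
  by (induction k) (simp_all add: peval_mult)

lemma peval_prod: "peval \<gamma> (\<Prod>i\<in>I. f i) = (\<Prod>i\<in>I. peval \<gamma> (f i))"
  by (induction I rule: infinite_finite_induct) (simp_all add: peval_mult)

lemma peval_psubst: "peval \<gamma> (psubst \<sigma> p) = peval (\<lambda>v. peval \<gamma> (\<sigma> v)) p"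
  by (simp add: psubst_def peval_sum peval_mult peval_prod peval_power peval_def[of "\<lambda>v. peval \<gamma> (\<sigma> v)"])

lemma peval_cong:
  assumes "\<And>v. v \<in> indets p \<Longrightarrow> \<gamma> v = \<delta> v"
  shows "peval \<gamma> p = peval \<delta> p"
  unfolding peval_def using assms
  by (intro sum.cong refl arg_cong2[of _ _ _ _ "(*)"] prod.cong arg_cong2[of _ _ _ _ "(^)"]) (auto simp: indets_def)

lemma polyfun_peval:
  assumes "\<And>v. polyfun (\<lambda>t. h t v)"
  shows "polyfun (\<lambda>t. peval (h t) p)"
  unfolding peval_def using assms by (intro polyfun_sum polyfun_mult polyfun_prod polyfun_power polyfun_const)

lemma tendsto_peval:
  assumes "\<And>v. v \<in> indets p \<Longrightarrow> ((\<lambda>x. h x v) \<longlongrightarrow> h0 v) F"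
  shows "((\<lambda>x. peval (h x) p) \<longlongrightarrow> peval h0 p) F"
  unfolding peval_def
proof (intro tendsto_sum tendsto_mult tendsto_const tendsto_prod tendsto_power)
  fix m v assume "m \<in> Poly_Mapping.keys p" "v \<in> Poly_Mapping.keys m"
  then show "((\<lambda>x. h x v) \<longlongrightarrow> h0 v) F" using assms by (auto simp: indets_def)
qed

section \<open>Polynomials in a given set of variables\<close>

definition pring :: "'v set \<Rightarrow> 'v cpoly set" where
  "pring J = {p. indets p \<subseteq> J}"

lemma pring_iff: "p \<in> pring J \<longleftrightarrow> (\<forall>m\<in>Poly_Mapping.keys p. Poly_Mapping.keys m \<subseteq> J)"
  by (auto simp: pring_def indets_def)

lemma carrier_poly_ring: "carrier (poly_ring J) = pring J"
  by (simp add: poly_ring_def pring_def)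

lemma pring_add [intro]: "p \<in> pring J \<Longrightarrow> q \<in> pring J \<Longrightarrow> p + q \<in> pring J"
  using Poly_Mapping.keys_add[of p q] unfolding pring_iff by blast

lemma pring_uminus [intro]: "p \<in> pring J \<Longrightarrow> - p \<in> pring J"
  unfolding pring_iff by (auto simp: in_keys_iff)

lemma pring_diff [intro]: "p \<in> pring J \<Longrightarrow> q \<in> pring J \<Longrightarrow> p - q \<in> pring J"
  using pring_add[of p J "- q"] by auto

lemma pring_mult [intro]:
  assumes "p \<in> pring J" "q \<in> pring J"
  shows "p * q \<in> pring J"
  unfolding pring_iff
proof
  fix m assume "m \<in> Poly_Mapping.keys (p * q)"
  then obtain a b where "m = a + b" "a \<in> Poly_Mapping.keys p" "b \<in> Poly_Mapping.keys q"
    using keys_mult[of p q] by blast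
  then show "Poly_Mapping.keys m \<subseteq> J"
    using assms Poly_Mapping.keys_add[of a b] unfolding pring_iff by blast
qed

lemma pring_Const [simp, intro]: "Const c \<in> pring J"
  by (auto simp: pring_iff Const_def split: if_splits)

lemma pring_zero [simp, intro]: "0 \<in> pring J"
  by (simp add: pring_iff)

lemma pring_one [simp, intro]: "1 \<in> pring J"
  by (simp add: pring_iff)

lemma pring_Var [intro]: "v \<in> J \<Longrightarrow> Var v \<in> pring J"
  by (simp add: pring_iff Var_def)

lemma pring_sum [intro]: "(\<And>i. i \<in> I \<Longrightarrow> f i \<in> pring J) \<Longrightarrow> (\<Sum>i\<in>I. f i) \<in> pring J"
  by (induction I rule: infinite_finite_induct) auto

lemma pring_prod [intro]: "(\<And>i. i \<in> I \<Longrightarrow> f i \<in> pring J) \<Longrightarrow> (\<Prod>i\<in>I. f i) \<in> pring J"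
  by (induction I rule: infinite_finite_induct) auto

lemma pring_power [intro]: "p \<in> pring J \<Longrightarrow> p ^ k \<in> pring J"
  by (induction k) auto

lemma pring_psubst:
  assumes "p \<in> pring J" "\<And>v. v \<in> J \<Longrightarrow> \<sigma> v \<in> pring K"
  shows "psubst \<sigma> p \<in> pring K"
  unfolding psubst_def
proof (intro pring_sum pring_mult pring_Const pring_prod pring_power)
  fix m v assume "m \<in> Poly_Mapping.keys p" "v \<in> Poly_Mapping.keys m"
  then show "\<sigma> v \<in> pring K" using assms unfolding pring_iff[of p] by blast
qed

lemma Var_power: "Var v ^ n = Poly_Mapping.single (Poly_Mapping.single v n) 1"
  by (induction n) (simp_all add: Var_def mult_single single_add[symmetric])

text \<open>Exhibits a polynomial as sums and products of constants and variables, so that a set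
  closed under these operations contains it; it also shows that replacing nothing changes no
  generator.\<close>

lemma psubst_Var: "psubst Var p = p"
proof -
  have prod_single: "(\<Prod>v\<in>S. Poly_Mapping.single (f v) (1::complex)) = Poly_Mapping.single (\<Sum>v\<in>S. f v) 1"
    for S :: "'a set" and f :: "'a \<Rightarrow> 'a \<Rightarrow>\<^sub>0 nat"
    by (induction S rule: infinite_finite_induct) (simp_all add: mult_single)
  have "(\<Prod>v\<in>Poly_Mapping.keys m. Var v ^ Poly_Mapping.lookup m v) = Poly_Mapping.single m 1" for m :: "'a \<Rightarrow>\<^sub>0 nat"
    by (simp add: Var_power prod_single poly_mapping_as_sum[symmetric])
  then show ?thesis
    by (simp add: psubst_def Const_def mult_single poly_mapping_as_sum[symmetric])
qed

section \<open>Hilbert's Nullstellensatz over the complex numbers\<close>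

definition poly_ideal :: "'v set \<Rightarrow> 'v cpoly set \<Rightarrow> bool" where
  "poly_ideal J I \<longleftrightarrow> I \<subseteq> pring J \<and> 0 \<in> I \<and> (\<forall>a\<in>I. \<forall>b\<in>I. a + b \<in> I) \<and> (\<forall>a\<in>I. \<forall>p\<in>pring J. p * a \<in> I)"

lemma poly_idealD:
  assumes "poly_ideal J I"
  shows "a \<in> I \<Longrightarrow> a \<in> pring J" "0 \<in> I" "a \<in> I \<Longrightarrow> b \<in> I \<Longrightarrow> a + b \<in> I"
    "a \<in> I \<Longrightarrow> p \<in> pring J \<Longrightarrow> p * a \<in> I" "a \<in> I \<Longrightarrow> - a \<in> I" "a \<in> I \<Longrightarrow> b \<in> I \<Longrightarrow> a - b \<in> I"
proof -
  show 1: "a \<in> I \<Longrightarrow> a \<in> pring J" "0 \<in> I" "a \<in> I \<Longrightarrow> b \<in> I \<Longrightarrow> a + b \<in> I"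
    "a \<in> I \<Longrightarrow> p \<in> pring J \<Longrightarrow> p * a \<in> I" for a b p
    using assms by (auto simp: poly_ideal_def)
  show 2: "a \<in> I \<Longrightarrow> - a \<in> I" for a using 1(4)[of a "- 1"] pring_uminus[OF pring_one, of J] by simp
  show "a \<in> I \<Longrightarrow> b \<in> I \<Longrightarrow> a - b \<in> I" using 1(3)[of a "- b"] 2 by simp
qed

lemma poly_ideal_sum:
  assumes "poly_ideal J I" "\<And>i. i \<in> K \<Longrightarrow> f i \<in> I"
  shows "(\<Sum>i\<in>K. f i) \<in> I"
  using assms(2) by (induction K rule: infinite_finite_induct) (auto intro: poly_idealD[OF assms(1)])

text \<open>Zorn's lemma, as the union of a nonempty chain of ideals avoiding the powers of
  \<open>f\<close> is again one.\<close>

lemma exists_maximal_avoiding: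
  assumes "poly_ideal J I" "\<And>k. f ^ k \<notin> I"
  shows "\<exists>P. poly_ideal J P \<and> I \<subseteq> P \<and> (\<forall>k. f ^ k \<notin> P) \<and>
    (\<forall>Q. poly_ideal J Q \<and> P \<subseteq> Q \<and> (\<forall>k. f ^ k \<notin> Q) \<longrightarrow> Q = P)"
proof -
  define \<A> where "\<A> = {Q. poly_ideal J Q \<and> I \<subseteq> Q \<and> (\<forall>k. f ^ k \<notin> Q)}"
  have "\<A> \<noteq> {}" using assms by (auto simp: \<A>_def)
  moreover have "\<Union>\<C> \<in> \<A>" if C: "\<C> \<noteq> {}" "subset.chain \<A> \<C>" for \<C>
  proof -
    have sub: "Q \<in> \<A>" if "Q \<in> \<C>" for Q using C(2) that by (auto simp: subset.chain_def)
    have tot: "Q \<subseteq> Q' \<or> Q' \<subseteq> Q" if "Q \<in> \<C>" "Q' \<in> \<C>" for Q Q'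
      using C(2) that by (auto simp: subset.chain_def)
    have id: "poly_ideal J Q" "I \<subseteq> Q" "\<And>k. f ^ k \<notin> Q" if "Q \<in> \<C>" for Q
      using sub[OF that] by (auto simp: \<A>_def)
    obtain Q0 where Q0: "Q0 \<in> \<C>" using C(1) by blast
    have "poly_ideal J (\<Union>\<C>)"
      unfolding poly_ideal_def
    proof (intro conjI ballI)
      show "\<Union>\<C> \<subseteq> pring J" using poly_idealD(1)[OF id(1)] by blast
      show "0 \<in> \<Union>\<C>" using poly_idealD(2)[OF id(1)[OF Q0]] Q0 by blast
    next
      fix a b assume "a \<in> \<Union>\<C>" "b \<in> \<Union>\<C>"
      then obtain Q Q' where "Q \<in> \<C>" "a \<in> Q" "Q' \<in> \<C>" "b \<in> Q'" by blast
      then obtain R where R: "R \<in> \<C>" "a \<in> R" "b \<in> R" using tot[of Q Q'] by blast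
      then show "a + b \<in> \<Union>\<C>" using poly_idealD(3)[OF id(1)[OF R(1)]] by blast
    next
      fix a p assume "a \<in> \<Union>\<C>" and p: "p \<in> pring J"
      then obtain Q where Q: "Q \<in> \<C>" "a \<in> Q" by blast
      then show "p * a \<in> \<Union>\<C>" using poly_idealD(4)[OF id(1)[OF Q(1)] Q(2) p] by blast
    qed
    moreover have "I \<subseteq> \<Union>\<C>" using id(2)[OF Q0] Q0 by blast
    ultimately show ?thesis using id(3) unfolding \<A>_def by blast
  qed
  ultimately obtain P where "P \<in> \<A>" "\<forall>X\<in>\<A>. P \<subseteq> X \<longrightarrow> X = P"
    using subset_Zorn_nonempty[of \<A>] by blast
  then have P: "poly_ideal J P" "I \<subseteq> P" "\<forall>k. f ^ k \<notin> P"
    and max: "\<And>X. X \<in> \<A> \<Longrightarrow> P \<subseteq> X \<Longrightarrow> X = P"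
    unfolding \<A>_def by simp_all
  show ?thesis
  proof (intro exI[of _ P] conjI P allI impI)
    fix Q assume Q: "poly_ideal J Q \<and> P \<subseteq> Q \<and> (\<forall>k. f ^ k \<notin> Q)"
    then have "Q \<in> \<A>" using P(2) unfolding \<A>_def by auto
    then show "Q = P" using max Q by simp
  qed
qed

lemma infinite_fibre:
  assumes "countable Y" "range f \<subseteq> Y" "uncountable (UNIV :: 'a set)"
  shows "\<exists>y\<in>Y. infinite {x::'a. f x = y}"
proof (rule ccontr)
  assume "\<not> ?thesis"
  then have "countable (\<Union>y\<in>Y. {x. f x = y})"
    using assms(1) by (intro countable_UN) (auto intro: countable_finite)
  moreover have "(\<Union>y\<in>Y. {x. f x = y}) = UNIV" using assms(2) by auto
  ultimately show False using assms(3) by simp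
qed

lemma countable_monomials:
  assumes "finite J"
  shows "countable {m :: 'v \<Rightarrow>\<^sub>0 nat. Poly_Mapping.keys m \<subseteq> J}"
proof -
  let ?f = "\<lambda>m :: 'v \<Rightarrow>\<^sub>0 nat. restrict (Poly_Mapping.lookup m) J"
  have "inj_on ?f {m. Poly_Mapping.keys m \<subseteq> J}"
  proof (rule inj_onI)
    fix m n :: "'v \<Rightarrow>\<^sub>0 nat"
    assume *: "m \<in> {m. Poly_Mapping.keys m \<subseteq> J}" "n \<in> {m. Poly_Mapping.keys m \<subseteq> J}" "?f m = ?f n"
    show "m = n"
    proof (rule poly_mapping_eqI)
      fix v show "Poly_Mapping.lookup m v = Poly_Mapping.lookup n v"
      proof (cases "v \<in> J")
        case True
        then show ?thesis using fun_cong[OF *(3), of v] by simp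
      next
        case False
        then have "v \<notin> Poly_Mapping.keys m" "v \<notin> Poly_Mapping.keys n" using *(1,2) by auto
        then show ?thesis by (simp only: in_keys_iff not_not)
      qed
    qed
  qed
  moreover have "countable (?f ` {m. Poly_Mapping.keys m \<subseteq> J})"
    by (rule countable_subset[of _ "J \<rightarrow>\<^sub>E UNIV"]) (auto intro: countable_PiE assms)
  ultimately show ?thesis by (rule countable_image_inj_on[rotated])
qed

lemma lookup_Const_mult: "Poly_Mapping.lookup (Const c * p) m = c * Poly_Mapping.lookup p m"
  by (simp add: Const_def mult_map_scale_conv_mult[symmetric] Poly_Mapping.map.rep_eq when_def)

text \<open>The embedding of the one-variable polynomials that sends the variable to
  \<open>Var v\<close>; it carries factorizations over the complex numbers into the polynomial
  ring.\<close>

definition univariate :: "'v \<Rightarrow> complex poly \<Rightarrow> 'v cpoly" where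
  "univariate v q = poly (map_poly Const q) (Var v)"

lemma univariate_0: "univariate v 0 = 0"
  and univariate_pCons: "univariate v (pCons a q) = Const a + Var v * univariate v q"
  by (simp_all add: univariate_def map_poly_pCons Const_zero)

lemma univariate_add: "univariate v (p + q) = univariate v p + univariate v q"
  by (induction p q rule: poly_induct2) (simp_all add: univariate_0 univariate_pCons Const_add algebra_simps)

lemma univariate_smult: "univariate v (smult a q) = Const a * univariate v q"
  by (induction q) (simp_all add: univariate_0 univariate_pCons Const_mult algebra_simps)

lemma univariate_mult: "univariate v (p * q) = univariate v p * univariate v q"
  by (induction p) (simp_all add: univariate_0 univariate_pCons univariate_add univariate_smult Const_zero algebra_simps)

lemma univariate_1: "univariate v 1 = 1"
  by (simp add: univariate_pCons univariate_0 one_pCons Const_one)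

lemma univariate_sum: "univariate v (\<Sum>i\<in>I. f i) = (\<Sum>i\<in>I. univariate v (f i))"
  by (induction I rule: infinite_finite_induct) (simp_all add: univariate_0 univariate_add)

lemma univariate_prod: "univariate v (\<Prod>i\<in>I. f i) = (\<Prod>i\<in>I. univariate v (f i))"
  by (induction I rule: infinite_finite_induct) (simp_all add: univariate_1 univariate_mult)

lemma pring_univariate: "v \<in> J \<Longrightarrow> univariate v q \<in> pring J"
  by (induction q) (auto simp: univariate_0 univariate_pCons)

lemma Const_notin_ideal:
  assumes "poly_ideal J P" "1 \<notin> P" "c \<noteq> 0"
  shows "Const c \<notin> P"
proof
  assume "Const c \<in> P"
  then have "Const (1 / c) * Const c \<in> P" using poly_idealD(4)[OF assms(1)] by blast
  then show False using assms(2,3) by (simp add: Const_mult[symmetric] Const_one)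
qed

text \<open>By induction on the degree: a root splits off a linear factor, and primality puts this
  factor or the cofactor into \<open>P\<close>. The descent cannot reach a nonzero constant, which
  would be a unit in \<open>P\<close>.\<close>

lemma linear_factor_in_prime:
  assumes "poly_ideal J P" "1 \<notin> P" "v \<in> J"
    "\<And>x y. x \<in> pring J \<Longrightarrow> y \<in> pring J \<Longrightarrow> x * y \<in> P \<Longrightarrow> x \<in> P \<or> y \<in> P"
    "univariate v q \<in> P" "q \<noteq> 0"
  shows "\<exists>d. Var v - Const d \<in> P"
  using assms(5,6)
proof (induction "degree q" arbitrary: q)
  case 0
  then obtain a where "q = [:a:]" using degree_eq_zeroE by metis
  then have "Const a \<in> P" "a \<noteq> 0" using 0 by (auto simp: univariate_pCons univariate_0)
  then show ?case using Const_notin_ideal[OF assms(1,2)] by blast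
next
  case (Suc n)
  then have "\<not> constant (poly q)" by (simp add: constant_degree)
  then obtain d where "poly q d = 0" using fundamental_theorem_of_algebra by blast
  then obtain q' where q': "q = [:-d, 1:] * q'" by (meson dvdE poly_eq_0_iff_dvd)
  have "q' \<noteq> 0" using q' Suc.prems by auto
  then have "degree q = degree q' + 1"
    unfolding q' by (subst degree_mult_eq) auto
  then have deg: "n = degree q'" using Suc.hyps by simp
  have L: "univariate v [:-d, 1:] = Var v - Const d"
    by (simp add: univariate_pCons univariate_0 Const_uminus Const_one)
  have "(Var v - Const d) * univariate v q' \<in> P"
    using Suc.prems q' L by (simp add: univariate_mult del: mult_pCons_left)
  then have "Var v - Const d \<in> P \<or> univariate v q' \<in> P"
    by (rule assms(4)[OF pring_diff[OF pring_Var[OF assms(3)] pring_Const] pring_univariate[OF assms(3)]])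
  then show ?case using Suc.hyps(1)[OF deg _ \<open>q' \<noteq> 0\<close>] by blast
qed

text \<open>
  Let \<open>P\<close> be maximal among the ideals above \<open>I\<close> that avoid all powers of \<open>f\<close>. The quotient by \<open>P\<close>
  localized at \<open>f\<close> is a field of countable dimension, so for a variable \<open>X\<close> the inverses of the
  uncountably many \<open>X - c\<close> would satisfy a linear relation. Clearing denominators puts a nonzero
  polynomial in \<open>X\<close> alone into the prime ideal \<open>P\<close>, and with it some \<open>X - c\<close>; so \<open>P\<close> is the ideal of a point.
\<close>

theorem nullstellensatz:
  fixes J :: "'v set"
  assumes J: "finite J" and I: "poly_ideal J I" and f: "f \<in> pring J"
    and zeros: "\<And>\<gamma>. (\<forall>p\<in>I. peval \<gamma> p = 0) \<Longrightarrow> peval \<gamma> f = 0"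
  shows "\<exists>k. f ^ k \<in> I"
proof (rule ccontr)
  assume "\<not> ?thesis"
  then obtain P where P: "poly_ideal J P" "I \<subseteq> P" "\<And>k. f ^ k \<notin> P"
    and max: "\<And>Q. poly_ideal J Q \<Longrightarrow> P \<subseteq> Q \<Longrightarrow> (\<And>k. f ^ k \<notin> Q) \<Longrightarrow> Q = P"
    using exists_maximal_avoiding[OF I, of f] by auto
  note id = poly_idealD[OF P(1)]
  have one: "1 \<notin> P" using P(3)[of 0] by simp
  have inv: "\<exists>h k. h \<in> pring J \<and> h * g - f ^ k \<in> P" if g: "g \<in> pring J" "g \<notin> P" for g
  proof -
    \<comment> \<open>The ideal generated by \<open>P\<close> and \<open>g\<close>. By maximality it
      contains a power of \<open>f\<close>, so \<open>g\<close> is invertible modulo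
      \<open>P\<close> up to that power.\<close>
    define Q where "Q = {a + h * g | a h. a \<in> P \<and> h \<in> pring J}"
    have QI: "a + h * g \<in> Q" if "a \<in> P" "h \<in> pring J" for a h
      using that unfolding Q_def by blast
    have "poly_ideal J Q"
      unfolding poly_ideal_def
    proof (intro conjI ballI)
      show "Q \<subseteq> pring J" using g id(1) by (auto simp: Q_def)
      show "0 \<in> Q" using QI[OF id(2) pring_zero] by simp
    next
      fix a b assume "a \<in> Q" "b \<in> Q"
      then obtain x h y h' where *: "a = x + h * g" "b = y + h' * g" "x \<in> P" "y \<in> P" "h \<in> pring J" "h' \<in> pring J"
        unfolding Q_def by blast
      have "a + b = (x + y) + (h + h') * g" using *(1,2) by (simp add: algebra_simps)
      then show "a + b \<in> Q" using QI[OF id(3)[OF *(3,4)] pring_add[OF *(5,6)]] by simp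
    next
      fix a p assume "a \<in> Q" and p: "p \<in> pring J"
      then obtain x h where *: "a = x + h * g" "x \<in> P" "h \<in> pring J" unfolding Q_def by blast
      have "p * a = p * x + (p * h) * g" using *(1) by (simp add: algebra_simps)
      then show "p * a \<in> Q" using QI[OF id(4)[OF *(2) p] pring_mult[OF p *(3)]] by simp
    qed
    moreover
    have "P \<subseteq> Q" using QI[of _ 0] by auto
    moreover have "g \<in> Q" using QI[of 0 1] id(2) by simp
    ultimately have "\<exists>k. f ^ k \<in> Q" using max[of Q] g(2) by metis
    then obtain k a h where *: "f ^ k = a + h * g" "a \<in> P" "h \<in> pring J" unfolding Q_def by auto
    have "h * g - f ^ k \<in> P" using id(5)[OF *(2)] unfolding *(1) by simp
    then show ?thesis using *(3) by blast
  qed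
  have prime: "x \<in> P \<or> y \<in> P" if xy: "x \<in> pring J" "y \<in> pring J" "x * y \<in> P" for x y
  proof (rule ccontr)
    assume no: "\<not> ?thesis"
    obtain h k where h: "h \<in> pring J" "h * x - f ^ k \<in> P" using inv[OF xy(1)] no by blast
    obtain h' k' where h': "h' \<in> pring J" "h' * y - f ^ k' \<in> P" using inv[OF xy(2)] no by blast
    have "f ^ (k + k') = (h * h') * (x * y) - ((h * x) * (h' * y - f ^ k') + f ^ k' * (h * x - f ^ k))"
      by (simp add: algebra_simps power_add)
    moreover have "\<dots> \<in> P"
      by (rule id(6)[OF id(4)[OF xy(3)] id(3)[OF id(4)[OF h'(2)] id(4)[OF h(2)]]]) (use h h' xy f in auto)
    ultimately show False using P(3) by metis
  qed
  have linear: "\<exists>c. Var v - Const c \<in> P" if v: "v \<in> J" for v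
  proof (rule ccontr)
    assume no: "\<not> ?thesis"
    define L where "L = (\<lambda>c. Var v - Const c)"
    have L: "L c \<in> pring J" for c unfolding L_def using v by auto
    have "\<forall>c. \<exists>h k. h \<in> pring J \<and> h * L c - f ^ k \<in> P" using inv no L unfolding L_def by blast
    then obtain h k where hk: "\<And>c. h c \<in> pring J" "\<And>c. h c * L c - f ^ k c \<in> P" by metis
    \<comment> \<open>An inverse of \<open>L c\<close> is recorded by its exponent of
      \<open>f\<close> and the support of \<open>h c\<close>. There are only countably many such
      pairs, so infinitely many \<open>c\<close> share one.\<close>
    let ?Y = "(UNIV :: nat set) \<times> {K. finite K \<and> K \<subseteq> {m :: 'v \<Rightarrow>\<^sub>0 nat. Poly_Mapping.keys m \<subseteq> J}}"
    have "countable ?Y" using countable_monomials[OF J] by (auto intro: countable_Collect_finite_subset)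
    moreover have "range (\<lambda>c. (k c, Poly_Mapping.keys (h c))) \<subseteq> ?Y"
      using hk(1) unfolding pring_iff by auto
    ultimately obtain n K where nK: "finite K" "infinite {c. (k c, Poly_Mapping.keys (h c)) = (n, K)}"
      using infinite_fibre[of ?Y "\<lambda>c. (k c, Poly_Mapping.keys (h c))"] uncountable_UNIV_complex by blast
    \<comment> \<open>One more \<open>c\<close> than there are monomials in \<open>K\<close>, so
      that the polynomials \<open>h c\<close> satisfy a linear relation.\<close>
    obtain T where T: "finite T" "card T = Suc (card K)" "T \<subseteq> {c. (k c, Poly_Mapping.keys (h c)) = (n, K)}"
      using infinite_arbitrarily_large[OF nK(2)] by blast
    obtain x where x: "\<exists>c\<in>T. x c \<noteq> 0" "\<forall>m\<in>K. (\<Sum>c\<in>T. Poly_Mapping.lookup (h c) m * x c) = 0"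
      using underdetermined_system[OF nK(1) T(1), of "\<lambda>m c. Poly_Mapping.lookup (h c) m"] T(2) by auto
    have rel: "(\<Sum>c\<in>T. Const (x c) * h c) = 0"
    proof (rule poly_mapping_eqI)
      fix m
      show "Poly_Mapping.lookup (\<Sum>c\<in>T. Const (x c) * h c) m = Poly_Mapping.lookup 0 m"
      proof (cases "m \<in> K")
        case True
        then have "(\<Sum>c\<in>T. x c * Poly_Mapping.lookup (h c) m) = 0"
          using x(2) by (simp add: mult.commute[of "x _"])
        then show ?thesis by (simp add: lookup_sum lookup_Const_mult)
      next
        case False
        then have "Poly_Mapping.lookup (h c) m = 0" if "c \<in> T" for c
          using T(3) that by (auto simp: in_keys_iff)
        then show ?thesis by (simp add: lookup_sum lookup_Const_mult)
      qed
    qed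
    \<comment> \<open>The numerator of the sum of \<open>x c / (X - c)\<close> over the common
      denominator.\<close>
    define q where "q = (\<Sum>c\<in>T. smult (x c) (\<Prod>d\<in>T - {c}. [:-d, 1:]))"
    have L': "univariate v [:-c, 1:] = L c" for c
      by (simp add: univariate_pCons univariate_0 Const_uminus Const_one L_def)
    have q: "univariate v q = (\<Sum>c\<in>T. Const (x c) * (\<Prod>d\<in>T - {c}. L d))"
      by (simp add: q_def univariate_sum univariate_smult univariate_prod L')
    have "(\<Sum>c\<in>T. (Const (x c) * (\<Prod>d\<in>T - {c}. L d)) * (h c * L c - f ^ n)) \<in> P"
    proof (intro poly_ideal_sum[OF P(1)] id(4))
      fix c assume "c \<in> T"
      then show "h c * L c - f ^ n \<in> P" using T(3) hk(2)[of c] by auto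
    qed (use L in auto)
    moreover have "(\<Sum>c\<in>T. (Const (x c) * (\<Prod>d\<in>T - {c}. L d)) * (h c * L c - f ^ n)) = - (f ^ n * univariate v q)"
    proof -
      have "(\<Sum>c\<in>T. (Const (x c) * (\<Prod>d\<in>T - {c}. L d)) * (h c * L c - f ^ n)) =
          (\<Sum>c\<in>T. Const (x c) * h c * (\<Prod>d\<in>T. L d) - f ^ n * (Const (x c) * (\<Prod>d\<in>T - {c}. L d)))"
        using T(1) by (intro sum.cong) (auto simp: prod.remove[of T _ L] algebra_simps)
      also have "\<dots> = (\<Sum>c\<in>T. Const (x c) * h c) * (\<Prod>d\<in>T. L d) - f ^ n * univariate v q"
        by (simp add: sum_subtractf sum_distrib_left sum_distrib_right q)
      finally show ?thesis by (simp add: rel)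
    qed
    ultimately have "f ^ n * univariate v q \<in> P" using id(5)[of "- (f ^ n * univariate v q)"] by simp
    then have "univariate v q \<in> P"
      using prime[OF pring_power[OF f] pring_univariate[OF v]] P(3) by blast
    moreover have "q \<noteq> 0"
    proof
      assume "q = 0"
      obtain c where c: "c \<in> T" "x c \<noteq> 0" using x(1) by blast
      have "poly q c = (\<Sum>b\<in>T. x b * (\<Prod>d\<in>T - {b}. c - d))"
        by (simp add: q_def poly_sum poly_prod)
      also have "\<dots> = x c * (\<Prod>d\<in>T - {c}. c - d)"
        using c(1) T(1) by (subst sum.remove[of _ c]) (auto intro!: sum.neutral)
      also have "\<dots> \<noteq> 0" using c T(1) by auto
      finally show False using \<open>q = 0\<close> by simp
    qed
    ultimately show False using linear_factor_in_prime[OF P(1) one v prime] no by blast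
  qed
  then obtain c where c: "\<And>v. v \<in> J \<Longrightarrow> Var v - Const (c v) \<in> P" by metis
  \<comment> \<open>The polynomials congruent modulo \<open>P\<close> to their value at
    \<open>c\<close>. They contain the constants and the variables and are closed under sums and
    products, so they are all of \<open>pring J\<close>: \<open>P\<close> is the ideal of the point
    \<open>c\<close>.\<close>
  define G where "G = {p \<in> pring J. p - Const (peval c p) \<in> P}"
  have G_mult: "p * q \<in> G" if "p \<in> G" "q \<in> G" for p q
  proof -
    have "p * q - Const (peval c (p * q)) = q * (p - Const (peval c p)) + Const (peval c p) * (q - Const (peval c q))"
      by (simp add: peval_mult Const_mult algebra_simps)
    moreover have "\<dots> \<in> P" using that id(3,4) by (auto simp: G_def)
    ultimately show ?thesis using that by (auto simp: G_def)
  qed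
  have G_add: "p + q \<in> G" if "p \<in> G" "q \<in> G" for p q
  proof -
    have "p + q - Const (peval c (p + q)) = (p - Const (peval c p)) + (q - Const (peval c q))"
      by (simp add: peval_add Const_add algebra_simps)
    also have "\<dots> \<in> P" using that id(3) by (auto simp: G_def)
    finally show ?thesis using that by (simp add: G_def pring_add)
  qed
  have G_Const: "Const a \<in> G" for a using id(2) by (simp add: G_def)
  have G_zero: "0 \<in> G" and G_one: "1 \<in> G"
    using G_Const[of 0] G_Const[of 1] by (simp_all add: Const_zero Const_one)
  have G_sum: "(\<Sum>i\<in>A. F i) \<in> G" if F: "\<And>i. i \<in> A \<Longrightarrow> F i \<in> G" for A :: "('v \<Rightarrow>\<^sub>0 nat) set" and F
    using F by (induction A rule: infinite_finite_induct) (simp_all add: G_zero G_add)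
  have G_power: "p ^ n \<in> G" if p: "p \<in> G" for p n
    by (induction n) (simp_all add: G_one G_mult p)
  have G_prod: "(\<Prod>i\<in>A. F i) \<in> G" if F: "\<And>i. i \<in> A \<Longrightarrow> F i \<in> G" for A :: "'v set" and F
    using F by (induction A rule: infinite_finite_induct) (simp_all add: G_one G_mult)
  have cong: "p - Const (peval c p) \<in> P" if p: "p \<in> pring J" for p
  proof -
    have Var: "Var v \<in> G" if "m \<in> Poly_Mapping.keys p" "v \<in> Poly_Mapping.keys m" for m v
    proof -
      have "v \<in> J" using that p unfolding pring_iff by blast
      then show ?thesis using c pring_Var by (simp add: G_def)
    qed
    have "psubst Var p \<in> G" unfolding psubst_def
      by (rule G_sum, rule G_mult, rule G_Const, rule G_prod, rule G_power, rule Var)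
    then show ?thesis by (simp add: psubst_Var G_def)
  qed
  have "peval c p = 0" if "p \<in> I" for p
  proof (rule ccontr)
    assume "peval c p \<noteq> 0"
    have "p \<in> P" using that P(2) by blast
    then have "p - (p - Const (peval c p)) \<in> P" using cong id(1,6) by blast
    then show False using Const_notin_ideal[OF P(1) one \<open>peval c p \<noteq> 0\<close>] by simp
  qed
  then have "peval c f = 0" using zeros by blast
  then have "f \<in> P" using cong[OF f] by (simp add: Const_zero)
  then show False using P(3)[of 1] by simp
qed

section \<open>Matroids\<close>

lemma matroid_axioms:
  "finite (ground M) \<and> indep_sets M \<subseteq> Pow (ground M) \<and> {} \<in> indep_sets M \<and>
    (\<forall>A\<in>indep_sets M. \<forall>B. B \<subseteq> A \<longrightarrow> B \<in> indep_sets M) \<and>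
    (\<forall>A\<in>indep_sets M. \<forall>B\<in>indep_sets M. card A < card B \<longrightarrow> (\<exists>x\<in>B - A. insert x A \<in> indep_sets M))"
  using Rep_matroid[of M] unfolding ground.rep_eq indep_sets.rep_eq by (simp add: case_prod_unfold)

lemma finite_ground [simp]: "finite (ground M)"
  using matroid_axioms by blast

lemma indep_subset_ground: "A \<in> indep_sets M \<Longrightarrow> A \<subseteq> ground M"
  using matroid_axioms by blast

lemma indep_empty [simp]: "{} \<in> indep_sets M"
  using matroid_axioms by blast

lemma indep_subset: "A \<in> indep_sets M \<Longrightarrow> B \<subseteq> A \<Longrightarrow> B \<in> indep_sets M"
  using matroid_axioms by blast

lemma indep_augment:
  "A \<in> indep_sets M \<Longrightarrow> B \<in> indep_sets M \<Longrightarrow> card A < card B \<Longrightarrow> \<exists>x\<in>B - A. insert x A \<in> indep_sets M"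
  using matroid_axioms by blast

lemma indep_finite: "A \<in> indep_sets M \<Longrightarrow> finite A"
  using indep_subset_ground finite_ground finite_subset by blast

lemma finite_indep_sets [simp]: "finite (indep_sets M)"
  by (rule finite_subset[of _ "Pow (ground M)"]) (use indep_subset_ground in auto)

lemma ground_restrict [simp]: "ground (restrict_matroid M N) = ground M \<inter> N"
  by transfer auto

lemma indep_restrict [simp]: "indep_sets (restrict_matroid M N) = {A \<in> indep_sets M. A \<subseteq> N}"
  by transfer auto

section \<open>Ranks, circuits and closures\<close>

lemma indep_card_le_of_maximal:
  assumes "B \<in> indep_sets M" "\<And>x. x \<in> X \<Longrightarrow> x \<in> B \<or> insert x B \<notin> indep_sets M"
    "C \<in> indep_sets M" "C \<subseteq> X"
  shows "card C \<le> card B"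
  using indep_augment[of B M C] assms by (meson DiffE not_le subsetD)

lemma card_le_rank:
  assumes "B \<in> indep_sets M" "B \<subseteq> A"
  shows "card B \<le> rank_of M A"
  unfolding rank_of_def using assms by (intro Max_ge) auto

lemma rank_attained: "\<exists>B\<in>indep_sets M. B \<subseteq> A \<and> card B = rank_of M A"
proof -
  have "{} \<in> {B \<in> indep_sets M. B \<subseteq> A}" by simp
  then have "rank_of M A \<in> card ` {B \<in> indep_sets M. B \<subseteq> A}"
    unfolding rank_of_def by (intro Max_in finite_imageI) (simp, blast)
  then show ?thesis by auto
qed

lemma card_le_mrank: "B \<in> indep_sets M \<Longrightarrow> card B \<le> mrank M"
  unfolding mrank_def using card_le_rank indep_subset_ground by blast

lemma dep_contains_circuit:
  assumes "dep_set M A"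
  shows "\<exists>C\<subseteq>A. circuit M C"
proof -
  have "finite A" using assms finite_subset[OF _ finite_ground] by (auto simp: dep_set_def)
  then have "finite {D. D \<subseteq> A \<and> dep_set M D}" by auto
  moreover have "A \<in> {D. D \<subseteq> A \<and> dep_set M D}" using assms by auto
  ultimately obtain C where C: "C \<in> {D. D \<subseteq> A \<and> dep_set M D}"
      "\<forall>D\<in>{D. D \<subseteq> A \<and> dep_set M D}. D \<subseteq> C \<longrightarrow> C = D"
    using finite_has_minimal[of "{D. D \<subseteq> A \<and> dep_set M D}"] by auto
  then have "circuit M C" unfolding circuit_def by blast
  then show ?thesis using C(1) by blast
qed

lemma circuit_ground: "circuit M C \<Longrightarrow> C \<subseteq> ground M"
  by (simp add: circuit_def dep_set_def)

lemma circuit_finite: "circuit M C \<Longrightarrow> finite C"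
  using circuit_ground finite_ground finite_subset by blast

lemma circuit_not_indep: "circuit M C \<Longrightarrow> C \<notin> indep_sets M"
  by (simp add: circuit_def dep_set_def)

lemma circuit_proper_indep: "circuit M C \<Longrightarrow> D \<subset> C \<Longrightarrow> D \<in> indep_sets M"
  unfolding circuit_def dep_set_def by blast

lemma circuit_restrict: "circuit (restrict_matroid M N) C \<longleftrightarrow> circuit M C \<and> C \<subseteq> N"
proof -
  have "dep_set (restrict_matroid M N) D \<longleftrightarrow> dep_set M D \<and> D \<subseteq> N" for D
    by (auto simp: dep_set_def)
  moreover have "D \<subseteq> N" if "C \<subseteq> N" "D \<subset> C" for D using that by auto
  ultimately show ?thesis unfolding circuit_def by metis
qed

lemma card_circuit_le: "circuit M C \<Longrightarrow> card C \<le> mrank M + 1"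
proof -
  assume C: "circuit M C"
  then have "C \<noteq> {}" using circuit_not_indep[OF C] by auto
  then obtain q where q: "q \<in> C" by blast
  then have "card (C - {q}) \<le> mrank M"
    using circuit_proper_indep[OF C, of "C - {q}"] by (intro card_le_mrank) auto
  then show ?thesis using q circuit_finite[OF C] by simp
qed

lemma rank_circuit:
  assumes "circuit M C"
  shows "rank_of M C + 1 = card C"
proof -
  have "C \<noteq> {}" using circuit_not_indep[OF assms] by auto
  then obtain q where q: "q \<in> C" by blast
  have "card (C - {q}) \<le> rank_of M C"
    using circuit_proper_indep[OF assms, of "C - {q}"] q by (intro card_le_rank) auto
  moreover obtain B where B: "B \<in> indep_sets M" "B \<subseteq> C" "card B = rank_of M C"
    using rank_attained[of M C] by blast
  then have "B \<subset> C" using circuit_not_indep[OF assms] by (metis psubsetI)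
  then have "card B < card C" using psubset_card_mono circuit_finite[OF assms] by blast
  ultimately show ?thesis using B(3) q circuit_finite[OF assms] by simp
qed

lemma subset_mclosure: "A \<subseteq> ground M \<Longrightarrow> A \<subseteq> mclosure M A"
  by (auto simp: mclosure_def insert_absorb)

text \<open>Otherwise \<open>insert b (C - {q})\<close> would be independent of size
  \<open>card C\<close> inside \<open>insert b C\<close>, whose rank is that of \<open>C\<close>,
  namely \<open>card C - 1\<close>.\<close>

lemma mclosure_circuit_dep:
  assumes C: "circuit M C" and q: "q \<in> C" and b: "b \<in> mclosure M C"
    and A: "C - {q} \<subseteq> A" "b \<notin> A"
  shows "insert b A \<notin> indep_sets M"
proof
  assume "insert b A \<in> indep_sets M"
  then have "insert b (C - {q}) \<in> indep_sets M" using indep_subset A by blast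
  then have "card (insert b (C - {q})) \<le> rank_of M (insert b C)" by (intro card_le_rank) auto
  also have "\<dots> = rank_of M C" using b by (simp add: mclosure_def)
  finally have le: "card (insert b (C - {q})) \<le> rank_of M C" .
  have "b \<notin> C - {q}" using A by blast
  then have "card (insert b (C - {q})) = Suc (card (C - {q}))" using circuit_finite[OF C] by simp
  also have "\<dots> = card C" using q circuit_finite[OF C] by (intro card.remove[symmetric])
  finally show False using rank_circuit[OF C] le by simp
qed

text \<open>Transitivity of closure, from the augmentation axiom: extend \<open>B\<close> to a
  maximal independent subset \<open>D\<close> of \<open>A \<union> B\<close>. It is no larger than
  \<open>A\<close>, so a point of \<open>insert p A\<close> augments it; maximality leaves only
  \<open>p\<close>, against the dependence of \<open>insert p B\<close>.\<close>

lemma indep_closure_transfer: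
  assumes "B \<in> indep_sets M" "insert p B \<notin> indep_sets M" "A \<in> indep_sets M"
    and BA: "\<And>b. b \<in> B \<Longrightarrow> b \<in> A \<or> insert b A \<notin> indep_sets M"
  shows "p \<in> A \<or> insert p A \<notin> indep_sets M"
proof (rule ccontr)
  assume "\<not> ?thesis"
  then have p: "p \<notin> A" "insert p A \<in> indep_sets M" by auto
  define X where "X = {D \<in> indep_sets M. B \<subseteq> D \<and> D \<subseteq> A \<union> B}"
  have le: "card D \<le> card A" if "D \<in> indep_sets M" "D \<subseteq> A \<union> B" for D
    by (rule indep_card_le_of_maximal[OF assms(3) _ that]) (use BA in blast)
  have "finite X" "B \<in> X" using assms(1) by (auto simp: X_def)
  then obtain D where D: "D \<in> X" "\<forall>D'\<in>X. D \<subseteq> D' \<longrightarrow> D = D'"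
    using finite_has_maximal[of X] by auto
  have "card D < card (insert p A)"
    using le[of D] D(1) p(1) indep_finite[OF assms(3)] by (auto simp: X_def)
  then obtain x where x: "x \<in> insert p A - D" "insert x D \<in> indep_sets M"
    using indep_augment[of D M "insert p A"] D(1) p(2) by (auto simp: X_def)
  show False
  proof (cases "x = p")
    case True
    then have "insert p B \<in> indep_sets M" using indep_subset[OF x(2), of "insert p B"] D(1) by (auto simp: X_def)
    then show False using assms(2) by simp
  next
    case False
    then have "insert x D \<in> X" using x D(1) by (auto simp: X_def)
    then show False using D(2) x(1) by blast
  qed
qed

subsection \<open>Nilpotent matroids are built up point by point\<close>

text \<open>The last premise of \<open>on_flat\<close> says that \<open>p\<close> depends on
  \<open>A\<close> exactly when \<open>A\<close> spans all of \<open>B\<close>: the point is generic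
  on the flat of \<open>B\<close>. Everything is phrased by independent sets of points already
  present, so a building order of a restriction remains valid in the whole matroid.\<close>

inductive buildable :: "'a set set \<Rightarrow> 'a set \<Rightarrow> bool" for \<I> where
  empty: "buildable \<I> {}"
| free: "buildable \<I> N \<Longrightarrow> p \<notin> N \<Longrightarrow> (\<And>A. A \<subseteq> N \<Longrightarrow> A \<in> \<I> \<Longrightarrow> insert p A \<in> \<I>) \<Longrightarrow> buildable \<I> (insert p N)"
| on_flat: "buildable \<I> N \<Longrightarrow> p \<notin> N \<Longrightarrow> B \<subseteq> N \<Longrightarrow> B \<in> \<I> \<Longrightarrow>
    (\<And>A. A \<subseteq> N \<Longrightarrow> A \<in> \<I> \<Longrightarrow> insert p A \<notin> \<I> \<longleftrightarrow> (\<forall>b\<in>B. b \<in> A \<or> insert b A \<notin> \<I>)) \<Longrightarrow>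
    buildable \<I> (insert p N)"

lemma buildable_superfamily:
  assumes "buildable {A \<in> \<I>. A \<subseteq> G} N" "N \<subseteq> G"
  shows "buildable \<I> N"
  using assms
proof (induction rule: buildable.induct)
  case empty
  show ?case by (rule buildable.empty)
next
  case (free N p)
  show ?case
  proof (rule buildable.free)
    show "insert p A \<in> \<I>" if "A \<subseteq> N" "A \<in> \<I>" for A using free.hyps(3)[of A] free.prems that by auto
  qed (use free in auto)
next
  case (on_flat N p B)
  show ?case
  proof (rule buildable.on_flat[where B = B])
    fix A assume A: "A \<subseteq> N" "A \<in> \<I>"
    have "b \<in> G" if "b \<in> B" for b using that on_flat.hyps(3) on_flat.prems by auto
    then show "insert p A \<notin> \<I> \<longleftrightarrow> (\<forall>b\<in>B. b \<in> A \<or> insert b A \<notin> \<I>)"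
      using on_flat.hyps(5)[of A] A on_flat.prems by auto
  qed (use on_flat in auto)
qed

lemma small_circuits_same_closure:
  assumes "\<not> card (subspaces_at K p) > 1" "C \<in> small_circuits K" "D \<in> small_circuits K" "p \<in> C" "p \<in> D"
  shows "mclosure K C = mclosure K D"
proof -
  have at: "closure_rel K `` {X} \<in> subspaces_at K p" "X \<in> closure_rel K `` {X}" if "X \<in> small_circuits K" "p \<in> X" for X
    using that by (auto simp: subspaces_at_def subspaces_def closure_rel_def quotient_def)
  \<comment> \<open>\<open>card\<close> is 0 on infinite sets, so the bound on the degree needs
    finitely many subspaces to mean anything.\<close>
  have "small_circuits K \<subseteq> Pow (ground K)" using circuit_ground by (auto simp: small_circuits_def)
  then have "finite (small_circuits K)" by (rule finite_subset) simp
  then have "finite (subspaces_at K p)"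
    by (simp add: subspaces_at_def subspaces_def quotient_def)
  then have "closure_rel K `` {C} = closure_rel K `` {D}"
    using assms(1) at assms(2-5) card_le_Suc0_iff_eq[of "subspaces_at K p"] by auto
  then have "D \<in> closure_rel K `` {C}" using at assms by auto
  then show ?thesis by (simp add: closure_rel_def)
qed

text \<open>Any dependence of \<open>p\<close> comes from a circuit through \<open>p\<close>. Small
  ones all have the same closure, so a small circuit \<open>C0\<close> inside
  \<open>insert p N\<close> makes \<open>p\<close> generic on the flat of \<open>C0 - {p}\<close>.
  Without one, \<open>p\<close> depends only on sets of full rank: it is generic on the whole space
  if \<open>N\<close> contains a basis, and free otherwise.\<close>

lemma buildable_insert:
  assumes N: "buildable (indep_sets K) N" "N \<subseteq> ground K" and p: "p \<in> ground K" "p \<notin> N"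
    and deg: "\<not> card (subspaces_at K p) > 1"
  shows "buildable (indep_sets K) (insert p N)"
proof -
  let ?I = "indep_sets K"
  have circ: "\<exists>C. circuit K C \<and> p \<in> C \<and> C \<subseteq> insert p A" if "A \<subseteq> N" "A \<in> ?I" "insert p A \<notin> ?I" for A
  proof -
    have "dep_set K (insert p A)" using that N p by (auto simp: dep_set_def)
    then obtain C where C: "C \<subseteq> insert p A" "circuit K C" using dep_contains_circuit by blast
    then have "p \<in> C" using that(2) indep_subset[of A K C] circuit_not_indep[of K C] by blast
    then show ?thesis using C by blast
  qed
  have big: "insert b A \<notin> ?I" if "A \<in> ?I" "card A \<ge> mrank K" "b \<notin> A" for A b
    using card_le_mrank[of "insert b A" K] that indep_finite[of A K] by auto
  have cardA: "card C \<le> card A + 1" if "C \<subseteq> insert p A" "A \<in> ?I" for A C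
  proof -
    have "card C \<le> card (insert p A)" using that indep_finite[of A K] by (intro card_mono) auto
    also have "\<dots> \<le> card A + 1" using indep_finite[of A K] that by (simp add: card_insert_if)
    finally show ?thesis .
  qed
  show ?thesis
  proof (cases "\<exists>C\<in>small_circuits K. p \<in> C \<and> C \<subseteq> insert p N")
    case True
    then obtain C0 where C0: "C0 \<in> small_circuits K" "p \<in> C0" "C0 \<subseteq> insert p N" by blast
    then have c0: "circuit K C0" by (simp add: small_circuits_def)
    have B: "C0 - {p} \<in> ?I" using circuit_proper_indep[OF c0, of "C0 - {p}"] C0(2) by auto
    have pB: "insert p (C0 - {p}) \<notin> ?I" using circuit_not_indep[OF c0] C0(2) by (simp add: insert_absorb)
    show ?thesis
    proof (rule buildable.on_flat[OF N(1) p(2), of "C0 - {p}"])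
      show "C0 - {p} \<subseteq> N" using C0 by auto
      fix A assume A: "A \<subseteq> N" "A \<in> ?I"
      show "insert p A \<notin> ?I \<longleftrightarrow> (\<forall>b\<in>C0 - {p}. b \<in> A \<or> insert b A \<notin> ?I)"
      proof
        assume np: "insert p A \<notin> ?I"
        obtain C where C: "circuit K C" "p \<in> C" "C \<subseteq> insert p A" using circ[OF A np] by blast
        show "\<forall>b\<in>C0 - {p}. b \<in> A \<or> insert b A \<notin> ?I"
        proof (cases "C \<in> small_circuits K")
          case True
          then have "C0 \<subseteq> mclosure K C"
            using small_circuits_same_closure[OF deg True C0(1) C(2) C0(2)]
              subset_mclosure[OF circuit_ground[OF c0]] by simp
          then show ?thesis using mclosure_circuit_dep[OF C(1,2)] C(3) by blast
        next
          case False
          \<comment> \<open>A circuit that is not small has \<open>mrank K + 1\<close> elements, so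
            \<open>A\<close> has full rank and every further point makes it dependent.\<close>
          then have "mrank K \<le> card A" using C cardA[OF C(3) A(2)] by (auto simp: small_circuits_def)
          then show ?thesis using big[OF A(2)] by blast
        qed
      next
        assume "\<forall>b\<in>C0 - {p}. b \<in> A \<or> insert b A \<notin> ?I"
        then show "insert p A \<notin> ?I"
          using indep_closure_transfer[OF B pB A(2)] p(2) A(1) by blast
      qed
    qed (use B in auto)
  next
    case False
    have large: "mrank K \<le> card A" if "A \<subseteq> N" "A \<in> ?I" "insert p A \<notin> ?I" for A
    proof -
      note A = that
      obtain C where C: "circuit K C" "p \<in> C" "C \<subseteq> insert p A" using circ[OF A] by blast
      then have "C \<notin> small_circuits K" using False A(1) by blast
      then show ?thesis using C cardA[OF C(3) A(2)] by (auto simp: small_circuits_def)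
    qed
    show ?thesis
    proof (cases "\<exists>D\<in>?I. D \<subseteq> N \<and> card D = mrank K")
      case True
      then obtain D where D: "D \<in> ?I" "D \<subseteq> N" "card D = mrank K" by blast
      show ?thesis
      proof (rule buildable.on_flat[OF N(1) p(2) D(2,1)])
        fix A assume A: "A \<subseteq> N" "A \<in> ?I"
        show "insert p A \<notin> ?I \<longleftrightarrow> (\<forall>b\<in>D. b \<in> A \<or> insert b A \<notin> ?I)"
        proof
          assume "insert p A \<notin> ?I"
          then show "\<forall>b\<in>D. b \<in> A \<or> insert b A \<notin> ?I" using large[OF A] big[OF A(2)] by blast
        next
          assume *: "\<forall>b\<in>D. b \<in> A \<or> insert b A \<notin> ?I"
          have "card D \<le> card A"
            by (rule indep_card_le_of_maximal[OF A(2) _ D(1), of D]) (use * in auto)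
          then show "insert p A \<notin> ?I" using big[OF A(2)] D(3) p(2) A(1) by auto
        qed
      qed
    next
      case noD: False
      show ?thesis
      proof (rule buildable.free[OF N(1) p(2)], rule ccontr)
        fix A assume A: "A \<subseteq> N" "A \<in> ?I" "insert p A \<notin> ?I"
        then have "card A = mrank K" using large[OF A] card_le_mrank[OF A(2)] by simp
        then show False using noD A by blast
      qed
    qed
  qed
qed

lemma buildable_step:
  assumes "buildable (indep_sets K) (high_degree_points K)"
  shows "buildable (indep_sets K) (ground K)"
proof -
  have "buildable (indep_sets K) (high_degree_points K \<union> X)" if "finite X" "X \<subseteq> ground K - high_degree_points K" for X
    using that
  proof (induction X rule: finite_induct)
    case empty
    then show ?case using assms by simp
  next
    case (insert p X)
    have "buildable (indep_sets K) (insert p (high_degree_points K \<union> X))"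
      by (rule buildable_insert) (use insert in \<open>auto simp: high_degree_points_def\<close>)
    then show ?case by simp
  qed
  moreover have "high_degree_points K \<subseteq> ground K" by (auto simp: high_degree_points_def)
  then have "high_degree_points K \<union> (ground K - high_degree_points K) = ground K" by auto
  ultimately show ?thesis by (metis finite_Diff finite_ground subset_refl)
qed

text \<open>Goes back along the chain from its empty end; each level is a restriction, and its
  building order remains valid in the level before.\<close>

lemma nilpotent_buildable:
  assumes "nilpotent_matroid M"
  shows "buildable (indep_sets M) (ground M)"
proof -
  obtain J where J: "ground (nil_chain M J) = {}" using assms by (auto simp: nilpotent_matroid_def)
  have "buildable (indep_sets (nil_chain M (J - k))) (ground (nil_chain M (J - k)))" if "k \<le> J" for k
    using that
  proof (induction k)
    case 0
    show ?case using J by (simp add: buildable.empty)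
  next
    case (Suc k)
    define K where "K = nil_chain M (J - Suc k)"
    have "J - k = Suc (J - Suc k)" using Suc.prems by simp
    then have K: "nil_chain M (J - k) = restrict_matroid K (high_degree_points K)"
      by (simp add: K_def)
    have sub: "high_degree_points K \<subseteq> ground K" by (auto simp: high_degree_points_def)
    then have "ground K \<inter> high_degree_points K = high_degree_points K" by auto
    then have "buildable {A \<in> indep_sets K. A \<subseteq> high_degree_points K} (high_degree_points K)"
      using Suc K by simp
    then have "buildable (indep_sets K) (high_degree_points K)" using buildable_superfamily by blast
    then show ?case using buildable_step unfolding K_def by blast
  qed
  from this[of J] show ?thesis by simp
qed

subsection \<open>Paving matroids and their dependent hyperplanes\<close>

lemma paving_small_indep:
  assumes "paving M" "A \<subseteq> ground M" "card A < mrank M"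
  shows "A \<in> indep_sets M"
proof (rule ccontr)
  assume "A \<notin> indep_sets M"
  then have "dep_set M A" using assms(2) by (simp add: dep_set_def)
  then obtain C where C: "C \<subseteq> A" "circuit M C" using dep_contains_circuit by blast
  moreover have "card C \<le> card A"
    using C assms(2) finite_subset[OF assms(2) finite_ground] by (intro card_mono) auto
  ultimately show False using assms(1,3) by (auto simp: paving_def)
qed

lemma paving_circuit_iff:
  assumes "paving M" "A \<subseteq> ground M" "card A = mrank M"
  shows "circuit M A \<longleftrightarrow> A \<notin> indep_sets M"
proof
  assume "A \<notin> indep_sets M"
  moreover have "D \<in> indep_sets M" if "D \<subset> A" for D
    using that assms psubset_card_mono[of A D] finite_subset[OF assms(2) finite_ground]
    by (intro paving_small_indep) auto
  ultimately show "circuit M A" using assms(2) by (auto simp: circuit_def dep_set_def)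
qed (rule circuit_not_indep)

lemma all_rank_subsets_circuitsI:
  assumes "paving M" "B \<in> indep_sets M" "card B + 1 = mrank M" "X \<subseteq> ground M" "mrank M \<le> card X"
    "\<And>x. x \<in> X \<Longrightarrow> x \<in> B \<or> insert x B \<notin> indep_sets M"
  shows "all_rank_subsets_circuits M X"
  unfolding all_rank_subsets_circuits_def
proof (intro conjI allI impI assms(4,5))
  fix C assume C: "C \<subseteq> X \<and> card C = mrank M"
  have "C \<notin> indep_sets M"
    using indep_card_le_of_maximal[OF assms(2,6), of X C] C assms(3) by auto
  then show "circuit M C" using paving_circuit_iff[OF assms(1), of C] C assms(4) by auto
qed

lemma hyperplane_rank_pos:
  assumes "dependent_hyperplane M H"
  shows "0 < mrank M"
proof (rule ccontr)
  assume "\<not> ?thesis"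
  then have "circuit M {}" using assms
    by (auto simp: dependent_hyperplane_def all_rank_subsets_circuits_def)
  then show False using circuit_not_indep by force
qed

lemma hyperplane_dep:
  assumes "dependent_hyperplane M H" "B \<subseteq> H" "card B + 1 = mrank M" "x \<in> H"
  shows "x \<in> B \<or> insert x B \<notin> indep_sets M"
proof (rule ccontr)
  assume *: "\<not> ?thesis"
  then have "finite B" using indep_finite[of "insert x B" M] by auto
  then have "circuit M (insert x B)" using assms *
    by (auto simp: dependent_hyperplane_def all_rank_subsets_circuits_def)
  then show False using * circuit_not_indep by blast
qed

lemma hyperplane_ground: "dependent_hyperplane M H \<Longrightarrow> H \<subseteq> ground M"
  by (simp add: dependent_hyperplane_def all_rank_subsets_circuits_def)

text \<open>A common set of \<open>mrank M - 1\<close> points is independent, and every further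
  point of either hyperplane depends on it. Hence all \<open>mrank M\<close>-subsets of the union
  are circuits, and maximality makes both hyperplanes equal to the union.\<close>

lemma hyperplane_eqI:
  assumes "paving M" "dependent_hyperplane M H" "dependent_hyperplane M H'" "B \<subseteq> H \<inter> H'" "card B + 1 = mrank M"
  shows "H = H'"
proof -
  have gr: "H \<subseteq> ground M" "H' \<subseteq> ground M" using assms(2,3) hyperplane_ground by auto
  then have "B \<in> indep_sets M" using assms by (intro paving_small_indep) auto
  moreover have "mrank M \<le> card H" using assms(2) by (simp add: dependent_hyperplane_def all_rank_subsets_circuits_def)
  moreover have "card H \<le> card (H \<union> H')"
    using finite_subset[OF gr(1) finite_ground] finite_subset[OF gr(2) finite_ground] by (intro card_mono) auto
  then have "mrank M \<le> card (H \<union> H')" using calculation by simp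
  ultimately have "all_rank_subsets_circuits M (H \<union> H')"
    using assms hyperplane_dep[OF assms(2)] hyperplane_dep[OF assms(3)] gr
    by (intro all_rank_subsets_circuitsI[of M B]) auto
  then have "\<not> H \<subset> H \<union> H'" "\<not> H' \<subset> H \<union> H'"
    using assms(2,3) unfolding dependent_hyperplane_def by blast+
  then show ?thesis by blast
qed

lemma hyperplane_inter_card:
  assumes "paving M" "dependent_hyperplane M H" "dependent_hyperplane M H'" "H \<noteq> H'"
  shows "card (H \<inter> H') + 2 \<le> mrank M"
proof (rule ccontr)
  assume "\<not> ?thesis"
  then have "mrank M - 1 \<le> card (H \<inter> H')" by simp
  then obtain B where "B \<subseteq> H \<inter> H'" "card B = mrank M - 1" by (meson obtain_subset_with_card_n)
  then have "H = H'" using hyperplane_rank_pos[OF assms(2)] by (intro hyperplane_eqI[OF assms(1-3), of B]) auto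
  then show False using assms(4) by simp
qed

text \<open>Deleting one point of \<open>C\<close> leaves an independent set of size
  \<open>mrank M - 1\<close> that spans the closure. A larger set of the same kind adds no point
  \<open>y\<close>: all full-size subsets of \<open>insert y C\<close> would be circuits, so the
  rank does not grow and \<open>y\<close> is in the closure.\<close>

lemma hyperplane_of_circuit:
  assumes "paving M" "circuit M C" "card C = mrank M"
  shows "dependent_hyperplane M (mclosure M C)"
proof -
  have cne: "C \<noteq> {}" using circuit_not_indep[OF assms(2)] by auto
  then obtain q where q: "q \<in> C" by blast
  define B where "B = C - {q}"
  have fin: "finite C" using circuit_finite[OF assms(2)] .
  have B: "B \<in> indep_sets M" "card B + 1 = mrank M"
    using circuit_proper_indep[OF assms(2), of B] q assms(3) fin card_gt_0_iff[of C] by (auto simp: B_def)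
  have CH: "C \<subseteq> mclosure M C" using subset_mclosure circuit_ground[OF assms(2)] by blast
  have "finite (mclosure M C)" by (rule finite_subset[of _ "ground M"]) (auto simp: mclosure_def)
  then have card: "mrank M \<le> card (mclosure M C)" using card_mono[OF _ CH] assms(3) by simp
  have "all_rank_subsets_circuits M (mclosure M C)"
  proof (rule all_rank_subsets_circuitsI[OF assms(1) B _ card])
    show "mclosure M C \<subseteq> ground M" by (auto simp: mclosure_def)
    show "x \<in> B \<or> insert x B \<notin> indep_sets M" if "x \<in> mclosure M C" for x
      using mclosure_circuit_dep[OF assms(2) q that, of B] by (auto simp: B_def)
  qed
  moreover have "y \<in> mclosure M C" if H': "all_rank_subsets_circuits M H'" "mclosure M C \<subset> H'" "y \<in> H'" for H' y
  proof -
    have sub: "insert y C \<subseteq> H'" "H' \<subseteq> ground M" using H' CH by (auto simp: all_rank_subsets_circuits_def)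
    have "rank_of M C \<le> rank_of M (insert y C)"
      using rank_attained[of M C] card_le_rank[of _ M "insert y C"] by force
    moreover have "rank_of M (insert y C) < mrank M"
    proof (rule ccontr)
      assume "\<not> ?thesis"
      then obtain D where D: "D \<in> indep_sets M" "D \<subseteq> insert y C" "card D \<ge> mrank M"
        using rank_attained[of M "insert y C"] by force
      then obtain E where E: "E \<subseteq> D" "card E = mrank M" by (meson obtain_subset_with_card_n)
      then have "E \<subseteq> H'" using sub D(2) by blast
      then have "circuit M E" using H'(1) E(2) by (auto simp: all_rank_subsets_circuits_def)
      then show False using indep_subset[OF D(1) E(1)] circuit_not_indep by blast
    qed
    ultimately have "rank_of M (insert y C) = rank_of M C" using rank_circuit[OF assms(2)] assms(3) by simp
    then show ?thesis using sub by (auto simp: mclosure_def)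
  qed
  ultimately show ?thesis unfolding dependent_hyperplane_def by blast
qed

text \<open>Dependence in the two forms that can be checked on vectors: too many of them, or
  \<open>mrank M\<close> of them on a common hyperplane, where an annihilating functional settles
  it.\<close>

lemma paving_dep_iff:
  assumes "paving M" "A \<subseteq> ground M"
  shows "dep_set M A \<longleftrightarrow> mrank M < card A \<or> card A = mrank M \<and> (\<exists>H. dependent_hyperplane M H \<and> A \<subseteq> H)"
proof (cases "card A = mrank M")
  case True
  have "\<exists>H. dependent_hyperplane M H \<and> A \<subseteq> H" if "dep_set M A"
  proof -
    have "circuit M A" using that paving_circuit_iff[OF assms True] by (simp add: dep_set_def)
    then show ?thesis using hyperplane_of_circuit[OF assms(1) _ True] subset_mclosure[OF assms(2)] by blast
  qed
  moreover have "dep_set M A" if "dependent_hyperplane M H" "A \<subseteq> H" for H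
    using that True by (auto simp: dependent_hyperplane_def all_rank_subsets_circuits_def circuit_def)
  ultimately show ?thesis using True by auto
next
  case False
  then show ?thesis
    using card_le_mrank[of A M] paving_small_indep[OF assms] assms(2)
    by (cases "card A" "mrank M" rule: linorder_cases) (auto simp: dep_set_def)
qed

text \<open>Otherwise \<open>insert x B\<close> would be a circuit whose closure is a hyperplane
  sharing \<open>B\<close> with \<open>H\<close>, hence equal to it.\<close>

lemma hyperplane_extra_point_indep:
  assumes "paving M" "dependent_hyperplane M H" "B \<subseteq> H" "card B + 1 = mrank M" "x \<in> ground M" "x \<notin> H"
  shows "insert x B \<in> indep_sets M"
proof (rule ccontr)
  assume *: "insert x B \<notin> indep_sets M"
  have gr: "B \<subseteq> ground M" using assms hyperplane_ground by blast
  have "x \<notin> B" using assms by blast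
  have cardx: "card (insert x B) = mrank M"
    using assms(3,4,6) finite_subset[OF gr finite_ground] by (auto simp: card_insert_if)
  then have "circuit M (insert x B)" using paving_circuit_iff[OF assms(1), of "insert x B"] * gr assms by auto
  then have h: "dependent_hyperplane M (mclosure M (insert x B))"
    using hyperplane_of_circuit[OF assms(1)] cardx by blast
  have "insert x B \<subseteq> mclosure M (insert x B)" using subset_mclosure[of "insert x B" M] gr assms by auto
  then have "H = mclosure M (insert x B)" using hyperplane_eqI[OF assms(1,2) h, of B] assms by auto
  then show False using assms(6) \<open>insert x B \<subseteq> _\<close> by auto
qed

lemma finite_hyperplanes: "finite {H. dependent_hyperplane M H}"
  by (rule finite_subset[of _ "Pow (ground M)"]) (use hyperplane_ground in auto)

lemma mrank_restrict:
  assumes "B \<in> indep_sets M" "B \<subseteq> N" "card B = mrank M"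
  shows "mrank (restrict_matroid M N) = mrank M"
proof (rule antisym)
  obtain D where "D \<in> indep_sets (restrict_matroid M N)" "card D = mrank (restrict_matroid M N)"
    using rank_attained[of "restrict_matroid M N" "ground (restrict_matroid M N)"] by (auto simp: mrank_def)
  then show "mrank (restrict_matroid M N) \<le> mrank M" using card_le_mrank[of D M] by simp
  show "mrank M \<le> mrank (restrict_matroid M N)"
    using card_le_mrank[of B "restrict_matroid M N"] assms by simp
qed

text \<open>Collapses the iterated restrictions to a single one, so that circuits and independence
  along the chain are those of \<open>M\<close> itself.\<close>

lemma nil_chain_restrict: "\<exists>G\<subseteq>ground M. nil_chain M j = restrict_matroid M G \<and> ground (nil_chain M j) = G"
proof (induction j)
  case 0
  have "restrict_matroid M (ground M) = M"
  proof -
    have "Rep_matroid (restrict_matroid M (ground M)) = Rep_matroid M"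
      using indep_subset_ground[of _ M]
      by (auto simp: prod_eq_iff ground.rep_eq[symmetric] indep_sets.rep_eq[symmetric])
    then show ?thesis by (simp add: Rep_matroid_inject)
  qed
  then show ?case by (intro exI[of _ "ground M"]) auto
next
  case (Suc j)
  then obtain G where G: "G \<subseteq> ground M" "nil_chain M j = restrict_matroid M G" "ground (nil_chain M j) = G" by blast
  define D where "D = high_degree_points (nil_chain M j)"
  have D: "D \<subseteq> G" using G(3) by (auto simp: D_def high_degree_points_def)
  have "Rep_matroid (restrict_matroid (restrict_matroid M G) D) = Rep_matroid (restrict_matroid M D)"
    using D by (auto simp: prod_eq_iff ground.rep_eq[symmetric] indep_sets.rep_eq[symmetric])
  then have "restrict_matroid (restrict_matroid M G) D = restrict_matroid M D"
    by (simp add: Rep_matroid_inject)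
  moreover have "nil_chain M (Suc j) = restrict_matroid (nil_chain M j) D" by (simp add: D_def)
  ultimately have "nil_chain M (Suc j) = restrict_matroid M D" using G(2) by simp
  then show ?case using D G(1) by (intro exI[of _ D]) auto
qed

lemma high_degree_of_two_closures:
  assumes "C \<in> small_circuits K" "D \<in> small_circuits K" "p \<in> C" "p \<in> D" "mclosure K C \<noteq> mclosure K D" "p \<in> ground K"
  shows "p \<in> high_degree_points K"
  using small_circuits_same_closure[of K p C D] assms unfolding high_degree_points_def by blast

text \<open>Otherwise each member of \<open>\<H>\<close> shares at least \<open>mrank M\<close>
  points with the others. The set \<open>N\<close> of points lying on two members then contains two
  circuits through each of its points, one on either hyperplane, and so survives every step of the
  nilpotent chain.\<close>

lemma nilpotent_paving_leaf:
  assumes M: "paving M" "nilpotent_matroid M"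
    and \<H>: "\<H> \<subseteq> {H. dependent_hyperplane M H}" "\<H> \<noteq> {}"
  shows "\<exists>l\<in>\<H>. card (l \<inter> \<Union>(\<H> - {l})) < mrank M"
proof (rule ccontr)
  assume "\<not> ?thesis"
  then have large: "mrank M \<le> card (l \<inter> \<Union>(\<H> - {l}))" if "l \<in> \<H>" for l using that by (meson not_less)
  define N where "N = (\<Union>l\<in>\<H>. l \<inter> \<Union>(\<H> - {l}))"
  have hyp: "dependent_hyperplane M H" if "H \<in> \<H>" for H using that \<H> by blast
  obtain l0 where l0: "l0 \<in> \<H>" using \<H>(2) by blast
  have r: "0 < mrank M" using hyperplane_rank_pos[OF hyp[OF l0]] .
  then have "l0 \<inter> \<Union>(\<H> - {l0}) \<noteq> {}" using large[OF l0] by auto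
  then have "N \<noteq> {}" using l0 by (auto simp: N_def)
  have "N \<subseteq> ground (nil_chain M j)" for j
  proof (induction j)
    case 0
    show ?case using hyperplane_ground[OF hyp] by (auto simp: N_def)
  next
    case (Suc j)
    obtain G where G: "G \<subseteq> ground M" "nil_chain M j = restrict_matroid M G" "ground (nil_chain M j) = G"
      using nil_chain_restrict[of M j] by blast
    define K where "K = nil_chain M j"
    have "p \<in> high_degree_points K" if p: "p \<in> N" for p
    proof -
      obtain l l' where l: "l \<in> \<H>" "l' \<in> \<H>" "l \<noteq> l'" "p \<in> l" "p \<in> l'" using p by (auto simp: N_def)
      have fin: "finite (h \<inter> \<Union>(\<H> - {h}))" if "h \<in> \<H>" for h
        using finite_subset[OF hyperplane_ground[OF hyp[OF that]]] by auto
      have ex: "\<exists>C. p \<in> C \<and> C \<subseteq> h \<inter> N \<and> card C = mrank M" if h: "h \<in> \<H>" "h' \<in> \<H>" "h \<noteq> h'" "p \<in> h" "p \<in> h'" for h h'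
      proof -
        let ?X = "h \<inter> \<Union>(\<H> - {h})"
        have "p \<in> ?X" using h by blast
        then have "mrank M - 1 \<le> card (?X - {p})" using large[OF h(1)] fin[OF h(1)] by simp
        then obtain B where "B \<subseteq> ?X - {p}" "card B = mrank M - 1" by (meson obtain_subset_with_card_n)
        moreover from this have "finite B" using fin[OF h(1)] finite_subset by blast
        moreover have "?X \<subseteq> h \<inter> N" using h(1) by (auto simp: N_def)
        ultimately show ?thesis using \<open>p \<in> ?X\<close> r
          by (intro exI[of _ "insert p B"]) (auto simp: card_insert_if)
      qed
      obtain C where C: "p \<in> C" "C \<subseteq> l \<inter> N" "card C = mrank M" using ex[of l l'] l by blast
      obtain D where D: "p \<in> D" "D \<subseteq> l' \<inter> N" "card D = mrank M" using ex[of l' l] l by blast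
      have NG: "N \<subseteq> G" using Suc G(3) by simp
      have cC: "circuit M C" "circuit M D" using hyp l C D
        by (auto simp: dependent_hyperplane_def all_rank_subsets_circuits_def)
      then have cK: "circuit K C" "circuit K D" using C D NG unfolding K_def G(2) circuit_restrict by auto
      have "card (l \<inter> l') + 2 \<le> mrank M" using hyperplane_inter_card M(1) hyp l by blast
      have "\<not> D \<subseteq> l"
      proof
        assume "D \<subseteq> l"
        moreover have "finite (l \<inter> l')" using finite_subset[OF hyperplane_ground[OF hyp[OF l(1)]]] by auto
        ultimately have "card D \<le> card (l \<inter> l')" using D by (intro card_mono) auto
        then show False using \<open>card (l \<inter> l') + 2 \<le> mrank M\<close> D by simp
      qed
      then obtain x where x: "x \<in> D" "x \<notin> l" by blast
      define B where "B = C - {p}"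
      have B: "B \<subseteq> l" "card B + 1 = mrank M" "B \<subseteq> N" using C r circuit_finite[OF cC(1)] by (auto simp: B_def)
      have xg: "x \<in> ground M" "x \<in> N" using x D circuit_ground[OF cC(2)] by auto
      then have ind: "insert x B \<in> indep_sets M"
        using hyperplane_extra_point_indep[OF M(1) hyp[OF l(1)] B(1,2) _ x(2)] by blast
      have "x \<notin> B" using x B by blast
      then have cardx: "card (insert x B) = mrank M" using B indep_finite[OF ind] by simp
      \<comment> \<open>A circuit of \<open>mrank M\<close> points is small in \<open>K\<close> only
        if \<open>K\<close> still has full rank; \<open>insert x B\<close> is a basis inside
        \<open>N\<close>.\<close>
      then have rK: "mrank K = mrank M"
        unfolding K_def G(2) using mrank_restrict[OF ind, of G] cardx subset_trans[OF B(3) NG] subsetD[OF NG xg(2)] by simp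
      have "x \<in> mclosure K D" using subset_mclosure[of D K] circuit_ground[OF cK(2)] x by auto
      moreover have "insert x B \<in> indep_sets K" using ind subset_trans[OF B(3) NG] subsetD[OF NG xg(2)] by (simp add: K_def G(2))
      then have "x \<notin> mclosure K C" using mclosure_circuit_dep[OF cK(1) C(1), of x B] \<open>x \<notin> B\<close> by (auto simp: B_def)
      ultimately show ?thesis
        using cK C D rK NG p G(3) by (intro high_degree_of_two_closures[of C K D]) (auto simp: small_circuits_def K_def)
    qed
    then show ?case using Suc by (auto simp: K_def)
  qed
  then show False using M(2) \<open>N \<noteq> {}\<close> by (auto simp: nilpotent_matroid_def)
qed

section \<open>Subspaces of a paving matroid as dependent hyperplanes\<close>

lemma paving_subspace:
  assumes M: "paving M" and l: "l \<in> subspaces M"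
  shows "\<exists>C\<in>l. circuit M C \<and> card C = mrank M \<and> \<Union>l = mclosure M C \<and> l = closure_rel M `` {C}"
proof -
  obtain C where C: "C \<in> small_circuits M" "l = closure_rel M `` {C}"
    using l by (auto simp: subspaces_def quotient_def)
  have small: "circuit M D" "card D = mrank M" if "D \<in> small_circuits M" for D
    using that M by (auto simp: small_circuits_def paving_def)
  note c = small[OF C(1)]
  have "C \<in> l" using C by (simp add: closure_rel_def)
  have "\<Union>l = mclosure M C"
  proof
    show "\<Union>l \<subseteq> mclosure M C"
    proof
      fix x assume "x \<in> \<Union>l"
      then obtain D where D: "x \<in> D" "D \<in> small_circuits M" "mclosure M C = mclosure M D"
        using C by (auto simp: closure_rel_def)
      then show "x \<in> mclosure M C" using subset_mclosure[OF circuit_ground[OF small(1)[OF D(2)]]] by blast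
    qed
    show "mclosure M C \<subseteq> \<Union>l"
    proof
      fix x assume x: "x \<in> mclosure M C"
      show "x \<in> \<Union>l"
      proof (cases "x \<in> C")
        case True
        then show ?thesis using \<open>C \<in> l\<close> by blast
      next
        case False
        \<comment> \<open>Exchanging a point of \<open>C\<close> for \<open>x\<close> gives a
          circuit with the same closure, hence a member of the class that contains
          \<open>x\<close>.\<close>
        have "C \<noteq> {}" using circuit_not_indep[OF c(1)] by auto
        then obtain q where q: "q \<in> C" by blast
        define D where "D = insert x (C - {q})"
        have "card (C - {q}) + 1 = mrank M" using c q circuit_finite[OF c(1)] card_gt_0_iff[of C] by auto
        then have cardD: "card D = mrank M" using False circuit_finite[OF c(1)] by (simp add: D_def)
        have gr: "D \<subseteq> ground M" using circuit_ground[OF c(1)] x by (auto simp: D_def mclosure_def)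
        have "D \<notin> indep_sets M" using mclosure_circuit_dep[OF c(1) q x, of "C - {q}"] False by (auto simp: D_def)
        then have D: "circuit M D" using paving_circuit_iff[OF M gr cardD] by simp
        have "mclosure M C = mclosure M D"
        proof (rule hyperplane_eqI[OF M hyperplane_of_circuit[OF M c] hyperplane_of_circuit[OF M D cardD], of "C - {q}"])
          show "C - {q} \<subseteq> mclosure M C \<inter> mclosure M D"
            using subset_mclosure[OF circuit_ground[OF c(1)]] subset_mclosure[OF gr] by (auto simp: D_def)
        qed fact
        then have "D \<in> l" using C D cardD by (simp add: closure_rel_def small_circuits_def)
        then show ?thesis by (auto simp: D_def)
      qed
    qed
  qed
  then show ?thesis using c C \<open>C \<in> l\<close> by blast
qed

lemma paving_subspace_hyperplane:
  assumes "paving M" "l \<in> subspaces M"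
  shows "dependent_hyperplane M (\<Union>l)"
  using paving_subspace[OF assms] hyperplane_of_circuit[OF assms(1)] by metis

lemma paving_subspace_inj:
  assumes "paving M" "l \<in> subspaces M" "l' \<in> subspaces M" "\<Union>l = \<Union>l'"
  shows "l = l'"
  using paving_subspace[OF assms(1,2)] paving_subspace[OF assms(1,3)] assms(4)
  by (auto simp: closure_rel_def)

lemma paving_hyperplane_subspace:
  assumes M: "paving M" and H: "dependent_hyperplane M H"
  shows "\<exists>l\<in>subspaces M. \<Union>l = H"
proof -
  have "mrank M \<le> card H" "0 < mrank M"
    using H hyperplane_rank_pos[OF H] by (auto simp: dependent_hyperplane_def all_rank_subsets_circuits_def)
  then obtain C where C: "C \<subseteq> H" "card C = mrank M" by (meson obtain_subset_with_card_n)
  then have c: "circuit M C" using H by (auto simp: dependent_hyperplane_def all_rank_subsets_circuits_def)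
  define l where "l = closure_rel M `` {C}"
  have small: "C \<in> small_circuits M" using c C by (simp add: small_circuits_def)
  have l: "l \<in> subspaces M" using small by (auto simp: l_def subspaces_def quotient_def)
  have "C \<in> l" using small by (simp add: l_def closure_rel_def)
  obtain B where B: "B \<subseteq> C" "card B = mrank M - 1" using C by (metis diff_le_self obtain_subset_with_card_n)
  have "\<Union>l = H"
    by (rule hyperplane_eqI[OF M paving_subspace_hyperplane[OF M l] H, of B])
      (use B C \<open>C \<in> l\<close> \<open>0 < mrank M\<close> in auto)
  then show ?thesis using l by blast
qed

section \<open>Realizations\<close>

text \<open>Relative to a set \<open>N\<close> and a bare family of sets, so that it can be carried
  through the induction over \<open>buildable\<close>, one point at a time.\<close>

definition realizes :: "nat \<Rightarrow> 'a set set \<Rightarrow> 'a set \<Rightarrow> ('a \<Rightarrow> nat \<Rightarrow> complex) \<Rightarrow> bool" where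
  "realizes r \<I> N g \<longleftrightarrow> (\<forall>A\<subseteq>N. lindep r g A \<longleftrightarrow> A \<notin> \<I>)"

text \<open>No space over an infinite field is a finite union of proper subspaces: with
  \<open>w\<close> good for the old functionals and \<open>w'\<close> for the new one,
  \<open>w + s w'\<close> is good for all of them except for finitely many \<open>s\<close>.\<close>

lemma exists_avoiding:
  assumes "finite \<Theta>" "\<And>\<theta>. \<theta> \<in> \<Theta> \<Longrightarrow> \<exists>w\<in>K. dot r \<theta> w \<noteq> 0" "K \<noteq> {}"
    and K: "\<And>w w' s. w \<in> K \<Longrightarrow> w' \<in> K \<Longrightarrow> (\<lambda>i. w i + s * w' i) \<in> K"
  shows "\<exists>w\<in>K. \<forall>\<theta>\<in>\<Theta>. dot r \<theta> w \<noteq> 0"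
  using assms(1,2)
proof (induction \<Theta> rule: finite_induct)
  case empty
  then show ?case using assms(3) by auto
next
  case (insert \<theta> \<Theta>)
  then obtain w where w: "w \<in> K" "\<forall>\<theta>\<in>\<Theta>. dot r \<theta> w \<noteq> 0" by auto
  obtain w' where w': "w' \<in> K" "dot r \<theta> w' \<noteq> 0" using insert.prems by blast
  have "\<forall>\<^sub>F s in cofinite. dot r \<eta> w + s * dot r \<eta> w' \<noteq> 0" if "\<eta> \<in> insert \<theta> \<Theta>" for \<eta>
  proof -
    have poly: "polyfun (\<lambda>s. dot r \<eta> w + s * dot r \<eta> w')"
      by (intro polyfun_add polyfun_mult polyfun_const polyfun_id)
    show ?thesis
    proof (cases "dot r \<eta> w = 0")
      case True
      then have "\<eta> = \<theta>" using w(2) that by blast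
      then show ?thesis using polyfun_cofinite[OF poly, of 1] True w'(2) by simp
    next
      case False
      then show ?thesis using polyfun_cofinite[OF poly, of 0] by simp
    qed
  qed
  then have "\<forall>\<^sub>F s in cofinite. \<forall>\<eta>\<in>insert \<theta> \<Theta>. dot r \<eta> w + s * dot r \<eta> w' \<noteq> 0"
    using insert.hyps by (intro eventually_ball_finite) auto
  then obtain s where "\<forall>\<eta>\<in>insert \<theta> \<Theta>. dot r \<eta> w + s * dot r \<eta> w' \<noteq> 0"
    using eventually_happens'[OF cofinite_complex_neq_bot] by blast
  then have "\<forall>\<eta>\<in>insert \<theta> \<Theta>. dot r \<eta> (\<lambda>i. w i + s * w' i) \<noteq> 0"
    by (simp only: dot_linear)
  then show ?case using K[OF w(1) w'(1)] by blast
qed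

text \<open>Membership in the double annihilator expresses that \<open>g p\<close> lies in the span of \<open>B\<close>.\<close>

lemma lindep_insert_of_span:
  assumes "finite A" "\<And>l. kills r l g B \<Longrightarrow> dot r l (g p) = 0" "\<And>b. b \<in> B \<Longrightarrow> b \<in> A \<or> lindep r g (insert b A)" "p \<notin> A"
  shows "lindep r g (insert p A)"
proof (rule ccontr)
  assume indep: "\<not> lindep r g (insert p A)"
  then obtain l where l: "kills r l g (insert p A - {p})" "dot r l (g p) = 1"
    using dual_vector[of "insert p A" r g p] assms(1) by auto
  have kA: "kills r l g A" using l(1) assms(4) by (simp add: kills_def)
  have indA: "\<not> lindep r g A" using indep lindep_mono[of r g A "insert p A"] assms(1) by auto
  have "kills r l g B" unfolding kills_def
  proof
    fix b assume "b \<in> B"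
    then show "dot r l (g b) = 0"
      using assms(3) kills_lindep_insert[OF assms(1) indA _ kA] kA by (auto simp: kills_def)
  qed
  then show False using assms(2) l(2) by simp
qed

lemma realizes_extend:
  assumes her: "\<And>A B. A \<in> \<I> \<Longrightarrow> B \<subseteq> A \<Longrightarrow> B \<in> \<I>" and fin: "finite N" and g: "realizes r \<I> N g" and p: "p \<notin> N"
    and agree: "\<And>a i. a \<in> N \<Longrightarrow> i \<in> {1..r} \<Longrightarrow> g' a i = g a i"
    and dep: "\<And>A. A \<subseteq> N \<Longrightarrow> A \<in> \<I> \<Longrightarrow> insert p A \<notin> \<I> \<Longrightarrow> lindep r g' (insert p A)"
    and ind: "\<And>A. A \<subseteq> N \<Longrightarrow> insert p A \<in> \<I> \<Longrightarrow> \<not> lindep r g' (insert p A)"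
  shows "realizes r \<I> (insert p N) g'"
  unfolding realizes_def
proof (intro allI impI)
  fix A assume A: "A \<subseteq> insert p N"
  have old: "lindep r g' D \<longleftrightarrow> D \<notin> \<I>" if "D \<subseteq> N" for D
    using g that lindep_cong[of D r g' g] agree by (auto simp: realizes_def subset_iff)
  show "lindep r g' A \<longleftrightarrow> A \<notin> \<I>"
  proof (cases "p \<in> A")
    case False
    then show ?thesis using old A by blast
  next
    case True
    define D where "D = A - {p}"
    have D: "A = insert p D" "D \<subseteq> N" using True A by (auto simp: D_def)
    have finD: "finite D" using D(2) fin finite_subset by blast
    show ?thesis
    proof (cases "D \<in> \<I>")
      case True
      then show ?thesis using dep[OF D(2)] ind[OF D(2)] D(1) by blast
    next
      case False
      then have "lindep r g' D" using old D(2) by blast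
      then have "lindep r g' A" using lindep_mono[of r g' D A] D finD by auto
      then show ?thesis using False her[of A D] D by auto
    qed
  qed
qed

lemma buildable_finite: "buildable \<I> N \<Longrightarrow> finite N"
  by (induction rule: buildable.induct) auto

text \<open>The vector of \<open>p\<close> is chosen generic, in the whole space or in the span of
  \<open>B\<close>. Each \<open>A\<close> for which \<open>insert p A\<close> is independent
  excludes the kernel of one functional \<open>\<theta> A\<close> that kills \<open>A\<close>, and
  that functional does not vanish on the space of choices.\<close>

lemma exists_realization:
  assumes "buildable \<I> N" "{} \<in> \<I>" and her: "\<And>A B. A \<in> \<I> \<Longrightarrow> B \<subseteq> A \<Longrightarrow> B \<in> \<I>"
    and card: "\<And>A. A \<in> \<I> \<Longrightarrow> finite A \<and> card A \<le> r"
  shows "\<exists>g. realizes r \<I> N g"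
  using assms(1)
proof (induction rule: buildable.induct)
  case empty
  then show ?case using assms(2) by (auto simp: realizes_def)
next
  case (free N p)
  then obtain g where g: "realizes r \<I> N g" by blast
  have fin: "finite N" using buildable_finite free by blast
  define \<D> where "\<D> = {A. A \<subseteq> N \<and> insert p A \<in> \<I>}"
  have "\<exists>l. nonzero r l \<and> kills r l g A" if "A \<in> \<D>" for A
  proof -
    have "p \<notin> A" "finite A" using that free fin finite_subset by (auto simp: \<D>_def)
    then have "card A < r" using card[of "insert p A"] that by (auto simp: \<D>_def)
    then show ?thesis using exists_killing \<open>finite A\<close> by blast
  qed
  then obtain \<theta> where \<theta>: "\<And>A. A \<in> \<D> \<Longrightarrow> nonzero r (\<theta> A) \<and> kills r (\<theta> A) g A" by metis
  have "\<exists>w\<in>UNIV. \<forall>\<eta>\<in>\<theta> ` \<D>. dot r \<eta> w \<noteq> 0"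
  proof (rule exists_avoiding)
    show "finite (\<theta> ` \<D>)" using fin by (auto simp: \<D>_def)
    fix \<eta> assume "\<eta> \<in> \<theta> ` \<D>"
    then have "nonzero r \<eta>" using \<theta> by blast
    then obtain e where "dot r \<eta> e = 1" using exists_dot_one by blast
    then show "\<exists>w\<in>UNIV. dot r \<eta> w \<noteq> 0" by (intro bexI[of _ e]) auto
  qed auto
  then obtain v where v: "\<And>A. A \<in> \<D> \<Longrightarrow> dot r (\<theta> A) v \<noteq> 0" by blast
  have "realizes r \<I> (insert p N) (g(p := v))"
  proof (rule realizes_extend[OF her fin g free.hyps(2)])
    fix A assume A: "A \<subseteq> N" "insert p A \<in> \<I>"
    have pA: "p \<notin> A" using A free.hyps(2) by blast
    then have same: "(g(p := v)) a = g a" if "a \<in> A" for a using that by auto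
    have "A \<in> \<I>" using her[OF A(2)] by blast
    then have "\<not> lindep r g A" using g A(1) by (auto simp: realizes_def)
    then have "\<not> lindep r (g(p := v)) A" using lindep_cong[of A r "g(p := v)" g] same by simp
    moreover have "kills r (\<theta> A) (g(p := v)) A" "dot r (\<theta> A) v \<noteq> 0"
      using \<theta>[of A] v[of A] A same by (auto simp: \<D>_def kills_def)
    ultimately show "\<not> lindep r (g(p := v)) (insert p A)"
      using finite_subset[OF A(1) fin] pA by (intro not_lindep_insertI) auto
  qed (use free in auto)
  then show ?case by blast
next
  case (on_flat N p B)
  then obtain g where g: "realizes r \<I> N g" by blast
  have fin: "finite N" using buildable_finite on_flat by blast
  define \<D> where "\<D> = {A. A \<subseteq> N \<and> insert p A \<in> \<I>}"
  define K where "K = {v. \<forall>l. kills r l g B \<longrightarrow> dot r l v = 0}"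
  have "\<exists>l. (\<exists>b\<in>B. dot r l (g b) \<noteq> 0) \<and> kills r l g A" if A: "A \<in> \<D>" for A
  proof -
    have AN: "A \<subseteq> N" and AI: "A \<in> \<I>" using A her[of "insert p A" A] by (auto simp: \<D>_def)
    then obtain b where b: "b \<in> B" "b \<notin> A" "insert b A \<in> \<I>"
      using on_flat.hyps(5)[OF AN AI] A by (auto simp: \<D>_def)
    have "\<not> lindep r g (insert b A)" using g b AN on_flat.hyps(3) by (auto simp: realizes_def)
    then obtain l where "kills r l g (insert b A - {b})" "dot r l (g b) = 1"
      using dual_vector[of "insert b A" r g b] finite_subset[OF AN fin] by auto
    then show ?thesis using b by (intro exI[of _ l] conjI bexI[of _ b]) auto
  qed
  then obtain \<theta> where \<theta>: "\<And>A. A \<in> \<D> \<Longrightarrow> (\<exists>b\<in>B. dot r (\<theta> A) (g b) \<noteq> 0) \<and> kills r (\<theta> A) g A" by metis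
  have "\<exists>w\<in>K. \<forall>\<eta>\<in>\<theta> ` \<D>. dot r \<eta> w \<noteq> 0"
  proof (rule exists_avoiding)
    show "finite (\<theta> ` \<D>)" using fin by (auto simp: \<D>_def)
    fix \<eta> assume "\<eta> \<in> \<theta> ` \<D>"
    then obtain b where "b \<in> B" "dot r \<eta> (g b) \<noteq> 0" using \<theta> by blast
    then show "\<exists>w\<in>K. dot r \<eta> w \<noteq> 0" by (intro bexI[of _ "g b"]) (auto simp: K_def kills_def)
  next
    have "(\<lambda>_. 0) \<in> K" by (simp add: K_def dot_def)
    then show "K \<noteq> {}" by blast
  qed (auto simp: K_def dot_linear)
  then obtain v where vK: "v \<in> K" and v: "\<And>A. A \<in> \<D> \<Longrightarrow> dot r (\<theta> A) v \<noteq> 0" by blast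
  have same: "(g(p := v)) a = g a" if "a \<in> N" for a using that on_flat.hyps(2) by auto
  have cong: "lindep r (g(p := v)) A \<longleftrightarrow> A \<notin> \<I>" if "A \<subseteq> N" for A
    using g that lindep_cong[of A r "g(p := v)" g] same by (auto simp: realizes_def subset_iff)
  have "realizes r \<I> (insert p N) (g(p := v))"
  proof (rule realizes_extend[OF her fin g on_flat.hyps(2)])
    fix A assume A: "A \<subseteq> N" "insert p A \<in> \<I>"
    have pA: "p \<notin> A" using A on_flat.hyps(2) by blast
    have "A \<in> \<I>" using her[OF A(2)] by blast
    then have "\<not> lindep r (g(p := v)) A" using cong[OF A(1)] by simp
    moreover have "kills r (\<theta> A) (g(p := v)) A" "dot r (\<theta> A) v \<noteq> 0"
      using \<theta>[of A] v[of A] A pA same by (auto simp: \<D>_def kills_def subset_iff)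
    ultimately show "\<not> lindep r (g(p := v)) (insert p A)"
      using finite_subset[OF A(1) fin] pA by (intro not_lindep_insertI) auto
  next
    fix A assume A: "A \<subseteq> N" "A \<in> \<I>" "insert p A \<notin> \<I>"
    show "lindep r (g(p := v)) (insert p A)"
    proof (rule lindep_insert_of_span[of A r "g(p := v)" B])
      show "finite A" using A(1) fin finite_subset by blast
      show "p \<notin> A" using A(1) on_flat.hyps(2) by blast
      show "dot r l ((g(p := v)) p) = 0" if "kills r l (g(p := v)) B" for l
        using that vK on_flat.hyps(3) same by (auto simp: K_def kills_def subset_iff)
      fix b assume "b \<in> B"
      then show "b \<in> A \<or> lindep r (g(p := v)) (insert b A)"
        using on_flat.hyps(5)[OF A(1,2)] A on_flat.hyps(3) cong[of "insert b A"] by blast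
    qed
  qed (use same in auto)
  then show ?case by blast
qed

text \<open>A free point moves along a segment; a point on a flat moves by its coefficients with
  respect to \<open>B\<close>, which keeps it in the moving span. The required dependences thus hold
  by construction, and the independences hold at \<open>t = 0\<close>, hence for almost all
  \<open>t\<close>.\<close>

lemma realization_curve:
  assumes "buildable \<I> N" and her: "\<And>A B. A \<in> \<I> \<Longrightarrow> B \<subseteq> A \<Longrightarrow> B \<in> \<I>"
    and "realizes r \<I> N g0" "realizes r \<I> N g1"
  shows "\<exists>h. (\<forall>a i. polyfun (\<lambda>t. h t a i)) \<and>
    (\<forall>a\<in>N. \<forall>i\<in>{1..r}. h 0 a i = g0 a i \<and> h 1 a i = g1 a i) \<and>
    (\<forall>\<^sub>F t in cofinite. realizes r \<I> N (h t))"
  using assms(1,3,4)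
proof (induction rule: buildable.induct)
  case empty
  then show ?case by (intro exI[of _ "\<lambda>_ _ _. 0"]) (auto simp: realizes_def intro: polyfun_const)
next
  case (free N p)
  have sub: "realizes r \<I> N g" if "realizes r \<I> (insert p N) g" for g
    using that by (auto simp: realizes_def subset_insertI2)
  obtain h where h: "\<And>a i. polyfun (\<lambda>t. h t a i)" "\<And>a i. a \<in> N \<Longrightarrow> i \<in> {1..r} \<Longrightarrow> h 0 a i = g0 a i \<and> h 1 a i = g1 a i"
      "\<forall>\<^sub>F t in cofinite. realizes r \<I> N (h t)"
    using free.IH[OF sub sub] free.prems by blast
  have fin: "finite N" using buildable_finite free by blast
  define k where "k = (\<lambda>t. (h t)(p := (\<lambda>i. (1 - t) * g0 p i + t * g1 p i)))"
  have k: "polyfun (\<lambda>t. k t a i)" for a i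
  proof (cases "a = p")
    case True
    then show ?thesis unfolding k_def
      by simp (intro polyfun_add polyfun_mult polyfun_diff polyfun_const polyfun_id)
  next
    case False
    then show ?thesis using h(1) unfolding k_def by simp
  qed
  have k01: "k 0 a i = g0 a i \<and> k 1 a i = g1 a i" if "a \<in> insert p N" "i \<in> {1..r}" for a i
    using that h(2) unfolding k_def by auto
  have "\<forall>\<^sub>F t in cofinite. \<not> lindep r (k t) A" if "A \<subseteq> insert p N" "A \<in> \<I>" for A
  proof (rule independent_cofinite[of A k r 0])
    have "\<not> lindep r g0 A" using free.prems(1) that by (auto simp: realizes_def)
    then show "\<not> lindep r (k 0) A" using lindep_cong[of A r "k 0" g0] k01 that(1) by (auto simp: subset_iff)
  qed (use k finite_subset[OF that(1)] fin in auto)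
  then have "\<forall>\<^sub>F t in cofinite. \<forall>A\<in>{A. A \<subseteq> insert p N \<and> A \<in> \<I>}. \<not> lindep r (k t) A"
    using fin by (intro eventually_ball_finite) auto
  with h(3) have "\<forall>\<^sub>F t in cofinite. realizes r \<I> (insert p N) (k t)"
  proof eventually_elim
    case (elim t)
    show ?case
    proof (rule realizes_extend[OF her fin elim(1) free.hyps(2)])
      show "k t a i = h t a i" if "a \<in> N" for a i using that free.hyps(2) by (auto simp: k_def)
    qed (use elim(2) free.hyps(3) in \<open>auto simp: subset_insertI2\<close>)
  qed
  then show ?case using k k01 by blast
next
  case (on_flat N p B)
  have sub: "realizes r \<I> N g" if "realizes r \<I> (insert p N) g" for g
    using that by (auto simp: realizes_def subset_insertI2)
  obtain h where h: "\<And>a i. polyfun (\<lambda>t. h t a i)" "\<And>a i. a \<in> N \<Longrightarrow> i \<in> {1..r} \<Longrightarrow> h 0 a i = g0 a i \<and> h 1 a i = g1 a i"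
      "\<forall>\<^sub>F t in cofinite. realizes r \<I> N (h t)"
    using on_flat.IH[OF sub sub] on_flat.prems by blast
  have fin: "finite N" using buildable_finite on_flat by blast
  have finB: "finite B" using fin on_flat.hyps(3) finite_subset by blast
  have "insert p B \<notin> \<I>" using on_flat.hyps(5)[OF on_flat.hyps(3,4)] by blast
  then have span: "\<exists>c. \<forall>i\<in>{1..r}. g p i = (\<Sum>b\<in>B. c b * g b i)" if "realizes r \<I> (insert p N) g" for g
    using that on_flat.hyps(3,4) finB by (intro span_of_lindep_insert) (auto simp: realizes_def subset_insertI2)
  obtain c0 where c0: "\<And>i. i \<in> {1..r} \<Longrightarrow> g0 p i = (\<Sum>b\<in>B. c0 b * g0 b i)" using span[OF on_flat.prems(1)] by blast
  obtain c1 where c1: "\<And>i. i \<in> {1..r} \<Longrightarrow> g1 p i = (\<Sum>b\<in>B. c1 b * g1 b i)" using span[OF on_flat.prems(2)] by blast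
  define k where "k = (\<lambda>t. (h t)(p := (\<lambda>i. \<Sum>b\<in>B. ((1 - t) * c0 b + t * c1 b) * h t b i)))"
  have k: "polyfun (\<lambda>t. k t a i)" for a i
  proof (cases "a = p")
    case True
    then show ?thesis unfolding k_def
      by simp (intro polyfun_sum polyfun_add polyfun_mult polyfun_diff polyfun_const polyfun_id h(1))
  next
    case False
    then show ?thesis using h(1) unfolding k_def by simp
  qed
  have k01: "k 0 a i = g0 a i \<and> k 1 a i = g1 a i" if "a \<in> insert p N" "i \<in> {1..r}" for a i
  proof (cases "a = p")
    case True
    have "(\<Sum>b\<in>B. c0 b * h 0 b i) = (\<Sum>b\<in>B. c0 b * g0 b i)" "(\<Sum>b\<in>B. c1 b * h 1 b i) = (\<Sum>b\<in>B. c1 b * g1 b i)"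
      using h(2) that(2) on_flat.hyps(3) by (auto intro!: sum.cong)
    then show ?thesis using True c0 c1 that(2) unfolding k_def by simp
  next
    case False
    then show ?thesis using that h(2) unfolding k_def by auto
  qed
  have "\<forall>\<^sub>F t in cofinite. \<not> lindep r (k t) A" if "A \<subseteq> insert p N" "A \<in> \<I>" for A
  proof (rule independent_cofinite[of A k r 0])
    have "\<not> lindep r g0 A" using on_flat.prems(1) that by (auto simp: realizes_def)
    then show "\<not> lindep r (k 0) A" using lindep_cong[of A r "k 0" g0] k01 that(1) by (auto simp: subset_iff)
  qed (use k finite_subset[OF that(1)] fin in auto)
  then have "\<forall>\<^sub>F t in cofinite. \<forall>A\<in>{A. A \<subseteq> insert p N \<and> A \<in> \<I>}. \<not> lindep r (k t) A"
    using fin by (intro eventually_ball_finite) auto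
  with h(3) have "\<forall>\<^sub>F t in cofinite. realizes r \<I> (insert p N) (k t)"
  proof eventually_elim
    case (elim t)
    have same: "k t a i = h t a i" if "a \<in> N" for a i using that on_flat.hyps(2) by (auto simp: k_def)
    show ?case
    proof (rule realizes_extend[OF her fin elim(1) on_flat.hyps(2) same])
      fix A assume A: "A \<subseteq> N" "A \<in> \<I>" "insert p A \<notin> \<I>"
      show "lindep r (k t) (insert p A)"
      proof (rule lindep_insert_of_span[of A r "k t" B])
        show "finite A" using A(1) fin finite_subset by blast
        show "p \<notin> A" using A(1) on_flat.hyps(2) by blast
        show "dot r l (k t p) = 0" if l: "kills r l (k t) B" for l
        proof (rule kills_span[OF l])
          show "k t p i = (\<Sum>b\<in>B. ((1 - t) * c0 b + t * c1 b) * k t b i)" for i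
            using same on_flat.hyps(3) by (auto simp: k_def intro!: sum.cong)
        qed
        fix b assume b: "b \<in> B"
        have bA: "insert b A \<subseteq> N" using b A(1) on_flat.hyps(3) by blast
        then have "lindep r (k t) (insert b A) \<longleftrightarrow> lindep r (h t) (insert b A)"
          by (intro lindep_cong same) blast
        then have "lindep r (k t) (insert b A) \<longleftrightarrow> insert b A \<notin> \<I>"
          using elim(1) bA unfolding realizes_def by blast
        then show "b \<in> A \<or> lindep r (k t) (insert b A)"
          using on_flat.hyps(5)[OF A(1,2)] A b by blast
      qed
    qed (use elim(2) in \<open>auto simp: subset_insertI2\<close>)
  qed
  then show ?case using k k01 by blast
qed

subsection \<open>Points of the coordinate space\<close>

definition ev :: "('a \<Rightarrow> nat \<Rightarrow> complex) \<Rightarrow> (nat \<times> 'a) cpoly \<Rightarrow> complex" where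
  "ev g P = peval (\<lambda>(i, a). g a i) P"

definition coords :: "'a matroid \<Rightarrow> ('a \<Rightarrow> nat \<Rightarrow> complex) \<Rightarrow> nat \<times> 'a \<Rightarrow> complex" where
  "coords M g = restrict (\<lambda>(i, a). g a i) (matrix_index M)"

abbreviation realizes_matroid :: "'a matroid \<Rightarrow> ('a \<Rightarrow> nat \<Rightarrow> complex) \<Rightarrow> bool" where
  "realizes_matroid M g \<equiv> realizes (mrank M) (indep_sets M) (ground M) g"

lemma coords_affine: "coords M g \<in> affine_space (matrix_index M)"
  by (auto simp: coords_def affine_space_def)

lemma peval_coords:
  assumes "P \<in> pring (matrix_index M)"
  shows "peval (coords M g) P = ev g P"
  unfolding ev_def coords_def using assms by (intro peval_cong) (auto simp: pring_def)

lemma family_dependent_vectors: "family_dependent r \<gamma> A \<longleftrightarrow> lindep r (\<lambda>a i. \<gamma> (i, a)) A"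
  by (simp add: lindep_def)

lemma family_dependent_coords:
  assumes "A \<subseteq> ground M"
  shows "family_dependent (mrank M) (coords M g) A \<longleftrightarrow> lindep (mrank M) g A"
  unfolding family_dependent_vectors using assms
  by (intro lindep_cong) (auto simp: coords_def matrix_index_def)

lemma ev_vectors: "ev (\<lambda>a i. \<gamma> (i, a)) P = peval \<gamma> P"
  by (simp add: ev_def)

lemma realizations_iff:
  "\<gamma> \<in> realizations M \<longleftrightarrow> \<gamma> \<in> affine_space (matrix_index M) \<and> realizes_matroid M (\<lambda>a i. \<gamma> (i, a))"
  by (auto simp: realizations_def realizes_def family_dependent_vectors dep_set_def)

lemma coords_realizations: "realizes_matroid M g \<Longrightarrow> coords M g \<in> realizations M"
  by (auto simp: realizations_def coords_affine realizes_def family_dependent_coords dep_set_def)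

lemma polyfun_ev: "(\<And>a i. polyfun (\<lambda>t. h t a i)) \<Longrightarrow> polyfun (\<lambda>t. ev (h t) P)"
  unfolding ev_def by (intro polyfun_peval) (auto simp: split_beta)

lemma tendsto_ev:
  assumes "\<And>a i. ((\<lambda>x. f x a i) \<longlongrightarrow> g a i) F"
  shows "((\<lambda>x. ev (f x) P) \<longlongrightarrow> ev g P) F"
  unfolding ev_def by (intro tendsto_peval) (use assms in \<open>auto simp: split_beta\<close>)

lemma ev_cong:
  assumes "P \<in> pring (matrix_index M)" "\<And>a i. a \<in> ground M \<Longrightarrow> i \<in> {1..mrank M} \<Longrightarrow> g a i = g' a i"
  shows "ev g P = ev g' P"
  unfolding ev_def using assms by (intro peval_cong) (auto simp: pring_def matrix_index_def)

theorem nilpotent_realizable: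
  assumes "nilpotent_matroid M"
  shows "realizable M"
proof -
  have "\<exists>g. realizes_matroid M g"
    using nilpotent_buildable[OF assms] indep_subset[of _ M] card_le_mrank[of _ M] indep_finite[of _ M]
    by (intro exists_realization) auto
  then show ?thesis using coords_realizations unfolding realizable_def by blast
qed

text \<open>A realization outside each closed set is witnessed by a polynomial that is nonzero
  there. On a curve joining the two, both polynomials are nonzero at almost all parameters, which
  gives a realization outside the union.\<close>

theorem nilpotent_irreducible:
  assumes "nilpotent_matroid M"
  shows "zariski_irreducible (matrix_index M) (realizations M)"
  unfolding zariski_irreducible_def
proof (intro allI impI, rule ccontr)
  fix Z1 Z2
  assume Z: "zariski_closed (matrix_index M) Z1 \<and> zariski_closed (matrix_index M) Z2 \<and> realizations M \<subseteq> Z1 \<union> Z2"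
    and no: "\<not> (realizations M \<subseteq> Z1 \<or> realizations M \<subseteq> Z2)"
  have sep: "\<exists>P \<gamma>. P \<in> pring (matrix_index M) \<and> (\<forall>\<delta>\<in>Z. peval \<delta> P = 0) \<and> \<gamma> \<in> realizations M \<and> peval \<gamma> P \<noteq> 0"
    if Zc: "zariski_closed (matrix_index M) Z" "\<not> realizations M \<subseteq> Z" for Z
  proof -
    obtain S where S: "S \<subseteq> pring (matrix_index M)" "Z = {\<gamma> \<in> affine_space (matrix_index M). \<forall>p\<in>S. peval \<gamma> p = 0}"
      using Zc(1) by (auto simp: zariski_closed_def carrier_poly_ring)
    obtain \<gamma> where "\<gamma> \<in> realizations M" "\<gamma> \<notin> Z" using Zc(2) by blast
    moreover from this have "\<gamma> \<in> affine_space (matrix_index M)" by (simp add: realizations_iff)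
    ultimately obtain P where "P \<in> S" "peval \<gamma> P \<noteq> 0" using S(2) by blast
    then show ?thesis using S \<open>\<gamma> \<in> realizations M\<close> by blast
  qed
  obtain P0 \<gamma>0 where P0: "P0 \<in> pring (matrix_index M)" "\<forall>\<delta>\<in>Z1. peval \<delta> P0 = 0" "\<gamma>0 \<in> realizations M" "peval \<gamma>0 P0 \<noteq> 0"
    using sep[of Z1] Z no by blast
  obtain P1 \<gamma>1 where P1: "P1 \<in> pring (matrix_index M)" "\<forall>\<delta>\<in>Z2. peval \<delta> P1 = 0" "\<gamma>1 \<in> realizations M" "peval \<gamma>1 P1 \<noteq> 0"
    using sep[of Z2] Z no by blast
  let ?g0 = "\<lambda>a i. \<gamma>0 (i, a)" and ?g1 = "\<lambda>a i. \<gamma>1 (i, a)"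
  have "\<exists>h. (\<forall>a i. polyfun (\<lambda>t. h t a i)) \<and>
    (\<forall>a\<in>ground M. \<forall>i\<in>{1..mrank M}. h 0 a i = ?g0 a i \<and> h 1 a i = ?g1 a i) \<and>
    (\<forall>\<^sub>F t in cofinite. realizes_matroid M (h t))"
    using nilpotent_buildable[OF assms] indep_subset[of _ M] P0(3) P1(3) unfolding realizations_iff
    by (intro realization_curve) auto
  then obtain h where h: "\<And>a i. polyfun (\<lambda>t. h t a i)"
      "\<And>a i. a \<in> ground M \<Longrightarrow> i \<in> {1..mrank M} \<Longrightarrow> h 0 a i = ?g0 a i \<and> h 1 a i = ?g1 a i"
      "\<forall>\<^sub>F t in cofinite. realizes_matroid M (h t)" by blast
  have "ev (h 0) P0 = ev ?g0 P0" using h(2) by (intro ev_cong[OF P0(1)]) auto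
  then have "\<forall>\<^sub>F t in cofinite. ev (h t) P0 \<noteq> 0"
    using P0(4) by (intro polyfun_cofinite[of _ 0] polyfun_ev h(1)) (simp add: ev_vectors)
  moreover have "ev (h 1) P1 = ev ?g1 P1" using h(2) by (intro ev_cong[OF P1(1)]) auto
  then have "\<forall>\<^sub>F t in cofinite. ev (h t) P1 \<noteq> 0"
    using P1(4) by (intro polyfun_cofinite[of _ 1] polyfun_ev h(1)) (simp add: ev_vectors)
  ultimately have "\<forall>\<^sub>F t in cofinite. realizes_matroid M (h t) \<and> ev (h t) P0 \<noteq> 0 \<and> ev (h t) P1 \<noteq> 0"
    using h(3) by eventually_elim auto
  then obtain t where t: "realizes_matroid M (h t)" "ev (h t) P0 \<noteq> 0" "ev (h t) P1 \<noteq> 0"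
    using eventually_happens'[OF cofinite_complex_neq_bot] by blast
  have "coords M (h t) \<in> Z1 \<union> Z2" using coords_realizations[OF t(1)] Z by blast
  moreover have "peval (coords M (h t)) P0 \<noteq> 0" "peval (coords M (h t)) P1 \<noteq> 0"
    using t P0(1) P1(1) by (simp_all add: peval_coords)
  ultimately show False using P0(2) P1(2) by blast
qed

subsection \<open>The Zariski closure of the realization space\<close>

text \<open>The matroid variety for total families; values outside \<open>matrix_index M\<close> do
  not matter (\<open>zclosure_cong\<close>), which spares restrictions along curves.\<close>

definition zclosure :: "'a matroid \<Rightarrow> ('a \<Rightarrow> nat \<Rightarrow> complex) set" where
  "zclosure M = {g. \<forall>P\<in>pring (matrix_index M). (\<forall>\<gamma>\<in>realizations M. peval \<gamma> P = 0) \<longrightarrow> ev g P = 0}"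

lemma matroid_variety_iff:
  "\<gamma> \<in> matroid_variety M \<longleftrightarrow> \<gamma> \<in> affine_space (matrix_index M) \<and> (\<lambda>a i. \<gamma> (i, a)) \<in> zclosure M"
proof -
  define S where "S = {P \<in> pring (matrix_index M). \<forall>\<gamma>\<in>realizations M. peval \<gamma> P = 0}"
  define Z where "Z = {\<gamma> \<in> affine_space (matrix_index M). \<forall>P\<in>S. peval \<gamma> P = 0}"
  have "S \<subseteq> pring (matrix_index M)" by (simp add: S_def)
  then have Z: "zariski_closed (matrix_index M) Z"
    unfolding zariski_closed_def carrier_poly_ring Z_def by (intro exI[of _ S]) simp
  have RZ: "realizations M \<subseteq> Z"
    unfolding Z_def S_def by (simp add: subset_iff realizations_iff)
  have "matroid_variety M = Z"
  proof
    show "matroid_variety M \<subseteq> Z"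
      unfolding matroid_variety_def zariski_closure_def using Z RZ by (intro hull_minimal)
    show "Z \<subseteq> matroid_variety M"
      unfolding matroid_variety_def zariski_closure_def hull_def
    proof (intro Inter_greatest)
      fix t assume "t \<in> {t. zariski_closed (matrix_index M) t \<and> realizations M \<subseteq> t}"
      then obtain T where T: "T \<subseteq> pring (matrix_index M)" "t = {\<gamma> \<in> affine_space (matrix_index M). \<forall>p\<in>T. peval \<gamma> p = 0}"
          "realizations M \<subseteq> t"
        by (auto simp: zariski_closed_def carrier_poly_ring)
      then have "T \<subseteq> S" by (auto simp: S_def)
      then show "Z \<subseteq> t" using T(2) by (auto simp: Z_def)
    qed
  qed
  then show ?thesis by (auto simp: Z_def S_def zclosure_def ev_vectors)
qed

lemma realizes_zclosure:
  assumes "realizes_matroid M g"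
  shows "g \<in> zclosure M"
  unfolding zclosure_def
proof (intro CollectI ballI impI)
  fix P assume "P \<in> pring (matrix_index M)" "\<forall>\<gamma>\<in>realizations M. peval \<gamma> P = 0"
  then show "ev g P = 0" using coords_realizations[OF assms] peval_coords[of P M g] by auto
qed

lemma zclosure_cong:
  assumes "g \<in> zclosure M" "\<And>a i. a \<in> ground M \<Longrightarrow> i \<in> {1..mrank M} \<Longrightarrow> g a i = g' a i"
  shows "g' \<in> zclosure M"
  using assms ev_cong[of _ M g g'] by (simp add: zclosure_def)

lemma zclosure_curve:
  assumes "\<And>a i. polyfun (\<lambda>t. h t a i)" "\<exists>\<^sub>F t in cofinite. h t \<in> zclosure M"
  shows "h t \<in> zclosure M"
  unfolding zclosure_def
proof (intro CollectI ballI impI)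
  fix P assume P: "P \<in> pring (matrix_index M)" "\<forall>\<gamma>\<in>realizations M. peval \<gamma> P = 0"
  have "\<exists>\<^sub>F t in cofinite. ev (h t) P = 0"
    using assms(2) by (rule frequently_elim1) (use P in \<open>auto simp: zclosure_def\<close>)
  then show "ev (h t) P = 0"
    by (intro polyfun_frequently_zero[of "\<lambda>t. ev (h t) P"] polyfun_ev assms(1))
qed

text \<open>Polynomials are continuous, so the Zariski closure is closed under limits along any
  filter, in particular those coming from the product topology.\<close>

lemma zclosure_limit:
  assumes "F \<noteq> bot" "\<forall>\<^sub>F x in F. f x \<in> zclosure M" "\<And>a i. ((\<lambda>x. f x a i) \<longlongrightarrow> g a i) F"
  shows "g \<in> zclosure M"
  unfolding zclosure_def
proof (intro CollectI ballI impI)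
  fix P assume P: "P \<in> pring (matrix_index M)" "\<forall>\<gamma>\<in>realizations M. peval \<gamma> P = 0"
  have "\<forall>\<^sub>F x in F. ev (f x) P = 0"
    using assms(2) by (rule eventually_mono) (use P in \<open>auto simp: zclosure_def\<close>)
  then have "((\<lambda>x. ev (f x) P) \<longlongrightarrow> 0) F" by (rule tendsto_eventually)
  moreover have "((\<lambda>x. ev (f x) P) \<longlongrightarrow> ev g P) F" by (intro tendsto_ev assms(3))
  ultimately show "ev g P = 0" using tendsto_unique[OF assms(1)] by metis
qed

lemma matroid_variety_subset_circuit_variety:
  assumes "\<gamma> \<in> realizations M"
  shows "\<gamma> \<in> circuit_variety M"
  using assms by (auto simp: realizations_def circuit_variety_def dep_set_def)

text \<open>Independence of \<open>A\<close> at \<open>g\<close> is an open condition. Continuing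
  dual vectors over the algebra of polynomial functions on the space of families gives for each
  \<open>a\<close> a polynomial with value 1 at \<open>g\<close> whose nonvanishing provides a dual
  vector; the product of these would separate \<open>g\<close> from all realizations.\<close>

lemma zclosure_lindep:
  fixes M :: "'a matroid"
  assumes g: "g \<in> zclosure M" and A: "dep_set M A"
  shows "lindep (mrank M) g A"
proof (rule ccontr)
  assume ind: "\<not> lindep (mrank M) g A"
  define r where "r = mrank M"
  define R :: "(('a \<Rightarrow> nat \<Rightarrow> complex) \<Rightarrow> complex) set"
    where "R = {f. \<exists>P\<in>pring (matrix_index M). f = (\<lambda>x. ev x P)}"
  have Agr: "A \<subseteq> ground M" using A by (simp add: dep_set_def)
  then have fin: "finite A" by (rule finite_subset) simp
  have R: "(\<lambda>x. ev x P) \<in> R" if "P \<in> pring (matrix_index M)" for P using that by (auto simp: R_def)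
  have alg: "function_algebra R"
    unfolding function_algebra_def
  proof (intro conjI allI ballI)
    show "(\<lambda>_. c) \<in> R" for c using R[OF pring_Const[of c]] by (simp add: ev_def)
    fix f1 f2 assume "f1 \<in> R" "f2 \<in> R"
    then obtain P Q where PQ: "P \<in> pring (matrix_index M)" "Q \<in> pring (matrix_index M)"
      "f1 = (\<lambda>x. ev x P)" "f2 = (\<lambda>x. ev x Q)" by (auto simp: R_def)
    show "(\<lambda>x. f1 x + f2 x) \<in> R" "(\<lambda>x. f1 x - f2 x) \<in> R" "(\<lambda>x. f1 x * f2 x) \<in> R"
      using R[OF pring_add[OF PQ(1,2)]] R[OF pring_diff[OF PQ(1,2)]] R[OF pring_mult[OF PQ(1,2)]]
      unfolding PQ(3,4) by (simp_all add: ev_def peval_add peval_diff peval_mult)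
  qed
  \<comment> \<open>Coordinates outside \<open>{1..r}\<close> are not among the variables; setting
    them to 0 makes every coordinate function polynomial.\<close>
  define v where "v = (\<lambda>(x :: 'a \<Rightarrow> nat \<Rightarrow> complex) a i. if i \<in> {1..r} then x a i else 0)"
  have vR: "(\<lambda>x. v x a i) \<in> R" if "a \<in> A" for a i
  proof (cases "i \<in> {1..r}")
    case True
    then have "(i, a) \<in> matrix_index M" using that Agr by (auto simp: matrix_index_def r_def)
    then show ?thesis using R[OF pring_Var[of "(i, a)"]] True by (simp add: v_def ev_def)
  next
    case False
    then have "(\<lambda>x. v x a i) = (\<lambda>_. 0)" unfolding v_def by (intro ext) (rule if_not_P)
    then show ?thesis using alg by (simp add: function_algebra_def)
  qed
  have v: "lindep r (v x) B \<longleftrightarrow> lindep r x B" for x B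
    by (rule lindep_cong) (simp add: v_def)
  have "\<exists>q\<in>R. q g = 1 \<and> (\<forall>x. q x \<noteq> 0 \<longrightarrow> (\<exists>l. kills r l (v x) (A - {a}) \<and> dot r l (v x a) \<noteq> 0))" if a: "a \<in> A" for a
  proof -
    have ind': "\<not> lindep r (v g) A" using ind v by (simp add: r_def)
    then obtain l0 where l0: "kills r l0 (v g) (A - {a})" "dot r l0 (v g a) = 1"
      using dual_vector[OF fin _ a] by blast
    have "\<not> lindep r (v g) (A - {a})" using ind' fin lindep_mono[of r "v g" "A - {a}" A] by auto
    then obtain l where l: "\<And>i. (\<lambda>x. l x i) \<in> R" "l g = l0" "\<And>x. kills r (l x) (v x) (A - {a})"
      using orthogonal_continuation[OF alg, of "A - {a}" v r g l0] fin vR l0 by auto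
    have "(\<lambda>x. dot r (l x) (v x a)) \<in> R" using function_algebra_dot[OF alg l(1) vR[OF a]] .
    then show ?thesis using l l0 by (intro bexI[of _ "\<lambda>x. dot r (l x) (v x a)"]) auto
  qed
  then obtain q where q: "\<And>a. a \<in> A \<Longrightarrow> q a \<in> R" "\<And>a. a \<in> A \<Longrightarrow> q a g = 1"
      "\<And>a x. a \<in> A \<Longrightarrow> q a x \<noteq> 0 \<Longrightarrow> \<exists>l. kills r l (v x) (A - {a}) \<and> dot r l (v x a) \<noteq> 0" by metis
  obtain P where P: "\<And>a. a \<in> A \<Longrightarrow> P a \<in> pring (matrix_index M)" "\<And>a. a \<in> A \<Longrightarrow> q a = (\<lambda>x. ev x (P a))"
    using q(1) unfolding R_def by (simp add: Bex_def) metis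
  define Q where "Q = (\<Prod>a\<in>A. P a)"
  have Q: "Q \<in> pring (matrix_index M)" unfolding Q_def using P(1) by auto
  have evQ: "ev x Q = (\<Prod>a\<in>A. q a x)" for x
    using P(2) by (simp add: Q_def ev_def peval_prod)
  have "peval \<gamma> Q = 0" if \<gamma>: "\<gamma> \<in> realizations M" for \<gamma>
  proof (rule ccontr)
    let ?x = "\<lambda>a i. \<gamma> (i, a)"
    assume "peval \<gamma> Q \<noteq> 0"
    then have "(\<Prod>a\<in>A. q a ?x) \<noteq> 0" using evQ[of ?x] by (simp add: ev_vectors)
    then have "q a ?x \<noteq> 0" if "a \<in> A" for a using that fin by simp
    then have "\<not> lindep r (v ?x) A" using q(3) fin by (intro not_lindepI_dual) auto
    moreover have "lindep r ?x A" using \<gamma> A Agr by (auto simp: realizations_iff realizes_def r_def dep_set_def)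
    ultimately show False using v by simp
  qed
  then have "ev g Q = 0" using g Q by (auto simp: zclosure_def)
  moreover have "ev g Q = 1" using evQ[of g] q(2) by simp
  ultimately show False by simp
qed

section \<open>Limits of families with their hyperplane functionals\<close>

lemma tendsto_fun_iff:
  "(f \<longlongrightarrow> l) F \<longleftrightarrow> (\<forall>i. ((\<lambda>c. f c i) \<longlongrightarrow> l i) F)" for f :: "'x \<Rightarrow> 'i \<Rightarrow> 'b::topological_space"
  using limitin_componentwise[of "\<lambda>_. euclidean :: 'b topology" UNIV f l F]
  by (simp add: euclidean_product_topology)

text \<open>Filters instead of sequences: families are indexed by arbitrary types, and the product
  topology need not be first countable.\<close>

lemma closure_filter:
  assumes "y \<in> closure S"
  shows "inf (nhds y) (principal S) \<noteq> bot"
proof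
  assume "inf (nhds y) (principal S) = bot"
  then have "eventually (\<lambda>_. False) (inf (nhds y) (principal S))" by simp
  then have "eventually (\<lambda>x. x \<notin> S) (nhds y)" by (simp add: eventually_inf_principal)
  then obtain U where "open U" "y \<in> U" "\<forall>x\<in>U. x \<notin> S" unfolding eventually_nhds by blast
  then show False using assms unfolding closure_iff_nhds_not_empty by blast
qed

lemma closureI_limit:
  assumes "F \<noteq> bot" "\<forall>\<^sub>F x in F. f x \<in> T" "(f \<longlongrightarrow> y) F"
  shows "y \<in> closure T"
proof -
  have "\<forall>\<^sub>F x in F. f x \<in> closure T" using assms(2)
    by (rule eventually_mono) (use closure_subset in blast)
  then show ?thesis using Lim_in_closed_set[OF closed_closure _ assms(1,3)] by blast
qed

type_synonym 'a framed_family = "('a \<Rightarrow> nat \<Rightarrow> complex) \<times> ('a set \<Rightarrow> nat \<Rightarrow> complex)"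

lemma tendsto_framed:
  fixes f :: "'x \<Rightarrow> 'a framed_family"
  assumes "\<And>a i. ((\<lambda>x. fst (f x) a i) \<longlongrightarrow> g a i) F" "\<And>H i. ((\<lambda>x. snd (f x) H i) \<longlongrightarrow> l H i) F"
  shows "(f \<longlongrightarrow> (g, l)) F"
proof -
  have "((\<lambda>x. (fst (f x), snd (f x))) \<longlongrightarrow> (g, l)) F"
    using assms by (intro tendsto_Pair) (simp_all add: tendsto_fun_iff)
  then show ?thesis by simp
qed

lemma closure_framed_filter:
  fixes S :: "'a framed_family set"
  assumes "(g, l) \<in> closure S"
  obtains F where "F \<noteq> bot" "\<forall>\<^sub>F x in F. x \<in> S" "\<And>a i. ((\<lambda>x. fst x a i) \<longlongrightarrow> g a i) F"
    "\<And>H i. ((\<lambda>x. snd x H i) \<longlongrightarrow> l H i) F"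
proof
  let ?F = "inf (nhds (g, l)) (principal S)"
  show "?F \<noteq> bot" using closure_filter[OF assms] .
  show "\<forall>\<^sub>F x in ?F. x \<in> S" by (simp add: eventually_inf_principal)
  have id: "((\<lambda>x. x) \<longlongrightarrow> (g, l)) ?F" by (rule filterlim_mono[OF filterlim_ident]) auto
  show "((\<lambda>x. fst x a i) \<longlongrightarrow> g a i) ?F" for a i
    using tendsto_fst[OF id] by (simp add: tendsto_fun_iff)
  show "((\<lambda>x. snd x H i) \<longlongrightarrow> l H i) ?F" for H i
    using tendsto_snd[OF id] by (simp add: tendsto_fun_iff)
qed

lemma function_algebra_tendsto: "function_algebra {f. (f \<longlongrightarrow> f x0) F}"
  by (auto simp: function_algebra_def intro: tendsto_intros)

lemma polyfun_tendsto:
  assumes "polyfun f"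
  shows "(f \<longlongrightarrow> f 0) (at 0)"
  using assms poly_isCont isCont_def by blast

lemma eventually_cofinite_at:
  assumes "\<forall>\<^sub>F s in cofinite. P s"
  shows "\<forall>\<^sub>F s in at (0::complex). P s"
proof -
  have "finite ({s. \<not> P s} - {0})" using assms by (simp add: eventually_cofinite)
  then have "open (- ({s. \<not> P s} - {0}))" by (intro open_Compl finite_imp_closed)
  then show ?thesis unfolding eventually_at_topological
    by (intro exI[of _ "- ({s. \<not> P s} - {0})"]) auto
qed

lemma closure_framed_curve:
  fixes T :: "'a framed_family set"
  assumes "\<And>a i. polyfun (\<lambda>s. fst (h s) a i)" "\<And>H i. polyfun (\<lambda>s. snd (h s) H i)"
    "\<forall>\<^sub>F s in cofinite. h s \<in> closure T"
  shows "h 0 \<in> closure T"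
proof -
  have "(h \<longlongrightarrow> (fst (h 0), snd (h 0))) (at 0)"
    by (rule tendsto_framed) (intro polyfun_tendsto assms)+
  then have "h 0 \<in> closure (closure T)"
    using eventually_cofinite_at[OF assms(3)] by (intro closureI_limit[of "at 0" h]) simp_all
  then show ?thesis by simp
qed

section \<open>Linear independence of two functionals as an open condition\<close>

definition nonparallel :: "nat \<Rightarrow> (nat \<Rightarrow> complex) \<Rightarrow> (nat \<Rightarrow> complex) \<Rightarrow> bool" where
  "nonparallel r x y \<longleftrightarrow> (\<exists>i\<in>{1..r}. \<exists>j\<in>{1..r}. x i * y j \<noteq> x j * y i)"

lemma nonparallel_sym: "nonparallel r x y \<Longrightarrow> nonparallel r y x"
  unfolding nonparallel_def by (metis mult.commute)

lemma nonparallel_nonzero: "nonparallel r x y \<Longrightarrow> nonzero r x"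
  unfolding nonparallel_def by (metis mult_zero_left)

lemma nonparallelI:
  assumes "nonzero r x" "dot r x v = 0" "dot r y v \<noteq> 0"
  shows "nonparallel r x y"
proof (rule ccontr)
  assume "\<not> ?thesis"
  then have par: "\<And>i j. i \<in> {1..r} \<Longrightarrow> j \<in> {1..r} \<Longrightarrow> x i * y j = x j * y i" by (auto simp: nonparallel_def)
  have "x i = 0" if i: "i \<in> {1..r}" for i
  proof -
    have "x i * dot r y v = (\<Sum>j\<in>{1..r}. x i * y j * v j)" by (simp add: dot_def sum_distrib_left mult.assoc)
    also have "\<dots> = (\<Sum>j\<in>{1..r}. x j * y i * v j)" using par[OF i] by (intro sum.cong) auto
    also have "\<dots> = y i * dot r x v" by (simp add: dot_def sum_distrib_left algebra_simps)
    finally show ?thesis using assms by simp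
  qed
  then show False using assms(1) by blast
qed

lemma parallel_trans:
  assumes "nonzero r x" "\<not> nonparallel r x y" "\<not> nonparallel r x z"
  shows "\<not> nonparallel r y z"
proof -
  obtain k where k: "k \<in> {1..r}" "x k \<noteq> 0" using assms(1) by blast
  define c d where "c = y k / x k" and "d = z k / x k"
  have y: "y i = c * x i" and z: "z i = d * x i" if "i \<in> {1..r}" for i
    using assms(2,3) k that by (auto simp: nonparallel_def field_simps c_def d_def)
  have "y i * z j = y j * z i" if "i \<in> {1..r}" "j \<in> {1..r}" for i j
    unfolding y[OF that(1)] y[OF that(2)] z[OF that(1)] z[OF that(2)] by (simp add: mult_ac)
  then show ?thesis by (auto simp: nonparallel_def)
qed

text \<open>Sizes 0, 1 and 2 at once, as needed for the functionals of the at most two hyperplanes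
  through a point; for two vectors a nonzero minor eliminates one coefficient.\<close>

lemma independent_of_nonparallel:
  assumes "finite A" "card A \<le> 2" "\<And>a. a \<in> A \<Longrightarrow> nonzero r (l a)"
    "\<And>a b. a \<in> A \<Longrightarrow> b \<in> A \<Longrightarrow> a \<noteq> b \<Longrightarrow> nonparallel r (l a) (l b)"
  shows "\<not> lindep r l A"
proof
  assume "lindep r l A"
  then obtain c a where c: "a \<in> A" "c a \<noteq> 0" "\<forall>i\<in>{1..r}. (\<Sum>b\<in>A. c b * l b i) = 0"
    unfolding lindep_iff by blast
  show False
  proof (cases "A = {a}")
    case True
    then show ?thesis using c assms(3)[OF c(1)] by auto
  next
    case False
    then obtain b where b: "b \<in> A" "b \<noteq> a" using c(1) by blast
    have "{a, b} = A" using assms(1,2) b c(1) by (intro card_seteq) auto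
    then have A: "A = {a, b}" by simp
    obtain i j where ij: "i \<in> {1..r}" "j \<in> {1..r}" "l a i * l b j \<noteq> l a j * l b i"
      using assms(4)[OF c(1) b(1)] b(2) by (auto simp: nonparallel_def)
    have "c a * l a i + c b * l b i = 0" "c a * l a j + c b * l b j = 0"
      using c(3) ij b(2) unfolding A by auto
    then have "(c a * l a i + c b * l b i) * l b j - (c a * l a j + c b * l b j) * l b i = 0" by simp
    then have "c a * (l a i * l b j - l a j * l b i) = 0" by (simp add: algebra_simps)
    then show False using c(2) ij(3) by simp
  qed
qed

lemma nonparallel_dual:
  assumes "nonparallel r x y"
  shows "\<exists>e. dot r x e = 1 \<and> dot r y e = 0"
proof -
  have "\<not> lindep r (\<lambda>b. if b then x else y) (UNIV :: bool set)"
    using assms nonparallel_sym[OF assms] nonparallel_nonzero[of r x y] nonparallel_nonzero[of r y x]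
    by (intro independent_of_nonparallel) auto
  then obtain e where "kills r e (\<lambda>b. if b then x else y) (UNIV - {True})" "dot r e x = 1"
    using dual_vector[of "UNIV :: bool set" r "\<lambda>b. if b then x else y" True] by auto
  then show ?thesis by (intro exI[of _ e]) (auto simp: kills_def dot_commute)
qed

lemma eventually_nonparallel:
  assumes "nonparallel r x y" "\<And>i. ((\<lambda>s. f s i) \<longlongrightarrow> x i) F" "\<And>i. ((\<lambda>s. g s i) \<longlongrightarrow> y i) F"
  shows "\<forall>\<^sub>F s in F. nonparallel r (f s) (g s)"
proof -
  obtain i j where ij: "i \<in> {1..r}" "j \<in> {1..r}" "x i * y j - x j * y i \<noteq> 0"
    using assms(1) by (auto simp: nonparallel_def)
  have "((\<lambda>s. f s i * g s j - f s j * g s i) \<longlongrightarrow> x i * y j - x j * y i) F"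
    by (intro tendsto_intros assms)
  then have "\<forall>\<^sub>F s in F. f s i * g s j - f s j * g s i \<noteq> 0" using ij(3) by (rule tendsto_imp_eventually_ne)
  then show ?thesis
  proof (rule eventually_mono)
    fix s assume "f s i * g s j - f s j * g s i \<noteq> 0"
    then show "nonparallel r (f s) (g s)"
      unfolding nonparallel_def using ij(1,2) by (intro bexI[of _ i] bexI[of _ j]) auto
  qed
qed

text \<open>A nonzero \<open>x\<close> cannot be parallel to both \<open>y\<close> and
  \<open>z\<close>, so some minor is a nonzero polynomial in \<open>s\<close>.\<close>

lemma nonparallel_cofinite:
  assumes "nonzero r x" "nonparallel r y z"
  shows "\<forall>\<^sub>F s in cofinite. nonparallel r x (\<lambda>i. y i + s * z i)"
proof -
  have poly: "polyfun (\<lambda>s. x i * (y j + s * z j) - x j * (y i + s * z i))" for i j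
    by (intro polyfun_diff polyfun_add polyfun_mult polyfun_const polyfun_id)
  have "\<exists>i\<in>{1..r}. \<exists>j\<in>{1..r}. \<exists>s. x i * (y j + s * z j) - x j * (y i + s * z i) \<noteq> 0"
  proof (cases "nonparallel r x y")
    case True
    then obtain i j where "i \<in> {1..r}" "j \<in> {1..r}" "x i * y j \<noteq> x j * y i" by (auto simp: nonparallel_def)
    then show ?thesis by (intro bexI[of _ i] bexI[of _ j] exI[of _ 0]) auto
  next
    case False
    then have "nonparallel r x z" using parallel_trans[OF assms(1)] assms(2) by blast
    then obtain i j where "i \<in> {1..r}" "j \<in> {1..r}" "x i * z j \<noteq> x j * z i" by (auto simp: nonparallel_def)
    then show ?thesis using False
      by (intro bexI[of _ i] bexI[of _ j] exI[of _ 1]) (auto simp: nonparallel_def algebra_simps)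
  qed
  then obtain i j s where ij: "i \<in> {1..r}" "j \<in> {1..r}" "x i * (y j + s * z j) - x j * (y i + s * z i) \<noteq> 0" by blast
  show ?thesis using polyfun_cofinite[OF poly ij(3)]
  proof (rule eventually_mono)
    fix s assume "x i * (y j + s * z j) - x j * (y i + s * z i) \<noteq> 0"
    then show "nonparallel r x (\<lambda>i. y i + s * z i)"
      unfolding nonparallel_def using ij(1,2) by (intro bexI[of _ i] bexI[of _ j]) auto
  qed
qed

text \<open>Nonparallel functionals make the conditions at a point on two hyperplanes independent,
  so its vector can follow a deformation of them. Functionals of sets outside \<open>\<H>\<close>
  are unconstrained.\<close>

definition framed :: "nat \<Rightarrow> 'a set set \<Rightarrow> 'a framed_family set" where
  "framed r \<H> = {(g, l). (\<forall>H\<in>\<H>. nonzero r (l H) \<and> kills r (l H) g H) \<and>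
     (\<forall>H\<in>\<H>. \<forall>H'\<in>\<H>. H \<noteq> H' \<longrightarrow> nonparallel r (l H) (l H'))}"

lemma framedD:
  assumes "x \<in> framed r \<H>"
  shows "H \<in> \<H> \<Longrightarrow> nonzero r (snd x H)" "H \<in> \<H> \<Longrightarrow> kills r (snd x H) (fst x) H"
    "H \<in> \<H> \<Longrightarrow> H' \<in> \<H> \<Longrightarrow> H \<noteq> H' \<Longrightarrow> nonparallel r (snd x H) (snd x H')"
proof -
  obtain g l where x: "x = (g, l)" by force
  show "H \<in> \<H> \<Longrightarrow> nonzero r (snd x H)" "H \<in> \<H> \<Longrightarrow> kills r (snd x H) (fst x) H"
    "H \<in> \<H> \<Longrightarrow> H' \<in> \<H> \<Longrightarrow> H \<noteq> H' \<Longrightarrow> nonparallel r (snd x H) (snd x H')"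
    using assms unfolding x framed_def by simp_all
qed

lemma framedI:
  assumes "\<And>H. H \<in> \<H> \<Longrightarrow> nonzero r (l H)" "\<And>H. H \<in> \<H> \<Longrightarrow> kills r (l H) g H"
    "\<And>H H'. H \<in> \<H> \<Longrightarrow> H' \<in> \<H> \<Longrightarrow> H \<noteq> H' \<Longrightarrow> nonparallel r (l H) (l H')"
  shows "(g, l) \<in> framed r \<H>"
  unfolding framed_def using assms by simp

lemma framed_insertI:
  assumes x: "(g, l) \<in> framed r \<H>" and L: "L \<notin> \<H>" and m: "nonzero r m" "kills r m g' L"
    and k: "\<And>H. H \<in> \<H> \<Longrightarrow> kills r (l H) g' H" and np: "\<And>H. H \<in> \<H> \<Longrightarrow> nonparallel r (l H) m"
  shows "(g', l(L := m)) \<in> framed r (insert L \<H>)"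
proof (rule framedI)
  fix H assume H: "H \<in> insert L \<H>"
  show "nonzero r ((l(L := m)) H)" using H m framedD(1)[OF x] by (cases "H = L") simp_all
  show "kills r ((l(L := m)) H) g' H" using H m k by (cases "H = L") simp_all
  fix H' assume H': "H' \<in> insert L \<H>" "H \<noteq> H'"
  show "nonparallel r ((l(L := m)) H) ((l(L := m)) H')"
    using H H' framedD(3)[OF x, of H H'] np[of H] nonparallel_sym[OF np, of H']
    by (cases "H = L"; cases "H' = L") simp_all
qed

lemma framed_closure_change:
  assumes "(g, l) \<in> closure (framed r \<H>)" "\<And>a. a \<in> \<Union>\<H> \<Longrightarrow> g' a = g a"
  shows "(g', l) \<in> closure (framed r \<H>)"
proof -
  obtain F where F: "F \<noteq> bot" "\<forall>\<^sub>F x in F. x \<in> framed r \<H>" "\<And>a i. ((\<lambda>x. fst x a i) \<longlongrightarrow> g a i) F"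
    "\<And>H i. ((\<lambda>x. snd x H i) \<longlongrightarrow> l H i) F" using closure_framed_filter[OF assms(1)] by blast
  let ?f = "\<lambda>x. (\<lambda>a. if a \<in> \<Union>\<H> then fst x a else g' a, snd x)"
  show ?thesis
  proof (rule closureI_limit[OF F(1)])
    show "\<forall>\<^sub>F x in F. ?f x \<in> framed r \<H>" using F(2)
    proof (rule eventually_mono)
      fix x assume x: "x \<in> framed r \<H>"
      show "?f x \<in> framed r \<H>"
        by (rule framedI) (use framedD[OF x] in \<open>auto simp: kills_def\<close>)
    qed
    show "(?f \<longlongrightarrow> (g', l)) F"
    proof (rule tendsto_framed)
      show "((\<lambda>x. fst (?f x) a i) \<longlongrightarrow> g' a i) F" for a i
        using F(3)[of a i] assms(2)[of a] by (cases "a \<in> \<Union>\<H>") simp_all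
    qed (use F(4) in simp)
  qed
qed

text \<open>The functional of \<open>L\<close> stays equal to \<open>m\<close> along the
  approximation. A point of \<open>L\<close> lies on at most one older hyperplane, so its vector
  obeys at most two conditions, independent at the limit, and continues with them.\<close>

lemma framed_add_transversal:
  assumes gl: "(g, l) \<in> closure (framed r \<H>)" and L: "L \<notin> \<H>" "finite \<H>"
    and m: "nonzero r m" "kills r m g L" and np: "\<And>H. H \<in> \<H> \<Longrightarrow> nonparallel r (l H) m"
    and nz: "\<And>H. H \<in> \<H> \<Longrightarrow> nonzero r (l H)" and lg: "\<And>H. H \<in> \<H> \<Longrightarrow> kills r (l H) g H"
    and deg: "\<And>a H H'. a \<in> L \<Longrightarrow> H \<in> \<H> \<Longrightarrow> H' \<in> \<H> \<Longrightarrow> a \<in> H \<Longrightarrow> a \<in> H' \<Longrightarrow> H = H'"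
  shows "(g, l(L := m)) \<in> closure (framed r (insert L \<H>))"
proof -
  obtain F where F: "F \<noteq> bot" "\<forall>\<^sub>F x in F. x \<in> framed r \<H>" "\<And>a i. ((\<lambda>x. fst x a i) \<longlongrightarrow> g a i) F"
    "\<And>H i. ((\<lambda>x. snd x H i) \<longlongrightarrow> l H i) F" using closure_framed_filter[OF gl] by blast
  let ?R = "{f. (f \<longlongrightarrow> f (g, l)) F}"
  define v where "v = (\<lambda>(x :: 'a framed_family) H. if H = L then m else snd x H)"
  define Q where "Q = (\<lambda>a w. (\<forall>i. (\<lambda>x. w x i) \<in> ?R) \<and> w (g, l) = g a \<and>
    (\<forall>x. kills r (w x) (v x) (insert L {H \<in> \<H>. a \<in> H})))"
  have "\<exists>w. Q a w" if a: "a \<in> L" for a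
    unfolding Q_def
  proof (rule orthogonal_continuation[OF function_algebra_tendsto])
    show "(\<lambda>x. v x H i) \<in> ?R" for H i using F(4) by (simp add: v_def)
    show "kills r (g a) (v (g, l)) (insert L {H \<in> \<H>. a \<in> H})"
      using m(2) lg a by (auto simp: kills_def v_def dot_commute)
    have "card {H \<in> \<H>. a \<in> H} \<le> 1" using deg[OF a] L(2) by (auto simp: card_le_Suc0_iff_eq)
    then have "card (insert L {H \<in> \<H>. a \<in> H}) \<le> 2" using card_insert_le_m1[of 2 "{H \<in> \<H>. a \<in> H}" L] by simp
    then show "\<not> lindep r (v (g, l)) (insert L {H \<in> \<H>. a \<in> H})"
    proof (rule independent_of_nonparallel[rotated])
      fix H H' assume "H \<in> insert L {H \<in> \<H>. a \<in> H}" "H' \<in> insert L {H \<in> \<H>. a \<in> H}" "H \<noteq> H'"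
      then show "nonparallel r (v (g, l) H) (v (g, l) H')"
        using np deg[OF a] nonparallel_sym[OF np] L(1) by (auto simp: v_def)
    qed (use L m(1) nz in \<open>auto simp: v_def\<close>)
  qed (use L(2) in auto)
  then obtain w where w': "\<And>a. a \<in> L \<Longrightarrow> Q a (w a)" by metis
  have w: "((\<lambda>x. w a x i) \<longlongrightarrow> w a (g, l) i) F" "w a (g, l) = g a"
      "kills r (w a x) (v x) (insert L {H \<in> \<H>. a \<in> H})" if "a \<in> L" for a i x
    using w'[OF that] unfolding Q_def by blast+
  let ?f = "\<lambda>x. (\<lambda>a. if a \<in> L then w a x else fst x a, (snd x)(L := m))"
  have "\<forall>\<^sub>F x in F. \<forall>H\<in>\<H>. nonparallel r (snd x H) m"
    using L(2) np F(4) by (intro eventually_ball_finite ballI eventually_nonparallel) auto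
  with F(2) have ev: "\<forall>\<^sub>F x in F. ?f x \<in> framed r (insert L \<H>)"
  proof eventually_elim
    case (elim x)
    obtain g' l' where x: "x = (g', l')" by force
    note fr = elim(1)[unfolded x]
    have w0: "dot r (w a x) m = 0" if "a \<in> L" for a
      using w(3)[OF that, of x] by (simp add: kills_def v_def)
    have w1: "dot r (w a x) (l' H) = 0" if "a \<in> L" "H \<in> \<H>" "a \<in> H" for a H
    proof -
      have "H \<noteq> L" using that(2) L(1) by blast
      moreover have "dot r (w a x) (v x H) = 0" using w(3)[OF that(1), of x] that(2,3) unfolding kills_def by blast
      ultimately show ?thesis by (simp add: v_def x)
    qed
    have "kills r (l' H) (\<lambda>a. if a \<in> L then w a x else fst x a) H" if "H \<in> \<H>" for H
      using framedD(2)[OF fr that] w1[OF _ that] by (simp add: kills_def x dot_commute)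
    moreover have "kills r m (\<lambda>a. if a \<in> L then w a x else fst x a) L"
      using w0 by (simp add: kills_def dot_commute)
    ultimately have "(\<lambda>a. if a \<in> L then w a x else fst x a, l'(L := m)) \<in> framed r (insert L \<H>)"
      using elim(2) m(1) L(1) by (intro framed_insertI[OF fr]) (simp_all add: x)
    then show ?case by (simp add: x)
  qed
  have lim: "(?f \<longlongrightarrow> (g, l(L := m))) F"
  proof (rule tendsto_framed)
    show "((\<lambda>x. fst (?f x) a i) \<longlongrightarrow> g a i) F" for a i
      using w(1)[of a i] w(2)[of a] F(3)[of a i] by (cases "a \<in> L") simp_all
    show "((\<lambda>x. snd (?f x) H i) \<longlongrightarrow> (l(L := m)) H i) F" for H i
      using F(4)[of H i] by (cases "H = L") simp_all
  qed
  show ?thesis by (rule closureI_limit[OF F(1) ev lim])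
qed

text \<open>
  The functionals \<open>m + s \<mu>\<close> are transversal to the old ones for almost all \<open>s\<close>; only the points
  lying on \<open>L\<close> alone have to follow.
\<close>

lemma framed_add_pencil:
  assumes gl: "(g, l) \<in> closure (framed r \<H>)" and L: "L \<notin> \<H>" "finite \<H>"
    and m: "kills r m g L" and \<mu>: "nonparallel r m \<mu>" "kills r \<mu> g (L \<inter> \<Union>\<H>)"
    and nz: "\<And>H. H \<in> \<H> \<Longrightarrow> nonzero r (l H)" and lg: "\<And>H. H \<in> \<H> \<Longrightarrow> kills r (l H) g H"
    and deg: "\<And>a H H'. a \<in> L \<Longrightarrow> H \<in> \<H> \<Longrightarrow> H' \<in> \<H> \<Longrightarrow> a \<in> H \<Longrightarrow> a \<in> H' \<Longrightarrow> H = H'"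
  shows "(g, l(L := m)) \<in> closure (framed r (insert L \<H>))"
proof -
  obtain e where e: "dot r m e = 1" "dot r \<mu> e = 0" using nonparallel_dual[OF \<mu>(1)] by blast
  \<comment> \<open>With \<open>dot r m e = 1\<close> and \<open>dot r \<mu> e = 0\<close> this
    correction cancels the value \<open>s * dot r \<mu> (g a)\<close> that \<open>ms s\<close> would
    take. Points shared with older hyperplanes are killed by \<open>m\<close> and
    \<open>\<mu>\<close> and need not move.\<close>
  define gs where "gs = (\<lambda>s a i. if a \<in> L - \<Union>\<H> then g a i - s * (dot r \<mu> (g a) * e i) else g a i)"
  define ms where "ms = (\<lambda>s i. m i + s * \<mu> i)"
  let ?h = "\<lambda>s. (gs s, l(L := ms s))"
  have dots: "dot r x (gs s a) = (if a \<in> L - \<Union>\<H> then dot r x (g a) - s * dot r \<mu> (g a) * dot r x e else dot r x (g a))" for x s a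
  proof (cases "a \<in> L - \<Union>\<H>")
    case True
    show ?thesis unfolding gs_def if_P[OF True] by (simp add: dot_linear mult.assoc)
  next
    case False
    show ?thesis unfolding gs_def if_not_P[OF False] ..
  qed
  have "\<forall>\<^sub>F s in cofinite. \<forall>H\<in>\<H>. nonparallel r (l H) (ms s)"
    unfolding ms_def using L(2) nz \<mu>(1) by (intro eventually_ball_finite ballI nonparallel_cofinite) auto
  then have "\<forall>\<^sub>F s in cofinite. ?h s \<in> closure (framed r (insert L \<H>))"
  proof eventually_elim
    case (elim s)
    show ?case
    proof (rule framed_add_transversal)
      show "(gs s, l) \<in> closure (framed r \<H>)"
      proof (rule framed_closure_change[OF gl])
        fix a assume "a \<in> \<Union>\<H>"
        then have "a \<notin> L - \<Union>\<H>" by blast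
        then show "gs s a = g a" unfolding gs_def by (intro ext) (rule if_not_P)
      qed
      have "dot r (ms s) e = 1" using e by (simp add: ms_def dot_linear)
      then show "nonzero r (ms s)" by (auto simp: dot_def intro: ccontr)
      have "dot r (ms s) (gs s a) = 0" if "a \<in> L" for a
        using that m \<mu>(2) e unfolding dots by (auto simp: ms_def dot_linear kills_def)
      then show "kills r (ms s) (gs s) L" by (simp add: kills_def)
      show "kills r (l H) (gs s) H" if "H \<in> \<H>" for H
        using lg[OF that] that unfolding kills_def dots by auto
    qed (use elim L nz deg in auto)
  qed
  then have "?h 0 \<in> closure (framed r (insert L \<H>))"
  proof (rule closure_framed_curve[rotated 2])
    show "polyfun (\<lambda>s. fst (?h s) a i)" for a i
    proof (cases "a \<in> L - \<Union>\<H>")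
      case True
      show ?thesis unfolding fst_conv gs_def if_P[OF True]
        by (intro polyfun_diff polyfun_mult polyfun_const polyfun_id)
    next
      case False
      show ?thesis unfolding fst_conv gs_def if_not_P[OF False] by (rule polyfun_const)
    qed
    show "polyfun (\<lambda>s. snd (?h s) H i)" for H i
    proof (cases "H = L")
      case True
      have "polyfun (\<lambda>s. m i + s * \<mu> i)" by (intro polyfun_add polyfun_mult polyfun_const polyfun_id)
      then show ?thesis unfolding True ms_def by simp
    next
      case False
      then show ?thesis using polyfun_const[of "l H i"] by simp
    qed
  qed
  moreover have "?h 0 = (g, l(L := m))" by (simp add: gs_def ms_def fun_eq_iff)
  ultimately show ?thesis by simp
qed

text \<open>A point on exactly one hyperplane \<open>K\<close> can be moved inside it along a
  direction not killed by the functional of \<open>H\<close>, since the two functionals are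
  nonparallel. The pairs are treated one after another; almost all shifts keep the inequalities
  already obtained.\<close>

lemma framed_generic_points:
  assumes "finite P" and P: "\<And>a H. (a, H) \<in> P \<Longrightarrow> H \<in> \<H> \<and> a \<notin> H \<and> a \<in> \<Union>\<H> \<and> (\<forall>H1\<in>\<H>. \<forall>H2\<in>\<H>. a \<in> H1 \<longrightarrow> a \<in> H2 \<longrightarrow> H1 = H2)"
  shows "framed r \<H> \<subseteq> closure {(g, l) \<in> framed r \<H>. \<forall>(a, H)\<in>P. dot r (l H) (g a) \<noteq> 0}"
  using assms
proof (induction P rule: finite_induct)
  case empty
  show ?case using closure_subset[of "framed r \<H>"] by simp
next
  case (insert q P)
  obtain a H where q: "q = (a, H)" by force
  let ?W = "\<lambda>P. {(g, l) \<in> framed r \<H>. \<forall>(a, H)\<in>P. dot r (l H) (g a) \<noteq> 0}"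
  have "?W P \<subseteq> closure (?W (insert q P))"
  proof
    fix x assume "x \<in> ?W P"
    then obtain g l where x: "x = (g, l)" and fr: "(g, l) \<in> framed r \<H>"
      and good': "\<forall>(a, H)\<in>P. dot r (l H) (g a) \<noteq> 0" by blast
    have good: "dot r (l H) (g a) \<noteq> 0" if "(a, H) \<in> P" for a H using good' that by blast
    have aH: "H \<in> \<H>" "a \<notin> H" and uniq: "\<And>H1 H2. H1 \<in> \<H> \<Longrightarrow> H2 \<in> \<H> \<Longrightarrow> a \<in> H1 \<Longrightarrow> a \<in> H2 \<Longrightarrow> H1 = H2"
      using insert.prems[of a H] q by auto
    obtain K where K: "K \<in> \<H>" "a \<in> K" using insert.prems[of a H] q by auto
    have "nonparallel r (l H) (l K)" using fr aH K by (auto simp: framed_def)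
    then obtain w where w: "dot r (l H) w = 1" "dot r (l K) w = 0" using nonparallel_dual by blast
    define gs where "gs = (\<lambda>s. g(a := (\<lambda>i. g a i + s * w i)))"
    have dots: "dot r y (gs s b) = (if b = a then dot r y (g a) + s * dot r y w else dot r y (g b))" for y s b
      by (simp add: gs_def dot_linear)
    have fr': "(gs s, l) \<in> framed r \<H>" for s
    proof -
      have "kills r (l H') (gs s) H'" if H': "H' \<in> \<H>" for H'
        unfolding kills_def dots
      proof
        fix b assume "b \<in> H'"
        moreover have "dot r (l H') (g b) = 0" if "b \<in> H'" for b
          using fr H' that by (auto simp: framed_def kills_def)
        ultimately show "(if b = a then dot r (l H') (g a) + s * dot r (l H') w else dot r (l H') (g b)) = 0"
          using uniq[OF H' K(1) _ K(2)] w by auto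
      qed
      then show ?thesis using fr by (auto simp: framed_def)
    qed
    have "\<forall>\<^sub>F s in cofinite. dot r (l H') (gs s b) \<noteq> 0" if "(b, H') \<in> insert q P" for b H'
    proof -
      have "\<exists>s. dot r (l H') (gs s b) \<noteq> 0"
      proof (cases "(b, H') \<in> P")
        case True
        then show ?thesis using good[OF True] by (intro exI[of _ 0]) (cases "b = a", simp_all add: dots)
      next
        case False
        then have "b = a" "H' = H" using that q by auto
        then show ?thesis unfolding dots using w
          by (cases "dot r (l H) (g a) = 0") (auto intro: exI[of _ 1] exI[of _ 0])
      qed
      then obtain s where s: "dot r (l H') (gs s b) \<noteq> 0" by blast
      have "polyfun (\<lambda>s. dot r (l H') (gs s b))"
      proof (cases "b = a")
        case True
        show ?thesis unfolding dots if_P[OF True]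
          by (intro polyfun_add polyfun_mult polyfun_const polyfun_id)
      next
        case False
        show ?thesis unfolding dots if_not_P[OF False] by (rule polyfun_const)
      qed
      from polyfun_cofinite[OF this s] show ?thesis .
    qed
    then have "\<forall>\<^sub>F s in cofinite. case p of (b, H') \<Rightarrow> dot r (l H') (gs s b) \<noteq> 0" if "p \<in> insert q P" for p
      using that by (cases p) simp
    then have "\<forall>\<^sub>F s in cofinite. \<forall>(b, H')\<in>insert q P. dot r (l H') (gs s b) \<noteq> 0"
      using insert.hyps(1) by (intro eventually_ball_finite) auto
    then have ev: "\<forall>\<^sub>F s in cofinite. (gs s, l) \<in> closure (?W (insert q P))"
    proof (rule eventually_mono)
      fix s assume "\<forall>(b, H')\<in>insert q P. dot r (l H') (gs s b) \<noteq> 0"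
      then have "(gs s, l) \<in> ?W (insert q P)" using fr' by simp
      then show "(gs s, l) \<in> closure (?W (insert q P))" by (rule subsetD[OF closure_subset])
    qed
    have "(gs 0, l) \<in> closure (?W (insert q P))"
    proof (rule closure_framed_curve[OF _ _ ev])
      show "polyfun (\<lambda>s. fst (gs s, l) b i)" for b i
      proof (cases "b = a")
        case True
        have "polyfun (\<lambda>s. g a i + s * w i)" by (intro polyfun_add polyfun_mult polyfun_const polyfun_id)
        then show ?thesis using True by (simp add: gs_def)
      next
        case False
        then show ?thesis using polyfun_const[of "g b i"] by (simp add: gs_def)
      qed
      show "polyfun (\<lambda>s. snd (gs s, l) H' i)" for H' i using polyfun_const[of "l H' i"] by simp
    qed
    moreover have "gs 0 = g" by (simp add: gs_def fun_eq_iff)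
    ultimately show "x \<in> closure (?W (insert q P))" using x by simp
  qed
  then have "closure (?W P) \<subseteq> closure (?W (insert q P))" by (intro closure_minimal closed_closure)
  then show ?case using insert.IH insert.prems by blast
qed

text \<open>Here the vectors of \<open>L \<inter> \<Union>\<H>\<close> determine \<open>m\<close> up
  to a factor, so the functional of \<open>L\<close> has to follow them. After a generic
  perturbation these vectors avoid all older hyperplanes not containing their points, and by
  \<open>small\<close> each older hyperplane misses one of these points; hence the new functional is
  nonparallel to the old ones.\<close>

lemma framed_add_spanned:
  assumes gl: "(g, l) \<in> closure (framed r \<H>)" and L: "L \<notin> \<H>" "finite \<H>" "finite L"
    and m: "nonzero r m" "kills r m g L"
    and S: "\<not> lindep r g (L \<inter> \<Union>\<H>)" "card (L \<inter> \<Union>\<H>) + 1 = r"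
    and small: "\<And>H. H \<in> \<H> \<Longrightarrow> card (L \<inter> H) + 2 \<le> r"
    and deg: "\<And>a H H'. a \<in> L \<Longrightarrow> H \<in> \<H> \<Longrightarrow> H' \<in> \<H> \<Longrightarrow> a \<in> H \<Longrightarrow> a \<in> H' \<Longrightarrow> H = H'"
  shows "(g, l(L := m)) \<in> closure (framed r (insert L \<H>))"
proof -
  define S where "S = L \<inter> \<Union>\<H>"
  have S': "finite S" "card S + 1 = r" "\<not> lindep r g S" using L(3) S by (auto simp: S_def)
  define P where "P = {(a, H). a \<in> S \<and> H \<in> \<H> \<and> a \<notin> H}"
  have "finite P" by (rule finite_subset[of _ "S \<times> \<H>"]) (use S'(1) L(2) in \<open>auto simp: P_def\<close>)
  then have "framed r \<H> \<subseteq> closure {(g, l) \<in> framed r \<H>. \<forall>(a, H)\<in>P. dot r (l H) (g a) \<noteq> 0}"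
    using deg by (intro framed_generic_points) (auto simp: P_def S_def)
  then have "closure (framed r \<H>) \<subseteq> closure {(g, l) \<in> framed r \<H>. \<forall>(a, H)\<in>P. dot r (l H) (g a) \<noteq> 0}"
    by (intro closure_minimal closed_closure)
  then have "(g, l) \<in> closure {(g, l) \<in> framed r \<H>. \<forall>(a, H)\<in>P. dot r (l H) (g a) \<noteq> 0}" using gl by blast
  then obtain F where F: "F \<noteq> bot"
    "\<forall>\<^sub>F x in F. x \<in> {(g, l) \<in> framed r \<H>. \<forall>(a, H)\<in>P. dot r (l H) (g a) \<noteq> 0}"
    "\<And>a i. ((\<lambda>x. fst x a i) \<longlongrightarrow> g a i) F"
    "\<And>H i. ((\<lambda>x. snd x H i) \<longlongrightarrow> l H i) F" by (rule closure_framed_filter) blast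
  let ?R = "{f. (f \<longlongrightarrow> f (g, l)) F}"
  have "\<exists>w. (\<forall>i. (\<lambda>x. w x i) \<in> ?R) \<and> w (g, l) = m \<and> (\<forall>x. kills r (w x) (fst x) S)"
    by (rule orthogonal_continuation[OF function_algebra_tendsto])
      (use F(3) S' m(2) in \<open>auto simp: kills_def S_def\<close>)
  then obtain ms where ms': "\<forall>i. (\<lambda>x. ms x i) \<in> ?R" and ms0: "ms (g, l) = m"
    and msk: "\<And>x. kills r (ms x) (fst x) S" by blast
  have ms: "((\<lambda>x. ms x i) \<longlongrightarrow> m i) F" for i using ms' ms0 by simp
  define Q where "Q = (\<lambda>a w. (\<forall>i. (\<lambda>x. w x i) \<in> ?R) \<and> w (g, l) = g a \<and> (\<forall>x. kills r (w x) (\<lambda>_. ms x) {()}))"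
  have "\<exists>w. Q a w" if "a \<in> L" for a
    unfolding Q_def by (rule orthogonal_continuation[OF function_algebra_tendsto])
      (use ms ms0 m that in \<open>auto simp: kills_def lindep_singleton dot_commute\<close>)
  then obtain w where w': "\<And>a. a \<in> L \<Longrightarrow> Q a (w a)" by metis
  have w: "((\<lambda>x. w a x i) \<longlongrightarrow> w a (g, l) i) F" "w a (g, l) = g a" "dot r (ms x) (w a x) = 0"
    if "a \<in> L" for a i x
  proof -
    show "((\<lambda>x. w a x i) \<longlongrightarrow> w a (g, l) i) F" "w a (g, l) = g a" using w'[OF that] unfolding Q_def by blast+
    have "kills r (w a x) (\<lambda>_. ms x) {()}" using w'[OF that] unfolding Q_def by blast
    then show "dot r (ms x) (w a x) = 0" by (simp add: kills_def dot_commute)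
  qed
  let ?g = "\<lambda>x a. if a \<in> L - S then w a x else fst x a"
  let ?f = "\<lambda>x. (?g x, (snd x)(L := ms x))"
  have "\<forall>\<^sub>F x in F. nonzero r (ms x)"
  proof -
    obtain i where i: "i \<in> {1..r}" "m i \<noteq> 0" using m(1) by blast
    have "\<forall>\<^sub>F x in F. ms x i \<noteq> 0" using tendsto_imp_eventually_ne[OF ms i(2)] .
    then show ?thesis by (rule eventually_mono) (use i in blast)
  qed
  with F(2) have ev: "\<forall>\<^sub>F x in F. ?f x \<in> framed r (insert L \<H>)"
  proof eventually_elim
    case (elim x)
    obtain g' l' where x: "x = (g', l')" by force
    have fr: "(g', l') \<in> framed r \<H>" and gen': "\<forall>(a, H)\<in>P. dot r (l' H) (g' a) \<noteq> 0"
      using elim(1) unfolding x by blast+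
    have gen: "dot r (l' H) (g' a) \<noteq> 0" if "a \<in> S" "H \<in> \<H>" "a \<notin> H" for a H
      using gen' that unfolding P_def by blast
    have np: "nonparallel r (ms x) (l' H)" if H: "H \<in> \<H>" for H
    proof -
      have "\<not> S \<subseteq> L \<inter> H" using small[OF H] S'(2) card_mono[of "L \<inter> H" S] L(3) by auto
      then obtain a where a: "a \<in> S" "a \<notin> H" by (auto simp: S_def)
      have "dot r (ms x) (g' a) = 0" using msk[of x] a(1) by (simp add: kills_def x)
      then show ?thesis using nonparallelI[OF elim(2)] gen[OF a(1) H a(2)] by blast
    qed
    have "kills r (l' H) (?g x) H" if H: "H \<in> \<H>" for H
      unfolding kills_def
    proof
      fix a assume "a \<in> H"
      then have nL: "a \<notin> L - S" using H by (auto simp: S_def)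
      show "dot r (l' H) (?g x a) = 0"
        unfolding if_not_P[OF nL] using framedD(2)[OF fr H] \<open>a \<in> H\<close> by (simp add: kills_def x)
    qed
    moreover have "kills r (ms x) (?g x) L"
      unfolding kills_def
    proof
      fix a assume "a \<in> L"
      then show "dot r (ms x) (?g x a) = 0"
        using msk[of x] w(3)[of a x] by (cases "a \<in> S") (simp_all add: kills_def)
    qed
    ultimately have "(?g x, l'(L := ms x)) \<in> framed r (insert L \<H>)"
      using elim(2) L(1) nonparallel_sym[OF np] by (intro framed_insertI[OF fr]) simp_all
    then show ?case by (simp add: x)
  qed
  have lim: "(?f \<longlongrightarrow> (g, l(L := m))) F"
  proof (rule tendsto_framed)
    show "((\<lambda>x. fst (?f x) a i) \<longlongrightarrow> g a i) F" for a i
    proof (cases "a \<in> L - S")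
      case True
      then show ?thesis using w(1)[of a i] w(2)[of a] unfolding fst_conv if_P[OF True] by simp
    next
      case False
      show ?thesis using F(3)[of a i] unfolding fst_conv if_not_P[OF False] .
    qed
    show "((\<lambda>x. snd (?f x) H i) \<longlongrightarrow> (l(L := m)) H i) F" for H i
      using F(4)[of H i] ms[of i] by (cases "H = L") simp_all
  qed
  show ?thesis by (rule closureI_limit[OF F(1) ev lim])
qed

text \<open>If the vectors of \<open>S\<close> span at most dimension \<open>r - 2\<close>, there is
  room for a second functional; it is also required to kill a vector \<open>e\<close> with
  \<open>dot r m e = 1\<close>, which makes it nonparallel to \<open>m\<close>. Otherwise
  \<open>S\<close> itself is independent of size \<open>r - 1\<close>.\<close>

lemma second_functional_or_spanned:
  assumes "finite S" "card S < r" "nonzero r m"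
  shows "(\<exists>\<mu>. nonparallel r m \<mu> \<and> kills r \<mu> g S) \<or> \<not> lindep r g S \<and> card S + 1 = r"
proof -
  obtain B where B: "B \<subseteq> S" "\<not> lindep r g B" "\<forall>a\<in>S. lindep r g (insert a B) \<or> a \<in> B"
    using maximal_independent[OF assms(1)] by blast
  have finB: "finite B" using B(1) assms(1) finite_subset by blast
  show ?thesis
  proof (cases "card B + 1 < r")
    case True
    obtain e where e: "dot r m e = 1" using exists_dot_one[OF assms(3)] by blast
    let ?A = "insert None (Some ` B)"
    have "card ?A < r" using True finB by (simp add: card_insert_if card_image)
    then obtain \<mu> where \<mu>: "nonzero r \<mu>" "kills r \<mu> (case_option e g) ?A"
      using exists_killing[of ?A r "case_option e g"] finB by auto
    have "kills r \<mu> g B" using \<mu>(2) by (auto simp: kills_def)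
    then have "kills r \<mu> g S" using kills_of_maximal[OF finB B(2,3)] by blast
    moreover have "nonparallel r \<mu> m" using \<mu> e by (intro nonparallelI[of r \<mu> e]) (auto simp: kills_def)
    ultimately show ?thesis using nonparallel_sym by blast
  next
    case False
    then have "B = S" using card_seteq[OF assms(1) B(1)] assms(2) by auto
    then show ?thesis using False B(2) assms(2) by auto
  qed
qed

text \<open>Hyperplanes are added so that each new one is a leaf of those present. The vectors it
  shares with the older ones either leave a pencil of functionals or span a hyperplane, and the two
  extension lemmas cover these cases for an arbitrary choice of \<open>m\<close>.\<close>

theorem framed_dense:
  assumes "finite \<H>" "\<And>H. H \<in> \<H> \<Longrightarrow> finite H"
    and small: "\<And>H H'. H \<in> \<H> \<Longrightarrow> H' \<in> \<H> \<Longrightarrow> H \<noteq> H' \<Longrightarrow> card (H \<inter> H') + 2 \<le> r"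
    and deg: "\<And>H1 H2 H3. H1 \<in> \<H> \<Longrightarrow> H2 \<in> \<H> \<Longrightarrow> H3 \<in> \<H> \<Longrightarrow> H1 \<noteq> H2 \<Longrightarrow> H1 \<noteq> H3 \<Longrightarrow> H2 \<noteq> H3 \<Longrightarrow> H1 \<inter> H2 \<inter> H3 = {}"
    and leaf: "\<And>\<K>. \<K> \<subseteq> \<H> \<Longrightarrow> \<K> \<noteq> {} \<Longrightarrow> \<exists>L\<in>\<K>. card (L \<inter> \<Union>(\<K> - {L})) < r"
    and g: "\<And>H. H \<in> \<H> \<Longrightarrow> \<exists>l. nonzero r l \<and> kills r l g H"
  shows "\<exists>l. (\<forall>H\<in>\<H>. nonzero r (l H) \<and> kills r (l H) g H) \<and> (g, l) \<in> closure (framed r \<H>)"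
proof -
  have "\<K> \<subseteq> \<H> \<Longrightarrow> ?thesis \<or> (\<exists>l. (\<forall>H\<in>\<K>. nonzero r (l H) \<and> kills r (l H) g H) \<and> (g, l) \<in> closure (framed r \<K>))"
    if "finite \<K>" for \<K>
    using that
  proof (induction \<K> rule: finite_psubset_induct)
    case (psubset \<K>)
    show ?case
    proof (cases "\<K> = {}")
      case True
      have "(g, \<lambda>_ _. 0) \<in> framed r {}" by (simp add: framed_def)
      then show ?thesis using True closure_subset by blast
    next
      case False
      then obtain L where L: "L \<in> \<K>" "card (L \<inter> \<Union>(\<K> - {L})) < r" using leaf psubset.prems by blast
      define \<J> where "\<J> = \<K> - {L}"
      have \<J>: "\<J> \<subset> \<K>" "L \<notin> \<J>" "insert L \<J> = \<K>" "finite \<J>" "\<J> \<subseteq> \<H>"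
        using L psubset by (auto simp: \<J>_def)
      have LH: "L \<in> \<H>" using L psubset.prems by blast
      have dL: "H = H'" if "a \<in> L" "H \<in> \<J>" "H' \<in> \<J>" "a \<in> H" "a \<in> H'" for a H H'
        using deg[of L H H'] that \<J> LH by blast
      from psubset.IH[OF \<J>(1,5)] show ?thesis
      proof
        assume "\<exists>l. (\<forall>H\<in>\<J>. nonzero r (l H) \<and> kills r (l H) g H) \<and> (g, l) \<in> closure (framed r \<J>)"
        then obtain l where l: "\<And>H. H \<in> \<J> \<Longrightarrow> nonzero r (l H)" "\<And>H. H \<in> \<J> \<Longrightarrow> kills r (l H) g H"
            "(g, l) \<in> closure (framed r \<J>)" by blast
        obtain m where m: "nonzero r m" "kills r m g L" using g[OF LH] by blast
        have fin: "finite (L \<inter> \<Union>\<J>)" using assms(2)[OF LH] by blast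
        have "(g, l(L := m)) \<in> closure (framed r (insert L \<J>))"
        proof (cases "\<exists>\<mu>. nonparallel r m \<mu> \<and> kills r \<mu> g (L \<inter> \<Union>\<J>)")
          case True
          then obtain \<mu> where \<mu>: "nonparallel r m \<mu>" "kills r \<mu> g (L \<inter> \<Union>\<J>)" by blast
          show ?thesis by (rule framed_add_pencil[OF l(3) \<J>(2,4) m(2) \<mu> l(1,2) dL])
        next
          case False
          then have sp: "\<not> lindep r g (L \<inter> \<Union>\<J>)" "card (L \<inter> \<Union>\<J>) + 1 = r"
            using second_functional_or_spanned[OF fin _ m(1), of g] L(2) by (auto simp: \<J>_def)
          show ?thesis
          proof (rule framed_add_spanned[OF l(3) \<J>(2,4) assms(2)[OF LH] m sp _ dL])
            show "card (L \<inter> H) + 2 \<le> r" if "H \<in> \<J>" for H using small[OF LH, of H] that \<J> by blast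
          qed
        qed
        moreover have "\<forall>H\<in>\<K>. nonzero r ((l(L := m)) H) \<and> kills r ((l(L := m)) H) g H"
          using l(1,2) m \<J>(3) by auto
        ultimately show ?thesis using \<J>(3) by metis
      qed simp
    qed
  qed
  from this[OF assms(1)] show ?thesis by blast
qed

section \<open>Nilpotent paving matroids with points of degree at most two\<close>

text \<open>Two hyperplanes get nonparallel functionals because some \<open>x\<close> on
  \<open>H'\<close> completes \<open>mrank M - 1\<close> points of \<open>H\<close> to a basis: the
  functional of \<open>H\<close> cannot vanish at \<open>x\<close>, while that of \<open>H'\<close>
  does.\<close>

lemma realization_frame:
  assumes M: "paving M" and g: "realizes_matroid M g"
  shows "\<exists>l. (g, l) \<in> framed (mrank M) {H. dependent_hyperplane M H}"
proof -
  let ?r = "mrank M"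
  have dep: "lindep ?r g A" if "dependent_hyperplane M H" "A \<subseteq> H" "card A = ?r" for A H
  proof -
    have "circuit M A" using that by (simp add: dependent_hyperplane_def all_rank_subsets_circuits_def)
    then have "A \<notin> indep_sets M" "A \<subseteq> ground M" using circuit_not_indep circuit_ground by blast+
    then show ?thesis using g unfolding realizes_def by blast
  qed
  have "\<exists>l. nonzero ?r l \<and> kills ?r l g H" if "dependent_hyperplane M H" for H
    using that dep hyperplane_rank_pos[OF that] hyperplane_ground[OF that] finite_subset[OF _ finite_ground]
    by (intro exists_killing_of_dependent) auto
  then obtain l where l: "\<And>H. dependent_hyperplane M H \<Longrightarrow> nonzero ?r (l H) \<and> kills ?r (l H) g H" by metis
  have "nonparallel ?r (l H) (l H')" if H: "dependent_hyperplane M H" "dependent_hyperplane M H'" "H \<noteq> H'" for H H'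
  proof -
    have cardH: "?r \<le> card H'" "finite H'" "H' \<subseteq> ground M"
      using H(2) finite_subset[OF hyperplane_ground[OF H(2)]]
      by (auto simp: dependent_hyperplane_def all_rank_subsets_circuits_def)
    have "\<not> H' \<subseteq> H"
    proof
      assume "H' \<subseteq> H"
      then have "H \<inter> H' = H'" by blast
      then show False using hyperplane_inter_card[OF M H] cardH(1) by simp
    qed
    then obtain x where x: "x \<in> H'" "x \<notin> H" by blast
    have "?r \<le> card H" using H(1) by (simp add: dependent_hyperplane_def all_rank_subsets_circuits_def)
    then obtain B where B: "B \<subseteq> H" "card B = ?r - 1" by (metis diff_le_self le_trans obtain_subset_with_card_n)
    have r: "0 < ?r" using hyperplane_rank_pos[OF H(1)] .
    have ind: "insert x B \<in> indep_sets M"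
      using hyperplane_extra_point_indep[OF M H(1) B(1) _ _ x(2)] B(2) r x(1) cardH(3) by auto
    have xB: "x \<notin> B" using x B by blast
    then have card: "card (insert x B) = ?r" using B(2) r indep_finite[OF ind] by simp
    have "\<not> lindep ?r g (insert x B)" using g ind indep_subset_ground[OF ind] by (auto simp: realizes_def)
    then have "\<not> kills ?r (l H) g (insert x B)"
      using lindep_of_kills[of "insert x B" ?r "l H" g] l[OF H(1)] card indep_finite[OF ind] by auto
    then have "dot ?r (l H) (g x) \<noteq> 0" using l[OF H(1)] B(1) by (auto simp: kills_def)
    moreover have "dot ?r (l H') (g x) = 0" using l[OF H(2)] x(1) by (auto simp: kills_def)
    ultimately show ?thesis using nonparallelI[of ?r "l H'" "g x" "l H"] l[OF H(2)] nonparallel_sym by blast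
  qed
  then show ?thesis using l by (auto simp: framed_def)
qed

text \<open>Independence is inherited from \<open>t = 1\<close> and nonvanishing of the functionals
  from \<open>t = 0\<close>, both for almost all \<open>t\<close>; annihilation supplies the
  dependences. So the curve consists of realizations up to finitely many parameters, and its start
  lies in their closure.\<close>

lemma killed_curve_in_zclosure:
  assumes M: "paving M" and h: "\<And>a i. polyfun (\<lambda>t. h t a i)" "realizes_matroid M (h 1)"
    and v: "\<And>H i. polyfun (\<lambda>t. v t H i)" "\<And>H. dependent_hyperplane M H \<Longrightarrow> nonzero (mrank M) (v 0 H)"
      "\<And>H t. dependent_hyperplane M H \<Longrightarrow> kills (mrank M) (v t H) (h t) H"
  shows "h 0 \<in> zclosure M"
proof -
  let ?r = "mrank M" and ?\<H> = "{H. dependent_hyperplane M H}"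
  have "\<forall>\<^sub>F t in cofinite. nonzero ?r (v t H)" if "dependent_hyperplane M H" for H
    using nonzero_cofinite[of "\<lambda>t. v t H" ?r 0] v(1) v(2)[OF that] by blast
  then have "\<forall>\<^sub>F t in cofinite. \<forall>H\<in>?\<H>. nonzero ?r (v t H)"
    using finite_hyperplanes by (intro eventually_ball_finite) auto
  moreover have "\<forall>\<^sub>F t in cofinite. \<not> lindep ?r (h t) A" if "A \<in> indep_sets M" for A
    using independent_cofinite[of A h ?r 1] h that indep_finite[OF that] indep_subset_ground[OF that]
    by (simp add: realizes_def)
  then have "\<forall>\<^sub>F t in cofinite. \<forall>A\<in>indep_sets M. \<not> lindep ?r (h t) A"
    by (intro eventually_ball_finite) auto
  ultimately have "\<forall>\<^sub>F t in cofinite. h t \<in> zclosure M"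
  proof eventually_elim
    case (elim t)
    have "realizes_matroid M (h t)"
      unfolding realizes_def
    proof (intro allI impI iffI)
      fix A assume A: "A \<subseteq> ground M"
      then have fin: "finite A" by (rule finite_subset) simp
      show "A \<notin> indep_sets M" if "lindep ?r (h t) A" using that elim(2) by blast
      assume "A \<notin> indep_sets M"
      then have "dep_set M A" using A by (simp add: dep_set_def)
      then consider "?r < card A" | H where "card A = ?r" "dependent_hyperplane M H" "A \<subseteq> H"
        using paving_dep_iff[OF M A] by blast
      then show "lindep ?r (h t) A"
      proof cases
        case 1
        then show ?thesis using card_gt_imp_lindep fin by blast
      next
        case 2
        then have "kills ?r (v t H) (h t) A" using v(3)[of H t] by (auto simp: kills_def)
        then show ?thesis using lindep_of_kills[OF fin, of ?r "v t H" "h t"] 2 elim(1) by auto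
      qed
    qed
    then show ?case by (rule realizes_zclosure)
  qed
  then have "\<exists>\<^sub>F t in cofinite. h t \<in> zclosure M" by (rule eventually_frequently[rotated]) (rule cofinite_complex_neq_bot)
  then show ?thesis using zclosure_curve[of h M 0] h(1) by blast
qed

text \<open>
  Over the functionals, the families form a bundle whose fibres are intersections of at most two
  hyperplanes; hence any two framed families are joined by a polynomial curve.
\<close>

lemma framed_in_zclosure:
  assumes M: "paving M" "nilpotent_matroid M"
    and deg: "\<And>H1 H2 H3. dependent_hyperplane M H1 \<Longrightarrow> dependent_hyperplane M H2 \<Longrightarrow> dependent_hyperplane M H3 \<Longrightarrow>
      H1 \<noteq> H2 \<Longrightarrow> H1 \<noteq> H3 \<Longrightarrow> H2 \<noteq> H3 \<Longrightarrow> H1 \<inter> H2 \<inter> H3 = {}"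
    and gl: "(g, l) \<in> framed (mrank M) {H. dependent_hyperplane M H}"
  shows "g \<in> zclosure M"
proof -
  let ?r = "mrank M" and ?\<H> = "{H. dependent_hyperplane M H}"
  obtain \<gamma> where "\<gamma> \<in> realizations M" using nilpotent_realizable[OF M(2)] by (auto simp: realizable_def)
  then obtain g1 where g1: "realizes_matroid M g1" using realizations_iff by blast
  obtain l1 where gl1: "(g1, l1) \<in> framed ?r ?\<H>" using realization_frame[OF M(1) g1] by blast
  define v where "v = (\<lambda>t H i. (1 - t) * l H i + t * l1 H i)"
  have v: "polyfun (\<lambda>t. v t H i)" for H i
    unfolding v_def by (intro polyfun_add polyfun_mult polyfun_diff polyfun_const polyfun_id)
  have v01: "v 0 = l" "v 1 = l1" by (simp_all add: v_def fun_eq_iff)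
  define D where "D = (\<lambda>a. {H \<in> ?\<H>. a \<in> H})"
  have finD: "finite (D a)" for a using finite_hyperplanes[of M] by (auto simp: D_def)
  have cardD: "card (D a) \<le> 2" for a
  proof (rule ccontr)
    assume "\<not> card (D a) \<le> 2"
    then have "3 \<le> card (D a)" by simp
    then obtain T where T: "T \<subseteq> D a" "card T = 3" by (meson obtain_subset_with_card_n)
    then obtain x y z where "T = {x, y, z}" "x \<noteq> y" "x \<noteq> z" "y \<noteq> z" by (auto simp: card_3_iff)
    then show False using deg[of x y z] T(1) by (auto simp: D_def)
  qed
  have ind: "\<not> lindep ?r l' (D a)" if "(g', l') \<in> framed ?r ?\<H>" for g' l' a
    using that finD cardD by (intro independent_of_nonparallel) (auto simp: framed_def D_def)
  have orth: "kills ?r (g' a) l' (D a)" if "(g', l') \<in> framed ?r ?\<H>" for g' l' a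
    using that by (auto simp: framed_def D_def kills_def dot_commute)
  \<comment> \<open>The functionals run along segments, and each vector is an unknown orthogonal to
    those of the at most two hyperplanes in \<open>D a\<close>. The functionals may become parallel
    in between; only at the two ends do they have to be independent.\<close>
  have "\<exists>w. (\<forall>i. polyfun (\<lambda>t. w t i)) \<and> w 0 = g a \<and> w 1 = g1 a \<and> (\<forall>t. kills ?r (w t) (v t) (D a))" for a
    using finD v ind[OF gl] ind[OF gl1] orth[OF gl] orth[OF gl1] by (intro orthogonal_curve) (simp_all add: v01)
  then obtain w where w: "\<And>a i. polyfun (\<lambda>t. w a t i)" "\<And>a. w a 0 = g a" "\<And>a. w a 1 = g1 a"
      "\<And>a t. kills ?r (w a t) (v t) (D a)" by metis
  define h where "h = (\<lambda>t a. w a t)"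
  have h: "polyfun (\<lambda>t. h t a i)" "h 0 = g" "h 1 = g1" for a i by (simp_all add: h_def w fun_eq_iff)
  have kill: "kills ?r (v t H) (h t) H" if "dependent_hyperplane M H" for t H
    using w(4)[of _ t] that by (auto simp: kills_def h_def D_def dot_commute)
  have "nonzero ?r (v 0 H)" if "dependent_hyperplane M H" for H
    using gl that by (auto simp: v01 framed_def)
  then have "h 0 \<in> zclosure M"
    using killed_curve_in_zclosure[OF M(1) h(1) _ v _ kill] g1 h(3) by simp
  then show ?thesis using h(2) by simp
qed

lemma circuit_variety_killing:
  assumes "\<gamma> \<in> circuit_variety M" "dependent_hyperplane M H"
  shows "\<exists>l. nonzero (mrank M) l \<and> kills (mrank M) l (\<lambda>a i. \<gamma> (i, a)) H"
proof (rule exists_killing_of_dependent)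
  show "finite H" using finite_subset[OF hyperplane_ground[OF assms(2)]] by simp
  show "0 < mrank M" using hyperplane_rank_pos[OF assms(2)] .
  fix B assume "B \<subseteq> H" "card B = mrank M"
  then have "dep_set M B" using assms(2)
    by (auto simp: dependent_hyperplane_def all_rank_subsets_circuits_def circuit_def)
  then show "lindep (mrank M) (\<lambda>a i. \<gamma> (i, a)) B"
    using assms(1) by (simp add: circuit_variety_def family_dependent_vectors)
qed

lemma matroid_variety_subset: "matroid_variety M \<subseteq> circuit_variety M"
  using zclosure_lindep by (auto simp: matroid_variety_iff circuit_variety_def family_dependent_vectors)

theorem nilpotent_paving_varieties:
  assumes M: "paving M" "nilpotent_matroid M"
    and deg: "\<And>H1 H2 H3. dependent_hyperplane M H1 \<Longrightarrow> dependent_hyperplane M H2 \<Longrightarrow> dependent_hyperplane M H3 \<Longrightarrow>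
      H1 \<noteq> H2 \<Longrightarrow> H1 \<noteq> H3 \<Longrightarrow> H2 \<noteq> H3 \<Longrightarrow> H1 \<inter> H2 \<inter> H3 = {}"
  shows "matroid_variety M = circuit_variety M"
proof
  show "circuit_variety M \<subseteq> matroid_variety M"
  proof
    fix \<gamma> assume \<gamma>: "\<gamma> \<in> circuit_variety M"
    let ?g = "\<lambda>a i. \<gamma> (i, a)" and ?\<H> = "{H. dependent_hyperplane M H}"
    have "\<exists>l. (\<forall>H\<in>?\<H>. nonzero (mrank M) (l H) \<and> kills (mrank M) (l H) ?g H) \<and> (?g, l) \<in> closure (framed (mrank M) ?\<H>)"
    proof (rule framed_dense)
      show "finite H" if "H \<in> ?\<H>" for H
        using that finite_subset[OF hyperplane_ground finite_ground] by blast
      show "card (H \<inter> H') + 2 \<le> mrank M" if "H \<in> ?\<H>" "H' \<in> ?\<H>" "H \<noteq> H'" for H H'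
        using hyperplane_inter_card[OF M(1)] that by blast
      show "\<exists>L\<in>\<K>. card (L \<inter> \<Union>(\<K> - {L})) < mrank M" if "\<K> \<subseteq> ?\<H>" "\<K> \<noteq> {}" for \<K>
        using nilpotent_paving_leaf[OF M that] .
      show "\<exists>l. nonzero (mrank M) l \<and> kills (mrank M) l ?g H" if "H \<in> ?\<H>" for H
        using circuit_variety_killing[OF \<gamma>] that by blast
    qed (use finite_hyperplanes deg in auto)
    then obtain l where "(?g, l) \<in> closure (framed (mrank M) ?\<H>)" by blast
    then obtain F where F: "F \<noteq> bot" "\<forall>\<^sub>F x in F. x \<in> framed (mrank M) ?\<H>" "\<And>a i. ((\<lambda>x. fst x a i) \<longlongrightarrow> ?g a i) F"
      by (rule closure_framed_filter) blast
    have "\<forall>\<^sub>F x in F. fst x \<in> zclosure M"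
      using F(2) framed_in_zclosure[OF M deg] by (auto elim!: eventually_mono)
    then have "?g \<in> zclosure M" by (rule zclosure_limit[OF F(1)]) (rule F(3))
    then show "\<gamma> \<in> matroid_variety M" using \<gamma> by (simp add: matroid_variety_iff circuit_variety_def)
  qed
qed (rule matroid_variety_subset)

section \<open>Forest configurations\<close>

lemma forest_paving:
  assumes "forest_configuration M"
  shows "paving M" "mrank M = 3"
proof -
  show r: "mrank M = 3" using assms by (simp add: forest_configuration_def)
  have "3 \<le> card C \<and> card C \<le> 4" if "circuit M C" for C
    using that assms card_circuit_le[OF that] r by (auto simp: forest_configuration_def simple_matroid_def)
  then show "paving M" unfolding paving_def r by fastforce
qed

text \<open>Shifts a closed walk with indices from \<open>i\<close> to \<open>k\<close> to the
  1-based indices of \<open>forest_configuration\<close>. Consecutive points differ, so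
  \<open>k\<close> is at least \<open>i + 2\<close> and the cycle has the required length.\<close>

lemma forest_no_cycle:
  assumes M: "forest_configuration M" and k: "i < (k::nat)" "x i = x k" "inj_on x {i..<k}"
    and H: "\<And>j. dependent_hyperplane M (H j)" "\<And>j. x j \<in> H j" "\<And>j. x (Suc j) \<in> H j"
      "\<And>j. H (Suc j) \<noteq> H j" "\<And>j. x (Suc j) \<noteq> x j"
  shows False
proof -
  have pav: "paving M" using forest_paving[OF M] by simp
  have "\<forall>j. \<exists>l\<in>subspaces M. \<Union>l = H j" using paving_hyperplane_subspace[OF pav H(1)] by blast
  then obtain l where l: "\<And>j. l j \<in> subspaces M" "\<And>j. \<Union>(l j) = H j" by metis
  have gr: "x j \<in> ground M" for j using hyperplane_ground[OF H(1)] H(2) by blast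
  have "k \<noteq> Suc i" using k(2) H(5)[of i] by metis
  then have k2: "i + 2 \<le> k" using k(1) by simp
  define K where "K = k - i + 1"
  define x' where "x' = (\<lambda>j. x (i + j - 1))"
  define l' where "l' = (\<lambda>j. l (i + j - 1))"
  have "3 \<le> K" using k2 by (simp add: K_def)
  moreover have "\<forall>j\<in>{1..K}. x' j \<in> ground M" using gr by (simp add: x'_def)
  moreover have "\<forall>j\<in>{1..K-1}. l' j \<in> subspaces M" using l by (simp add: l'_def)
  moreover have "x' 1 = x' K" using k(1,2) by (simp add: x'_def K_def)
  moreover have "inj_on x' {1..K-1}"
  proof (rule inj_onI)
    fix a b assume ab: "a \<in> {1..K-1}" "b \<in> {1..K-1}" "x' a = x' b"
    then have "i + a - 1 \<in> {i..<k}" "i + b - 1 \<in> {i..<k}" by (auto simp: K_def)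
    then have "i + a - 1 = i + b - 1" using inj_onD[OF k(3)] ab(3) by (simp add: x'_def)
    then show "a = b" using ab(1,2) unfolding atLeastAtMost_iff by linarith
  qed
  moreover have "\<forall>j\<in>{1..K-2}. l' j \<noteq> l' (j + 1)"
  proof
    fix j assume "j \<in> {1..K-2}"
    then have "i + (j + 1) - 1 = Suc (i + j - 1)" by simp
    then have "H (i + (j + 1) - 1) \<noteq> H (i + j - 1)" using H(4)[of "i + j - 1"] by metis
    then show "l' j \<noteq> l' (j + 1)" unfolding l'_def using l(2) by metis
  qed
  moreover have "\<forall>j\<in>{1..K-1}. x' j \<in> \<Union>(l' j) \<and> x' (j + 1) \<in> \<Union>(l' j)"
  proof
    fix j assume "j \<in> {1..K-1}"
    then have "i + (j + 1) - 1 = Suc (i + j - 1)" by simp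
    then show "x' j \<in> \<Union>(l' j) \<and> x' (j + 1) \<in> \<Union>(l' j)"
      unfolding l'_def x'_def l(2) using H(2)[of "i + j - 1"] H(3)[of "i + j - 1"] by simp
  qed
  ultimately show False using M unfolding forest_configuration_def by blast
qed

text \<open>If every line had two points on other lines, one could walk forever, leaving each line
  at a point other than the entry and changing the line each time. Finitely many points force a
  return.\<close>

lemma forest_leaf:
  assumes M: "forest_configuration M" and \<K>: "\<K> \<subseteq> {H. dependent_hyperplane M H}" "\<K> \<noteq> {}"
  shows "\<exists>L\<in>\<K>. card (L \<inter> \<Union>(\<K> - {L})) \<le> 1"
proof (rule ccontr)
  assume no: "\<not> ?thesis"
  define P where "P = (\<lambda>(x, L). x \<in> L \<and> L \<in> \<K>)"
  define Q where "Q = (\<lambda>(x, L) (y, L'). y \<in> L \<and> y \<noteq> x \<and> L' \<noteq> (L :: 'a set))"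
  have big: "2 \<le> card (L \<inter> \<Union>(\<K> - {L}))" if "L \<in> \<K>" for L
  proof (rule ccontr)
    assume "\<not> 2 \<le> card (L \<inter> \<Union>(\<K> - {L}))"
    then have "card (L \<inter> \<Union>(\<K> - {L})) \<le> 1" by simp
    then show False using no that by blast
  qed
  have step: "\<exists>y L'. P (y, L') \<and> Q (x, L) (y, L')" if "P (x, L)" for x L
  proof -
    have L: "L \<in> \<K>" using that by (simp add: P_def)
    have "\<not> L \<inter> \<Union>(\<K> - {L}) \<subseteq> {x}"
    proof
      assume "L \<inter> \<Union>(\<K> - {L}) \<subseteq> {x}"
      then have "card (L \<inter> \<Union>(\<K> - {L})) \<le> card {x}" by (intro card_mono) simp_all
      then show False using big[OF L] by simp
    qed
    then obtain y L' where "y \<in> L" "y \<noteq> x" "L' \<in> \<K>" "L' \<noteq> L" "y \<in> L'" by blast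
    then show ?thesis unfolding P_def Q_def by (intro exI[of _ y] exI[of _ L']) simp
  qed
  obtain L0 where L0: "L0 \<in> \<K>" using \<K>(2) by blast
  then have "L0 \<noteq> {}" using big[OF L0] by auto
  then obtain x0 where "P (x0, L0)" using L0 by (auto simp: P_def)
  then have "\<exists>f. (\<forall>n::nat. P (f n)) \<and> (\<forall>n. Q (f n) (f (Suc n)))"
    using dependent_nat_choice[of "\<lambda>_. P" "\<lambda>_. Q"] step by (metis surj_pair)
  then obtain f where f: "\<And>n::nat. P (f n)" "\<And>n. Q (f n) (f (Suc n))" by blast
  define x H where "x = (\<lambda>n. fst (f n))" and "H = (\<lambda>n. snd (f n))"
  have "P (x n, H n)" for n using f(1)[of n] by (simp add: x_def H_def)
  then have xH: "x n \<in> H n" "H n \<in> \<K>" for n by (simp_all add: P_def)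
  have "Q (x n, H n) (x (Suc n), H (Suc n))" for n using f(2)[of n] by (simp add: x_def H_def)
  then have Q: "x (Suc n) \<in> H n" "x (Suc n) \<noteq> x n" "H (Suc n) \<noteq> H n" for n by (simp_all add: Q_def)
  have hyp: "dependent_hyperplane M (H n)" for n using xH(2) \<K>(1) by blast
  have "range x \<subseteq> ground M" using hyperplane_ground[OF hyp] xH(1) by blast
  then have "finite (range x)" by (rule finite_subset) simp
  then have "\<not> inj x" using finite_imageD[of x UNIV] infinite_UNIV_nat by blast
  then obtain a b where "a < b" "x a = x b" unfolding inj_def by (metis nat_neq_iff)
  then have ex: "\<exists>k. \<exists>i<k. x i = x k" by blast
  \<comment> \<open>The first return, so that the points before it are distinct.\<close>
  define k where "k = (LEAST k. \<exists>i<k. x i = x k)"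
  obtain i where i: "i < k" "x i = x k" using LeastI_ex[OF ex] by (auto simp: k_def)
  have "inj_on x {i..<k}"
  proof (rule inj_onI, rule ccontr)
    fix a b assume ab: "a \<in> {i..<k}" "b \<in> {i..<k}" "x a = x b" "a \<noteq> b"
    have "\<exists>m<k. \<exists>i<m. x i = x m"
    proof (cases "a < b")
      case True
      then show ?thesis using ab by (intro exI[of _ b]) auto
    next
      case False
      then show ?thesis using ab by (intro exI[of _ a]) (auto intro: exI[of _ b])
    qed
    then show False unfolding k_def using not_less_Least by blast
  qed
  then show False using forest_no_cycle[OF M i _ hyp xH(1) Q(1,3,2)] by blast
qed

section \<open>Points of low degree in restrictions of a forest\<close>

lemma rank_of_restrict:
  assumes "A \<subseteq> G"
  shows "rank_of (restrict_matroid M G) A = rank_of M A"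
proof -
  have "{B \<in> indep_sets (restrict_matroid M G). B \<subseteq> A} = {B \<in> indep_sets M. B \<subseteq> A}" using assms by auto
  then show ?thesis by (simp add: rank_of_def)
qed

lemma mclosure_restrict:
  assumes "A \<subseteq> G" "G \<subseteq> ground M"
  shows "mclosure (restrict_matroid M G) A = mclosure M A \<inter> G"
  using assms rank_of_restrict[of A G M] rank_of_restrict[of "insert x A" G M for x]
  by (auto simp: mclosure_def)

lemma two_closures_of_high_degree:
  assumes "p \<in> high_degree_points K"
  shows "\<exists>C\<in>small_circuits K. \<exists>D\<in>small_circuits K. p \<in> C \<and> p \<in> D \<and> mclosure K C \<noteq> mclosure K D"
proof -
  have c: "1 < card (subspaces_at K p)" using assms by (simp add: high_degree_points_def)
  then have "finite (subspaces_at K p)" using card.infinite[of "subspaces_at K p"] by linarith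
  then obtain l l' where l: "l \<in> subspaces_at K p" "l' \<in> subspaces_at K p" "l \<noteq> l'"
    using c card_le_Suc0_iff_eq[of "subspaces_at K p"] by (metis One_nat_def not_less)
  have rep: "\<exists>C\<in>small_circuits K. p \<in> C \<and> l = closure_rel K `` {C}" if l: "l \<in> subspaces_at K p" for l
  proof -
    obtain C0 C where C: "C0 \<in> small_circuits K" "l = closure_rel K `` {C0}" "C \<in> l" "p \<in> C"
      using l by (auto simp: subspaces_at_def subspaces_def quotient_def)
    then have "C \<in> small_circuits K" "mclosure K C0 = mclosure K C" by (simp_all add: closure_rel_def)
    then have "l = closure_rel K `` {C}" using C(1,2) by (simp add: closure_rel_def)
    then show ?thesis using C(4) \<open>C \<in> small_circuits K\<close> by blast
  qed
  obtain C where C: "C \<in> small_circuits K" "p \<in> C" "l = closure_rel K `` {C}" using rep[OF l(1)] by blast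
  obtain D where D: "D \<in> small_circuits K" "p \<in> D" "l' = closure_rel K `` {D}" using rep[OF l(2)] by blast
  have "mclosure K C \<noteq> mclosure K D"
  proof
    assume "mclosure K C = mclosure K D"
    then have "closure_rel K `` {C} = closure_rel K `` {D}" using C(1) D(1) by (simp add: closure_rel_def)
    then show False using l(3) C(3) D(3) by simp
  qed
  then show ?thesis using C(1,2) D(1,2) by blast
qed

text \<open>If all points of \<open>G\<close> had degree two or more, each would lie on two of the
  lines that contain a three-point circuit of \<open>G\<close>. A leaf among these lines contains
  such a circuit, but has at most one point on the others.\<close>

lemma forest_low_degree_point:
  assumes M: "forest_configuration M" and G: "G \<subseteq> ground M" "G \<noteq> {}"
  shows "high_degree_points (restrict_matroid M G) \<subset> G"
proof (rule ccontr)
  define K where "K = restrict_matroid M G"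
  assume no: "\<not> high_degree_points (restrict_matroid M G) \<subset> G"
  have gK: "ground K = G" using G(1) by (auto simp: K_def)
  have "high_degree_points K \<subseteq> G" using gK by (auto simp: high_degree_points_def)
  then have all: "p \<in> high_degree_points K" if "p \<in> G" for p using no that by (auto simp: K_def)
  have pav: "paving M" and r: "mrank M = 3" using forest_paving[OF M] by auto
  have rK: "mrank K \<le> 3"
  proof -
    obtain B where "B \<in> indep_sets K" "card B = mrank K"
      using rank_attained[of K "ground K"] by (auto simp: mrank_def)
    then show ?thesis using card_le_mrank[of B M] r by (simp add: K_def)
  qed
  \<comment> \<open>Even if \<open>K\<close> has smaller rank, simplicity leaves only three-element
    circuits as small ones.\<close>
  have small: "circuit M C \<and> C \<subseteq> G \<and> card C = 3" if "C \<in> small_circuits K" for C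
  proof -
    have C: "circuit M C" "C \<subseteq> G" "card C \<le> 3"
      using that rK unfolding small_circuits_def K_def circuit_restrict by auto
    moreover have "3 \<le> card C" using M C(1) by (simp add: forest_configuration_def simple_matroid_def)
    ultimately show ?thesis by simp
  qed
  define \<K> where "\<K> = {H. dependent_hyperplane M H \<and> (\<exists>C\<subseteq>H \<inter> G. circuit M C \<and> card C = 3)}"
  have cl: "mclosure M C \<in> \<K> \<and> C \<subseteq> mclosure M C" if C: "C \<in> small_circuits K" for C
  proof -
    have c: "circuit M C" "C \<subseteq> G" "card C = 3" using small[OF C] by auto
    have "C \<subseteq> mclosure M C" using subset_mclosure[OF circuit_ground[OF c(1)]] .
    moreover have "dependent_hyperplane M (mclosure M C)" using hyperplane_of_circuit[OF pav c(1)] c(3) r by simp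
    ultimately show ?thesis unfolding \<K>_def using c by blast
  qed
  have two: "\<exists>H\<in>\<K>. p \<in> H \<and> H \<noteq> L" if p: "p \<in> G" for p L
  proof -
    obtain C D where CD: "C \<in> small_circuits K" "D \<in> small_circuits K" "p \<in> C" "p \<in> D" "mclosure K C \<noteq> mclosure K D"
      using two_closures_of_high_degree[OF all[OF p]] by blast
    have "mclosure M C \<noteq> mclosure M D"
      using CD(5) mclosure_restrict[of C G M] mclosure_restrict[of D G M] small[OF CD(1)] small[OF CD(2)] G(1)
      by (auto simp: K_def)
    then have "mclosure M C \<noteq> L \<or> mclosure M D \<noteq> L" by blast
    then show ?thesis using cl[OF CD(1)] cl[OF CD(2)] CD(3,4) by blast
  qed
  obtain p where "p \<in> G" using G(2) by blast
  then have "\<K> \<noteq> {}" using two by blast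
  moreover have "\<K> \<subseteq> {H. dependent_hyperplane M H}" by (auto simp: \<K>_def)
  ultimately obtain L where L: "L \<in> \<K>" "card (L \<inter> \<Union>(\<K> - {L})) \<le> 1" using forest_leaf[OF M] by blast
  obtain C where C: "C \<subseteq> L \<inter> G" "card C = 3" using L(1) by (auto simp: \<K>_def)
  have "C \<subseteq> L \<inter> \<Union>(\<K> - {L})"
  proof
    fix p assume "p \<in> C"
    then have "p \<in> L" "p \<in> G" using C(1) by auto
    then show "p \<in> L \<inter> \<Union>(\<K> - {L})" using two[of p L] by blast
  qed
  moreover have "finite (L \<inter> \<Union>(\<K> - {L}))"
    using L(1) finite_subset[OF hyperplane_ground finite_ground] by (auto simp: \<K>_def)
  ultimately have "card C \<le> card (L \<inter> \<Union>(\<K> - {L}))" by (intro card_mono)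
  then show False using C(2) L(2) by simp
qed

theorem forest_nilpotent:
  assumes M: "forest_configuration M"
  shows "nilpotent_matroid M"
proof -
  have "card (ground (nil_chain M j)) \<le> card (ground M) - j" for j
  proof (induction j)
    case (Suc j)
    obtain G where G: "G \<subseteq> ground M" "nil_chain M j = restrict_matroid M G" "ground (nil_chain M j) = G"
      using nil_chain_restrict[of M j] by blast
    define D where "D = high_degree_points (restrict_matroid M G)"
    have nx: "ground (nil_chain M (Suc j)) = G \<inter> D" using G by (simp add: D_def Int_absorb1)
    have finG: "finite G" using G(1) by (rule finite_subset) simp
    show ?case
    proof (cases "G = {}")
      case True
      then show ?thesis using nx by simp
    next
      case False
      then have "D \<subset> G" using forest_low_degree_point[OF M G(1)] by (simp add: D_def)
      then have "card (G \<inter> D) < card G" using finG by (intro psubset_card_mono) auto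
      then show ?thesis using Suc G(3) nx by simp
    qed
  qed simp
  then have "card (ground (nil_chain M (card (ground M)))) = 0" by (metis diff_self_eq_0 le_zero_eq)
  then show ?thesis unfolding nilpotent_matroid_def by (metis card_0_eq finite_ground)
qed

section \<open>Brackets and vectors in three-space\<close>

lemma atLeastAtMost_1_3: "{1..3::nat} = {1, 2, 3}"
  by auto

lemma dot_3: "dot 3 x y = x 1 * y 1 + x 2 * y 2 + x 3 * y 3"
  unfolding dot_def atLeastAtMost_1_3 by simp

lemma nonparallel_3:
  "nonparallel 3 x y \<longleftrightarrow> x 1 * y 2 \<noteq> x 2 * y 1 \<or> x 1 * y 3 \<noteq> x 3 * y 1 \<or> x 2 * y 3 \<noteq> x 3 * y 2"
  unfolding nonparallel_def atLeastAtMost_1_3 by auto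

definition cross :: "(nat \<Rightarrow> complex) \<Rightarrow> (nat \<Rightarrow> complex) \<Rightarrow> nat \<Rightarrow> complex" where
  "cross x y i = (if i = 1 then x 2 * y 3 - x 3 * y 2 else if i = 2 then x 3 * y 1 - x 1 * y 3 else x 1 * y 2 - x 2 * y 1)"

lemma cross_simps:
  "cross x y 1 = x 2 * y 3 - x 3 * y 2" "cross x y 2 = x 3 * y 1 - x 1 * y 3" "cross x y 3 = x 1 * y 2 - x 2 * y 1"
  "cross x y (Suc 0) = x 2 * y 3 - x 3 * y 2"
  by (simp_all add: cross_def)

lemma dot_cross [simp]: "dot 3 (cross x y) x = 0" "dot 3 (cross x y) y = 0"
  by (simp_all add: dot_3 cross_simps algebra_simps)

lemma nonzero_cross: "nonzero 3 (cross x y) \<longleftrightarrow> nonparallel 3 x y"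
proof -
  have "nonzero 3 (cross x y) \<longleftrightarrow> cross x y 1 \<noteq> 0 \<or> cross x y 2 \<noteq> 0 \<or> cross x y 3 \<noteq> 0"
    unfolding atLeastAtMost_1_3 by blast
  then show ?thesis unfolding nonparallel_3 cross_simps by (auto simp: mult.commute)
qed

text \<open>Parallelism in polarized form, valid also when one of the functionals vanishes; the
  proof interchanges the two summation indices.\<close>

lemma parallel_dot:
  assumes "\<not> nonparallel r x y"
  shows "dot r x u * dot r y w = dot r x w * dot r y u"
proof -
  have "dot r x u * dot r y w = (\<Sum>i\<in>{1..r}. \<Sum>j\<in>{1..r}. x i * y j * (u i * w j))"
    by (simp add: dot_def sum_product algebra_simps)
  also have "\<dots> = (\<Sum>i\<in>{1..r}. \<Sum>j\<in>{1..r}. x j * y i * (u i * w j))"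
    using assms by (intro sum.cong refl) (simp add: nonparallel_def)
  also have "\<dots> = (\<Sum>j\<in>{1..r}. \<Sum>i\<in>{1..r}. (x j * w j) * (y i * u i))"
    by (subst sum.swap) (simp add: algebra_simps)
  also have "\<dots> = dot r x w * dot r y u"
    by (simp add: dot_def sum_product)
  finally show ?thesis .
qed

lemma parallel_orthogonal:
  assumes "nonzero r x" "\<not> nonparallel r x y" "dot r x u = 0"
  shows "dot r y u = 0"
proof -
  obtain w where "dot r x w = 1" using exists_dot_one[OF assms(1)] by blast
  then show ?thesis using parallel_dot[OF assms(2), of u w] assms(3) by simp
qed

lemma parallel_multiple:
  assumes "nonzero r x" "\<not> nonparallel r x y"
  shows "\<exists>c. \<forall>i\<in>{1..r}. y i = c * x i"
proof -
  obtain k where k: "k \<in> {1..r}" "x k \<noteq> 0" using assms(1) by blast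
  have "y i = y k / x k * x i" if "i \<in> {1..r}" for i
    using assms(2) k that by (simp add: nonparallel_def field_simps)
  then show ?thesis by blast
qed

text \<open>The three minors are, up to sign, the coordinates of a double cross product, which
  expands into multiples of \<open>dot 3 l x\<close> and \<open>dot 3 l y\<close>.\<close>

lemma parallel_cross:
  assumes "dot 3 l x = 0" "dot 3 l y = 0"
  shows "\<not> nonparallel 3 (cross x y) l"
proof -
  have *: "cross x y 1 * l 2 - cross x y 2 * l 1 = y 3 * dot 3 l x - x 3 * dot 3 l y"
    "cross x y 1 * l 3 - cross x y 3 * l 1 = x 2 * dot 3 l y - y 2 * dot 3 l x"
    "cross x y 2 * l 3 - cross x y 3 * l 2 = y 1 * dot 3 l x - x 1 * dot 3 l y"
    by (simp_all add: dot_3 cross_simps algebra_simps)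
  show ?thesis using *[unfolded assms] unfolding nonparallel_3 by simp
qed

text \<open>Two independent functionals on three-space have a one-dimensional common kernel: if
  \<open>u\<close> and \<open>v\<close> were independent, both functionals would be parallel to
  \<open>cross u v\<close>.\<close>

lemma common_kernel:
  assumes "nonparallel 3 l m" "dot 3 l u = 0" "dot 3 m u = 0" "dot 3 l v = 0" "dot 3 m v = 0"
  shows "\<not> nonparallel 3 u v"
proof
  assume "nonparallel 3 u v"
  then have "nonzero 3 (cross u v)" using nonzero_cross by blast
  then show False
    using parallel_trans[of 3 "cross u v" l m] parallel_cross[OF assms(2,4)] parallel_cross[OF assms(3,5)] assms(1) by blast
qed

section \<open>Brackets and replacements evaluated at a family\<close>

definition brk :: "('a \<Rightarrow> nat \<Rightarrow> complex) \<Rightarrow> 'a \<Rightarrow> 'a \<Rightarrow> 'a \<Rightarrow> complex" where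
  "brk g a b c = dot 3 (cross (g a) (g b)) (g c)"

lemma bracket_expand:
  "bracket a b c =
     Var (1, a) * Var (2, b) * Var (3, c) + Var (1, b) * Var (2, c) * Var (3, a) + Var (1, c) * Var (2, a) * Var (3, b)
     - Var (1, a) * Var (2, c) * Var (3, b) - Var (1, b) * Var (2, a) * Var (3, c) - Var (1, c) * Var (2, b) * Var (3, a)"
  unfolding bracket_def det_3 by (simp add: algebra_simps)

lemma ev_bracket: "ev g (bracket a b c) = brk g a b c"
  unfolding bracket_expand ev_def brk_def dot_3
  by (simp add: peval_add peval_diff peval_mult cross_simps algebra_simps)

text \<open>If \<open>g a\<close> and \<open>g b\<close> are independent,
  \<open>cross (g a) (g b)\<close> cuts out their plane and the bracket tests membership; if they
  are parallel, both sides hold.\<close>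

lemma brk_zero_iff:
  assumes "a \<noteq> b" "a \<noteq> c" "b \<noteq> c"
  shows "brk g a b c = 0 \<longleftrightarrow> lindep 3 g {a, b, c}"
proof (cases "nonparallel 3 (g a) (g b)")
  case True
  have nz: "nonzero 3 (g a)" "nonzero 3 (g b)"
    using nonparallel_nonzero[OF True] nonparallel_nonzero[OF nonparallel_sym[OF True]] .
  have ind: "\<not> lindep 3 g {a, b}"
    using nz True nonparallel_sym[OF True] assms(1) by (intro independent_of_nonparallel) auto
  have k: "kills 3 (cross (g a) (g b)) g {a, b}" by (simp add: kills_def)
  show ?thesis
  proof
    assume "brk g a b c = 0"
    then have "kills 3 (cross (g a) (g b)) g {a, b, c}" by (simp add: kills_def brk_def)
    then show "lindep 3 g {a, b, c}"
      using lindep_of_kills[of "{a, b, c}" 3 "cross (g a) (g b)" g] nonzero_cross[of "g a" "g b"] True assms by simp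
  next
    assume "lindep 3 g {a, b, c}"
    moreover have "{a, b, c} = insert c {a, b}" by auto
    ultimately show "brk g a b c = 0"
      unfolding brk_def using kills_lindep_insert[OF _ ind _ k] by simp
  qed
next
  case False
  then have "\<not> nonzero 3 (cross (g a) (g b))" using nonzero_cross by blast
  then have "brk g a b c = 0" unfolding brk_def dot_def by simp
  moreover have "lindep 3 g {a, b}"
  proof (cases "nonzero 3 (g a)")
    case True
    obtain t where "\<forall>i\<in>{1..3}. g b i = t * g a i" using parallel_multiple[OF True False] by blast
    then have "lindep 3 g (insert b {a})" using assms(1) by (intro lindep_insertI[of _ _ _ _ "\<lambda>_. t"]) auto
    then show ?thesis by (simp add: insert_commute)
  next
    case False
    then show ?thesis using lindep_mono[of 3 g "{a}" "{a, b}"] by (simp add: lindep_singleton)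
  qed
  then have "lindep 3 g {a, b, c}" using lindep_mono[of 3 g "{a, b}" "{a, b, c}"] by auto
  ultimately show ?thesis by simp
qed

text \<open>The Grassmann-Cayley meet of the planes through \<open>p1\<close>, \<open>p2\<close> and
  through \<open>p3\<close>, \<open>p4\<close>: a vector in both, and the value of a replacement
  vector.\<close>

definition meet :: "('a \<Rightarrow> nat \<Rightarrow> complex) \<Rightarrow> 'a \<Rightarrow> 'a \<Rightarrow> 'a \<Rightarrow> 'a \<Rightarrow> nat \<Rightarrow> complex" where
  "meet g p1 p2 p3 p4 i = brk g p1 p2 p3 * g p4 i - brk g p1 p2 p4 * g p3 i"

definition meets :: "'a matroid \<Rightarrow> ('a \<Rightarrow> nat \<Rightarrow> complex) \<Rightarrow> 'a \<Rightarrow> (nat \<Rightarrow> complex) set" where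
  "meets M g x = {meet g p1 p2 p3 p4 | p1 p2 p3 p4 l1 l2. l1 \<in> subspaces_at M x \<and> l2 \<in> subspaces_at M x \<and> l1 \<noteq> l2 \<and>
     p1 \<in> \<Union>l1 \<and> p2 \<in> \<Union>l1 \<and> p3 \<in> \<Union>l2 \<and> p4 \<in> \<Union>l2}"

lemma meetsI:
  assumes "l1 \<in> subspaces_at M x" "l2 \<in> subspaces_at M x" "l1 \<noteq> l2" "p1 \<in> \<Union>l1" "p2 \<in> \<Union>l1" "p3 \<in> \<Union>l2" "p4 \<in> \<Union>l2"
  shows "meet g p1 p2 p3 p4 \<in> meets M g x"
  unfolding meets_def
  by (rule CollectI, rule exI[of _ p1], rule exI[of _ p2], rule exI[of _ p3], rule exI[of _ p4],
      rule exI[of _ l1], rule exI[of _ l2]) (use assms in simp)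

lemma meetsE:
  assumes "y \<in> meets M g x"
  obtains p1 p2 p3 p4 l1 l2 where "y = meet g p1 p2 p3 p4" "l1 \<in> subspaces_at M x" "l2 \<in> subspaces_at M x" "l1 \<noteq> l2"
    "p1 \<in> \<Union>l1" "p2 \<in> \<Union>l1" "p3 \<in> \<Union>l2" "p4 \<in> \<Union>l2"
  using assms unfolding meets_def by blast

text \<open>The effect of a substitution on points: by \<open>ev_replacement\<close> and
  \<open>replaces_ev\<close>, evaluating a substituted polynomial at \<open>g\<close> is evaluating
  the original at a family \<open>g'\<close> of this kind. All new columns are computed from the old
  family \<open>g\<close>.\<close>

definition replaces :: "'a matroid \<Rightarrow> ('a \<Rightarrow> nat \<Rightarrow> complex) \<Rightarrow> ('a \<Rightarrow> nat \<Rightarrow> complex) \<Rightarrow> bool" where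
  "replaces M g g' \<longleftrightarrow> (\<forall>x. g' x = g x \<or> g' x \<in> meets M g x)"

lemma ev_replacement_vector:
  "(\<lambda>i. ev g (bracket p1 p2 p3 * Var (i, p4) - bracket p1 p2 p4 * Var (i, p3))) = meet g p1 p2 p3 p4"
  unfolding meet_def ev_bracket[symmetric] by (simp add: ev_def peval_diff peval_mult fun_eq_iff)

lemma ev_replacement:
  assumes "replacement_subst M \<sigma>"
  shows "\<exists>g'. replaces M g g' \<and> (\<forall>P. ev g (psubst \<sigma> P) = ev g' P)"
proof (intro exI conjI allI)
  let ?g' = "\<lambda>x i. ev g (\<sigma> (i, x))"
  show "ev g (psubst \<sigma> P) = ev ?g' P" for P
    by (simp add: ev_def peval_psubst case_prod_unfold)
  show "replaces M g ?g'"
    unfolding replaces_def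
  proof
    fix x
    from assms have "(\<forall>i. \<sigma> (i, x) = Var (i, x)) \<or> (\<lambda>i. \<sigma> (i, x)) \<in> replacement_vectors M x"
      by (simp add: replacement_subst_def)
    then show "?g' x = g x \<or> ?g' x \<in> meets M g x"
    proof
      assume "\<forall>i. \<sigma> (i, x) = Var (i, x)"
      then have "?g' x = g x" by (simp add: ev_def fun_eq_iff)
      then show ?thesis ..
    next
      assume "(\<lambda>i. \<sigma> (i, x)) \<in> replacement_vectors M x"
      then obtain p1 p2 p3 p4 l1 l2 where
        p: "(\<lambda>i. \<sigma> (i, x)) = (\<lambda>i. bracket p1 p2 p3 * Var (i, p4) - bracket p1 p2 p4 * Var (i, p3))"
          "l1 \<in> subspaces_at M x" "l2 \<in> subspaces_at M x" "l1 \<noteq> l2"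
          "p1 \<in> \<Union>l1" "p2 \<in> \<Union>l1" "p3 \<in> \<Union>l2" "p4 \<in> \<Union>l2"
        unfolding replacement_vectors_def by blast
      have "?g' x = meet g p1 p2 p3 p4"
        unfolding ev_replacement_vector[symmetric] using fun_cong[OF p(1)] by simp
      then show ?thesis using meetsI[OF p(2-8)] by simp
    qed
  qed
qed

lemma replaces_ev:
  assumes "replaces M g g'"
  shows "\<exists>\<sigma>. replacement_subst M \<sigma> \<and> (\<forall>P. ev g (psubst \<sigma> P) = ev g' P)"
proof -
  have "\<exists>s. ((\<forall>i. s i = Var (i, x)) \<or> s \<in> replacement_vectors M x) \<and> (\<forall>i. ev g (s i) = g' x i)" for x
  proof (cases "g' x = g x")
    case True
    then show ?thesis by (intro exI[of _ "\<lambda>i. Var (i, x)"]) (simp add: ev_def)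
  next
    case False
    then have "g' x \<in> meets M g x" using assms unfolding replaces_def by blast
    then obtain p1 p2 p3 p4 l1 l2 where p: "g' x = meet g p1 p2 p3 p4"
        "l1 \<in> subspaces_at M x" "l2 \<in> subspaces_at M x" "l1 \<noteq> l2"
        "p1 \<in> \<Union>l1" "p2 \<in> \<Union>l1" "p3 \<in> \<Union>l2" "p4 \<in> \<Union>l2" by (rule meetsE)
    let ?s = "\<lambda>i. bracket p1 p2 p3 * Var (i, p4) - bracket p1 p2 p4 * Var (i, p3)"
    have "?s \<in> replacement_vectors M x" unfolding replacement_vectors_def
      by (rule CollectI, rule exI[of _ p1], rule exI[of _ p2], rule exI[of _ p3], rule exI[of _ p4],
          rule exI[of _ l1], rule exI[of _ l2]) (use p in simp)
    moreover have "\<forall>i. ev g (?s i) = g' x i"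
      unfolding p(1) ev_replacement_vector[symmetric] by simp
    ultimately show ?thesis by blast
  qed
  then obtain s where s: "\<And>x. (\<forall>i. s x i = Var (i, x)) \<or> s x \<in> replacement_vectors M x" "\<And>x i. ev g (s x i) = g' x i"
    by metis
  let ?\<sigma> = "\<lambda>(i, x). s x i"
  have "replacement_subst M ?\<sigma>" using s(1) by (simp add: replacement_subst_def)
  moreover have "ev g (psubst ?\<sigma> P) = ev g' P" for P
  proof -
    have "(\<lambda>v. ev g (?\<sigma> v)) = (\<lambda>(i, x). g' x i)" using s(2) by (auto simp: fun_eq_iff)
    then show ?thesis by (simp add: ev_def peval_psubst)
  qed
  ultimately show ?thesis by blast
qed

definition G_zero :: "'a matroid \<Rightarrow> ('a \<Rightarrow> nat \<Rightarrow> complex) \<Rightarrow> bool" where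
  "G_zero M g \<longleftrightarrow> (\<forall>j. \<forall>P\<in>G_gens M j. ev g P = 0)"

lemma G_zero_replaces:
  assumes "G_zero M g" "replaces M g g'"
  shows "G_zero M g'"
  unfolding G_zero_def
proof (intro allI ballI)
  fix j P assume P: "P \<in> G_gens M j"
  obtain \<sigma> where \<sigma>: "replacement_subst M \<sigma>" "\<And>P. ev g (psubst \<sigma> P) = ev g' P" using replaces_ev[OF assms(2)] by blast
  have "psubst \<sigma> P \<in> G_gens M (Suc j)" using P \<sigma>(1) by auto
  then have "ev g (psubst \<sigma> P) = 0" using assms(1) unfolding G_zero_def by blast
  then show "ev g' P = 0" using \<sigma>(2) by simp
qed

lemma G_zero_brk:
  assumes "G_zero M g" "circuit M {a, b, c}" "card {a, b, c} = 3"
  shows "brk g a b c = 0"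
proof -
  have "bracket a b c \<in> G_gens M 0" using assms(2,3) by auto
  then have "ev g (bracket a b c) = 0" using assms(1) unfolding G_zero_def by blast
  then show ?thesis by (simp add: ev_bracket)
qed

lemma brk_scale: "brk (\<lambda>a i. s a * g a i) a b c = s a * s b * s c * brk g a b c"
  by (simp add: brk_def dot_3 cross_simps algebra_simps)

lemma meet_scale: "meet (\<lambda>a i. s a * g a i) p1 p2 p3 p4 = (\<lambda>i. (s p1 * s p2 * s p3 * s p4) * meet g p1 p2 p3 p4 i)"
  by (simp add: meet_def brk_scale fun_eq_iff algebra_simps)

lemma replaces_scale:
  assumes "replaces M (\<lambda>a i. s a * g a i) h"
  shows "\<exists>g' s'. replaces M g g' \<and> h = (\<lambda>a i. s' a * g' a i)"
proof -
  have "\<exists>y c. (y = g x \<or> y \<in> meets M g x) \<and> h x = (\<lambda>i. c * y i)" for x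
  proof (cases "h x = (\<lambda>i. s x * g x i)")
    case True
    then show ?thesis by blast
  next
    case False
    then have "h x \<in> meets M (\<lambda>a i. s a * g a i) x" using assms unfolding replaces_def by blast
    then obtain p1 p2 p3 p4 l1 l2 where p: "h x = meet (\<lambda>a i. s a * g a i) p1 p2 p3 p4"
        "l1 \<in> subspaces_at M x" "l2 \<in> subspaces_at M x" "l1 \<noteq> l2"
        "p1 \<in> \<Union>l1" "p2 \<in> \<Union>l1" "p3 \<in> \<Union>l2" "p4 \<in> \<Union>l2" by (rule meetsE)
    then show ?thesis using meetsI[OF p(2-8), of g] unfolding meet_scale by blast
  qed
  then obtain g' s' where gs: "\<And>x. g' x = g x \<or> g' x \<in> meets M g x" "\<And>x. h x = (\<lambda>i. s' x * g' x i)"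
    by metis
  have "replaces M g g'" unfolding replaces_def using gs(1) by blast
  moreover have "h = (\<lambda>a i. s' a * g' a i)" using gs(2) by (intro ext) simp
  ultimately show ?thesis by blast
qed

text \<open>Brackets and meets are multihomogeneous in the columns, so a replacement made in a
  scaled family is a scaled replacement of \<open>g\<close>. This permits inserting small multiples
  of a replacement vector, which need not be replacements themselves.\<close>

lemma G_zero_scale:
  assumes "G_zero M g"
  shows "G_zero M (\<lambda>a i. s a * g a i)"
proof -
  have "\<forall>P\<in>G_gens M j. \<forall>g s. G_zero M g \<longrightarrow> ev (\<lambda>a i. s a * g a i) P = 0" for j
  proof (induction j)
    case 0
    show ?case
    proof (intro ballI allI impI)
      fix P g s assume "P \<in> G_gens M 0" and g: "G_zero M g"
      then obtain a b c where "P = bracket a b c" "circuit M {a, b, c}" "card {a, b, c} = 3" by auto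
      then show "ev (\<lambda>a i. s a * g a i) P = 0" using G_zero_brk[OF g] by (simp add: ev_bracket brk_scale)
    qed
  next
    case (Suc j)
    show ?case
    proof (intro ballI allI impI)
      fix P g s assume "P \<in> G_gens M (Suc j)" and g: "G_zero M g"
      then obtain \<sigma> Q where Q: "P = psubst \<sigma> Q" "Q \<in> G_gens M j" "replacement_subst M \<sigma>" by auto
      obtain h where h: "replaces M (\<lambda>a i. s a * g a i) h" "ev (\<lambda>a i. s a * g a i) P = ev h Q"
        using ev_replacement[OF Q(3)] Q(1) by blast
      obtain g' s' where g': "replaces M g g'" "h = (\<lambda>a i. s' a * g' a i)" using replaces_scale[OF h(1)] by blast
      have "ev (\<lambda>a i. s' a * g' a i) Q = 0" using Suc Q(2) G_zero_replaces[OF g g'(1)] by blast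
      then show "ev (\<lambda>a i. s a * g a i) P = 0" unfolding h(2) g'(2) .
    qed
  qed
  then show ?thesis using assms unfolding G_zero_def by blast
qed

lemma subspaces_at_hyperplane:
  assumes M: "forest_configuration M" and l: "l \<in> subspaces_at M x"
  shows "dependent_hyperplane M (\<Union>l)" "x \<in> \<Union>l"
  using l paving_subspace_hyperplane[OF forest_paving(1)[OF M]] by (auto simp: subspaces_at_def)

lemma subspaces_at_neq:
  assumes M: "forest_configuration M" and l: "l1 \<in> subspaces_at M x" "l2 \<in> subspaces_at M x" "l1 \<noteq> l2"
  shows "\<Union>l1 \<noteq> \<Union>l2"
  using l paving_subspace_inj[OF forest_paving(1)[OF M], of l1 l2] by (auto simp: subspaces_at_def)

subsection \<open>The generators of the ideal vanish on realizations\<close>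

text \<open>The meet lies in the planes of both lines, as does \<open>g x\<close>. In a realization
  the functionals of the two lines are nonparallel, so their common kernel has dimension
  one.\<close>

lemma meets_of_realization:
  assumes M: "forest_configuration M" and g: "realizes_matroid M g" and y: "y \<in> meets M g x"
  shows "\<exists>c. \<forall>i\<in>{1..3}. y i = c * g x i"
proof -
  obtain p1 p2 p3 p4 l1 l2 where p: "y = meet g p1 p2 p3 p4"
      "l1 \<in> subspaces_at M x" "l2 \<in> subspaces_at M x" "l1 \<noteq> l2"
      "p1 \<in> \<Union>l1" "p2 \<in> \<Union>l1" "p3 \<in> \<Union>l2" "p4 \<in> \<Union>l2" using y by (rule meetsE)
  have r: "mrank M = 3" and pav: "paving M" using forest_paving[OF M] by auto
  obtain k where k: "(g, k) \<in> framed 3 {H. dependent_hyperplane M H}"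
    using realization_frame[OF pav g] r by auto
  note H = subspaces_at_hyperplane[OF M p(2)] subspaces_at_hyperplane[OF M p(3)]
  define m1 m2 where "m1 = k (\<Union>l1)" and "m2 = k (\<Union>l2)"
  have np: "nonparallel 3 m1 m2"
    using framedD(3)[OF k, of "\<Union>l1" "\<Union>l2"] H subspaces_at_neq[OF M p(2-4)] by (simp add: m1_def m2_def)
  have "kills 3 m1 g (\<Union>l1)" "kills 3 m2 g (\<Union>l2)"
    using framedD(2)[OF k, of "\<Union>l1"] framedD(2)[OF k, of "\<Union>l2"] H(1,3) by (simp_all add: m1_def m2_def)
  note k12 = this
  have m1: "dot 3 m1 (g a) = 0" if "a \<in> \<Union>l1" for a using k12(1) that unfolding kills_def by blast
  have m2: "dot 3 m2 (g a) = 0" if "a \<in> \<Union>l2" for a using k12(2) that unfolding kills_def by blast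
  have "dot 3 m2 y = 0"
    unfolding p(1) meet_def by (simp add: dot_linear m2[OF p(7)] m2[OF p(8)])
  \<comment> \<open>The brackets are values of \<open>cross (g p1) (g p2)\<close>, which is parallel
    to \<open>m1\<close> and possibly zero; the polarized identity makes the two terms
    cancel.\<close>
  moreover have "dot 3 m1 y = 0"
    unfolding p(1) meet_def dot_linear brk_def
    using parallel_dot[OF parallel_cross[OF m1[OF p(5)] m1[OF p(6)]], of "g p3" "g p4"] by simp
  ultimately have par: "\<not> nonparallel 3 (g x) y"
    using common_kernel[OF np m1[OF H(2)] m2[OF H(4)]] by blast
  have "x \<in> ground M" using hyperplane_ground[OF H(1)] H(2) by blast
  then have "{x} \<in> indep_sets M" using paving_small_indep[OF pav, of "{x}"] r by simp
  then have "\<not> lindep 3 g {x}" using g \<open>x \<in> ground M\<close> by (simp add: realizes_def r)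
  then have "nonzero 3 (g x)" by (simp add: lindep_singleton)
  then show ?thesis using parallel_multiple[OF _ par] by blast
qed

lemma pring_bracket:
  assumes "mrank M = 3" "a \<in> ground M" "b \<in> ground M" "c \<in> ground M"
  shows "bracket a b c \<in> pring (matrix_index M)"
proof -
  have "Var (i, x) \<in> pring (matrix_index M)" if "i \<in> {1..3}" "x \<in> ground M" for i x
    using that assms(1) by (intro pring_Var) (simp add: matrix_index_def)
  then show ?thesis
    unfolding bracket_expand using assms(2-4)
    by (intro pring_add pring_diff pring_mult) simp_all
qed

lemma G_gens_pring:
  assumes M: "forest_configuration M"
  shows "P \<in> G_gens M j \<Longrightarrow> P \<in> pring (matrix_index M)"
proof (induction j arbitrary: P)
  case 0
  then obtain a b c where "P = bracket a b c" "circuit M {a, b, c}" by auto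
  then show ?case using circuit_ground[of M "{a, b, c}"] pring_bracket[OF forest_paving(2)[OF M], of a b c] by simp
next
  case (Suc j)
  then obtain \<sigma> Q where Q: "P = psubst \<sigma> Q" "Q \<in> G_gens M j" "replacement_subst M \<sigma>" by auto
  show ?case unfolding Q(1)
  proof (rule pring_psubst[OF Suc.IH[OF Q(2)]])
    fix v assume v: "v \<in> matrix_index M"
    obtain i x where ix: "v = (i, x)" by force
    from Q(3) have "(\<forall>i. \<sigma> (i, x) = Var (i, x)) \<or> (\<lambda>i. \<sigma> (i, x)) \<in> replacement_vectors M x"
      by (simp add: replacement_subst_def)
    then show "\<sigma> v \<in> pring (matrix_index M)"
    proof
      assume "\<forall>i. \<sigma> (i, x) = Var (i, x)"
      then show ?thesis using v ix pring_Var by metis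
    next
      assume "(\<lambda>i. \<sigma> (i, x)) \<in> replacement_vectors M x"
      then obtain p1 p2 p3 p4 l1 l2 where
        p: "(\<lambda>i. \<sigma> (i, x)) = (\<lambda>i. bracket p1 p2 p3 * Var (i, p4) - bracket p1 p2 p4 * Var (i, p3))"
          "l1 \<in> subspaces_at M x" "l2 \<in> subspaces_at M x"
          "p1 \<in> \<Union>l1" "p2 \<in> \<Union>l1" "p3 \<in> \<Union>l2" "p4 \<in> \<Union>l2"
        unfolding replacement_vectors_def by blast
      have gr: "p1 \<in> ground M" "p2 \<in> ground M" "p3 \<in> ground M" "p4 \<in> ground M"
        using p(4-7) hyperplane_ground[OF subspaces_at_hyperplane(1)[OF M p(2)]]
          hyperplane_ground[OF subspaces_at_hyperplane(1)[OF M p(3)]] by (auto simp: subset_iff)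
      have "Var (i, p3) \<in> pring (matrix_index M)" "Var (i, p4) \<in> pring (matrix_index M)"
        using v gr ix by (simp_all add: pring_Var matrix_index_def)
      then show ?thesis
        unfolding ix fun_cong[OF p(1), of i] using gr pring_bracket[OF forest_paving(2)[OF M]]
        by (intro pring_diff pring_mult) simp_all
    qed
  qed
qed

text \<open>A replacement turns a realization into itself up to factors on the columns, some of them
  possibly 0; proving vanishing for all scalings at once closes the induction.\<close>

lemma G_zero_realization:
  assumes M: "forest_configuration M" and g: "realizes_matroid M g"
  shows "G_zero M g"
proof -
  have r: "mrank M = 3" using forest_paving[OF M] by simp
  have "\<forall>P\<in>G_gens M j. \<forall>s. ev (\<lambda>a i. s a * g a i) P = 0" for j
  proof (induction j)
    case 0
    show ?case
    proof (intro ballI allI)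
      fix P s assume "P \<in> G_gens M 0"
      then obtain a b c where P: "P = bracket a b c" "circuit M {a, b, c}" "card {a, b, c} = 3" by auto
      have "a \<noteq> b" "a \<noteq> c" "b \<noteq> c" using P(3) by (auto simp: card_insert_if split: if_splits)
      moreover have "lindep 3 g {a, b, c}"
        using g circuit_ground[OF P(2)] circuit_not_indep[OF P(2)] by (simp add: realizes_def r)
      ultimately have "brk g a b c = 0" by (simp add: brk_zero_iff)
      then show "ev (\<lambda>a i. s a * g a i) P = 0" by (simp add: P(1) ev_bracket brk_scale)
    qed
  next
    case (Suc j)
    show ?case
    proof (intro ballI allI)
      fix P s assume "P \<in> G_gens M (Suc j)"
      then obtain \<sigma> Q where Q: "P = psubst \<sigma> Q" "Q \<in> G_gens M j" "replacement_subst M \<sigma>" by auto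
      obtain h where h: "replaces M (\<lambda>a i. s a * g a i) h" "ev (\<lambda>a i. s a * g a i) P = ev h Q"
        using ev_replacement[OF Q(3)] Q(1) by blast
      obtain g' s' where g': "replaces M g g'" "h = (\<lambda>a i. s' a * g' a i)" using replaces_scale[OF h(1)] by blast
      have "\<exists>c. \<forall>i\<in>{1..3}. g' x i = c * g x i" for x
      proof (cases "g' x = g x")
        case True
        then show ?thesis by (intro exI[of _ 1]) simp
      next
        case False
        then show ?thesis using g'(1) meets_of_realization[OF M g] unfolding replaces_def by blast
      qed
      then obtain c where c: "\<And>x i. i \<in> {1..3} \<Longrightarrow> g' x i = c x * g x i" by metis
      have "ev h Q = ev (\<lambda>a i. (s' a * c a) * g a i) Q"
        by (rule ev_cong[OF G_gens_pring[OF M Q(2)]]) (simp add: g'(2) c r)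
      also have "\<dots> = 0" using bspec[OF Suc Q(2), THEN spec, of "\<lambda>a. s' a * c a"] .
      finally show "ev (\<lambda>a i. s a * g a i) P = 0" using h(2) by simp
    qed
  qed
  from this[rule_format, of _ _ "\<lambda>_. 1"] show ?thesis by (simp add: G_zero_def)
qed

subsection \<open>Common zeros of the ideal are limits of realizations\<close>

text \<open>If no vector vanishes, lines and points can be moved one leaf at a time.\<close>

lemma nonzero_in_zclosure:
  assumes M: "forest_configuration M" and nz: "\<And>a. a \<in> ground M \<Longrightarrow> nonzero 3 (g a)"
    and l: "\<And>H. dependent_hyperplane M H \<Longrightarrow> nonzero 3 (l H) \<and> kills 3 (l H) g H"
  shows "g \<in> zclosure M"
proof -
  have r: "mrank M = 3" and pav: "paving M" using forest_paving[OF M] by auto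
  obtain \<gamma> where "\<gamma> \<in> realizations M" using nilpotent_realizable[OF forest_nilpotent[OF M]] by (auto simp: realizable_def)
  then obtain g1 where g1: "realizes_matroid M g1" using realizations_iff by blast
  obtain l1 where gl1: "(g1, l1) \<in> framed 3 {H. dependent_hyperplane M H}" using realization_frame[OF pav g1] r by auto
  have nz1: "nonzero 3 (g1 a)" if "a \<in> ground M" for a
  proof -
    have "{a} \<in> indep_sets M" using paving_small_indep[OF pav, of "{a}"] r that by simp
    then have "\<not> lindep 3 g1 {a}" using g1 that by (simp add: realizes_def r)
    then show ?thesis by (simp add: lindep_singleton)
  qed
  let ?C = "\<lambda>\<K> h v. (\<forall>a i. polyfun (\<lambda>t. h t a i)) \<and> (\<forall>H i. polyfun (\<lambda>t. v t H i)) \<and> h 0 = g \<and> h 1 = g1 \<and>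
    (\<forall>H\<in>\<K>. v 0 H = l H \<and> (\<forall>t. kills 3 (v t H) (h t) H))"
  have "\<K> \<subseteq> {H. dependent_hyperplane M H} \<Longrightarrow> \<exists>h v. ?C \<K> h v" if "finite \<K>" for \<K>
    using that
  proof (induction \<K> rule: finite_psubset_induct)
    case (psubset \<K>)
    show ?case
    proof (cases "\<K> = {}")
      case True
      let ?h = "\<lambda>t a i. (1 - t) * g a i + t * g1 a i"
      have "polyfun (\<lambda>t. ?h t a i)" for a i
        by (intro polyfun_add polyfun_mult polyfun_diff polyfun_const polyfun_id)
      moreover have "?h 0 = g" "?h 1 = g1" by (simp_all add: fun_eq_iff)
      ultimately have "?C \<K> ?h (\<lambda>_ _ _. 0)" using polyfun_const[of 0] True by simp
      then show ?thesis by (intro exI[of _ ?h] exI[of _ "\<lambda>_ _ _. 0"])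
    next
      case False
      then obtain L where L: "L \<in> \<K>" "card (L \<inter> \<Union>(\<K> - {L})) \<le> 1" using forest_leaf[OF M psubset.prems] by blast
      define S where "S = L \<inter> \<Union>(\<K> - {L})"
      have hyp: "dependent_hyperplane M L" using L psubset.prems by blast
      have gr: "L \<subseteq> ground M" using hyperplane_ground[OF hyp] .
      have finS: "finite S" "card S \<le> 1" using finite_subset[OF gr] L(2) by (auto simp: S_def)
      have "\<K> - {L} \<subset> \<K>" "\<K> - {L} \<subseteq> {H. dependent_hyperplane M H}" using L psubset.prems by auto
      from psubset.IH[OF this] obtain h v where "?C (\<K> - {L}) h v" by blast
      then have h: "\<And>a i. polyfun (\<lambda>t. h t a i)" "h 0 = g" "h 1 = g1" and v: "\<And>H i. polyfun (\<lambda>t. v t H i)"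
        and v0: "\<And>H. H \<in> \<K> - {L} \<Longrightarrow> v 0 H = l H" and k: "\<And>H t. H \<in> \<K> - {L} \<Longrightarrow> kills 3 (v t H) (h t) H" by blast+
      \<comment> \<open>At most one point is shared with the other lines, so a nonzero vector there
        makes the condition on the functional of \<open>L\<close> independent.\<close>
      have indS: "\<not> lindep 3 f S" if "\<And>a. a \<in> ground M \<Longrightarrow> nonzero 3 (f a)" for f
      proof (rule independent_of_nonparallel[OF finS(1)])
        show "card S \<le> 2" using finS(2) by simp
        show "nonzero 3 (f a)" if "a \<in> S" for a using that gr \<open>\<And>a. a \<in> ground M \<Longrightarrow> nonzero 3 (f a)\<close> by (auto simp: S_def)
        show "nonparallel 3 (f a) (f b)" if "a \<in> S" "b \<in> S" "a \<noteq> b" for a b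
          using that finS card_le_Suc0_iff_eq[OF finS(1)] by auto
      qed
      have kl: "kills 3 (l L) g L" "kills 3 (l1 L) g1 L" "nonzero 3 (l L)" "nonzero 3 (l1 L)"
        using l[OF hyp] framedD(1,2)[OF gl1, of L] hyp by simp_all
      \<comment> \<open>The functional of \<open>L\<close> follows the shared point, and then the
        vectors of the points of \<open>L\<close> follow the functional.\<close>
      have "\<exists>w. (\<forall>i. polyfun (\<lambda>t. w t i)) \<and> w 0 = l L \<and> w 1 = l1 L \<and> (\<forall>t. kills 3 (w t) (h t) S)"
        using h nz nz1 indS kl(1,2) by (intro orthogonal_curve finS(1)) (auto simp: kills_def S_def)
      then obtain m where m: "\<And>i. polyfun (\<lambda>t. m t i)" "m 0 = l L" "m 1 = l1 L" "\<And>t. kills 3 (m t) (h t) S" by blast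
      have "\<exists>w. (\<forall>i. polyfun (\<lambda>t. w t i)) \<and> w 0 = g a \<and> w 1 = g1 a \<and> (\<forall>t. kills 3 (w t) (\<lambda>_. m t) {()})" if "a \<in> L" for a
        using m kl that by (intro orthogonal_curve) (auto simp: kills_def lindep_singleton dot_commute)
      then have "\<exists>w. (\<forall>i. polyfun (\<lambda>t. w t i)) \<and> w 0 = g a \<and> w 1 = g1 a \<and> (\<forall>t. dot 3 (m t) (w t) = 0)" if "a \<in> L" for a
        using that by (simp add: kills_def dot_commute)
      then obtain w where w: "\<And>a i. a \<in> L \<Longrightarrow> polyfun (\<lambda>t. w a t i)" "\<And>a. a \<in> L \<Longrightarrow> w a 0 = g a" "\<And>a. a \<in> L \<Longrightarrow> w a 1 = g1 a"
          "\<And>a t. a \<in> L \<Longrightarrow> dot 3 (m t) (w a t) = 0" by metis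
      define h' where "h' = (\<lambda>t a. if a \<in> L - S then w a t else h t a)"
      define v' where "v' = (\<lambda>t. (v t)(L := m t))"
      have "polyfun (\<lambda>t. h' t a i)" for a i
        using w(1)[of a i] h(1)[of a i] unfolding h'_def by (cases "a \<in> L - S") (simp_all only: if_True if_False Diff_iff simp_thms)
      moreover have "polyfun (\<lambda>t. v' t H i)" for H i
        using m(1)[of i] v[of H i] unfolding v'_def by (cases "H = L") simp_all
      moreover have "h' 0 = g" "h' 1 = g1" using w(2,3) h(2,3) by (auto simp: h'_def fun_eq_iff)
      moreover have "v' 0 H = l H \<and> (\<forall>t. kills 3 (v' t H) (h' t) H)" if H: "H \<in> \<K>" for H
      proof (cases "H = L")
        case True
        have "dot 3 (m t) (h' t a) = 0" if "a \<in> L" for a t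
          using w(4)[OF that, of t] m(4)[of t] that unfolding h'_def kills_def by (cases "a \<in> S") simp_all
        then show ?thesis using True m(2) by (simp add: v'_def kills_def)
      next
        case False
        then have HK: "H \<in> \<K> - {L}" using H by simp
        have "h' t a = h t a" if "a \<in> H" for a t
        proof -
          have "a \<notin> L - S" using that HK unfolding S_def by blast
          then show ?thesis unfolding h'_def by (rule if_not_P)
        qed
        then show ?thesis using k[OF HK] v0[OF HK] False by (simp add: v'_def kills_def)
      qed
      ultimately have "?C \<K> h' v'" by blast
      then show ?thesis by blast
    qed
  qed
  from this[OF finite_hyperplanes[of M]] obtain h v where "?C {H. dependent_hyperplane M H} h v" by blast
  then have h: "\<And>a i. polyfun (\<lambda>t. h t a i)" "h 0 = g" "h 1 = g1" and v: "\<And>H i. polyfun (\<lambda>t. v t H i)"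
    and v0: "\<And>H. dependent_hyperplane M H \<Longrightarrow> v 0 H = l H"
    and k: "\<And>H t. dependent_hyperplane M H \<Longrightarrow> kills 3 (v t H) (h t) H" by blast+
  have "h 0 \<in> zclosure M"
  proof (rule killed_curve_in_zclosure[OF pav h(1) _ v])
    show "realizes_matroid M (h 1)" using g1 h(3) by simp
    fix H assume H: "dependent_hyperplane M H"
    show "nonzero (mrank M) (v 0 H)" using l[OF H] unfolding v0[OF H] r by blast
    show "kills (mrank M) (v t H) (h t) H" for t using k[OF H] unfolding r .
  qed
  then show ?thesis using h(2) by simp
qed

section \<open>Families with zero columns\<close>

definition zero_points :: "'a matroid \<Rightarrow> ('a \<Rightarrow> nat \<Rightarrow> complex) \<Rightarrow> 'a set" where
  "zero_points M g = {a \<in> ground M. \<not> nonzero 3 (g a)}"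

definition planar :: "('a \<Rightarrow> nat \<Rightarrow> complex) \<Rightarrow> 'a set \<Rightarrow> bool" where
  "planar g H \<longleftrightarrow> (\<exists>p\<in>H. \<exists>q\<in>H. nonparallel 3 (g p) (g q))"

text \<open>
  The vectors that may be inserted at a zero column \<open>x\<close>: they lie on every line through \<open>x\<close> whose
  plane is already determined by the nonzero columns.
\<close>

definition admissible :: "'a matroid \<Rightarrow> ('a \<Rightarrow> nat \<Rightarrow> complex) \<Rightarrow> 'a \<Rightarrow> (nat \<Rightarrow> complex) \<Rightarrow> bool" where
  "admissible M g x u \<longleftrightarrow> (\<forall>H. dependent_hyperplane M H \<longrightarrow> x \<in> H \<longrightarrow> planar g H \<longrightarrow>
     (\<forall>k. kills 3 k g H \<longrightarrow> dot 3 k u = 0))"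

lemma exists_orthogonal: "\<exists>u. nonzero 3 u \<and> dot 3 k u = 0"
  using exists_killing[of "{()}" 3 "\<lambda>_. k"] by (auto simp: kills_def dot_commute)

text \<open>Let \<open>g s\<close> and \<open>g t\<close> span the plane of one line through
  \<open>x\<close>. The meet with another such line is a combination of these two vectors, so it
  vanishes only if both brackets do, that is, if both vectors lie in the other plane. Hence every
  combination of them is admissible, and a nonzero one lies in the kernel of
  \<open>k\<close>.\<close>

lemma exists_admissible:
  assumes terminal: "\<And>H H' p q s t. dependent_hyperplane M H \<Longrightarrow> dependent_hyperplane M H' \<Longrightarrow> H \<noteq> H' \<Longrightarrow> x \<in> H \<Longrightarrow> x \<in> H' \<Longrightarrow>
      p \<in> H \<Longrightarrow> q \<in> H \<Longrightarrow> s \<in> H' \<Longrightarrow> t \<in> H' \<Longrightarrow> \<not> nonzero 3 (meet g p q s t)"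
  shows "\<exists>u. nonzero 3 u \<and> admissible M g x u \<and> dot 3 k u = 0"
proof (cases "\<exists>H. dependent_hyperplane M H \<and> x \<in> H \<and> planar g H")
  case False
  then show ?thesis using exists_orthogonal[of k] unfolding admissible_def by blast
next
  case True
  then obtain H0 s t where H0: "dependent_hyperplane M H0" "x \<in> H0" "s \<in> H0" "t \<in> H0" "nonparallel 3 (g s) (g t)"
    unfolding planar_def by blast
  have st: "dot 3 c (g s) = 0 \<and> dot 3 c (g t) = 0"
    if H: "dependent_hyperplane M H" "x \<in> H" "planar g H" "kills 3 c g H" for H c
  proof (cases "H = H0")
    case True
    then show ?thesis using H(4) H0(3,4) by (simp add: kills_def)
  next
    case False
    obtain p q where pq: "p \<in> H" "q \<in> H" "nonparallel 3 (g p) (g q)" using H(3) unfolding planar_def by blast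
    have "\<not> nonzero 3 (meet g p q s t)" using terminal[OF H(1) H0(1) False H(2) H0(2) pq(1,2) H0(3,4)] .
    then have eq: "brk g p q s * g t i = brk g p q t * g s i" if "i \<in> {1..3}" for i
      using that by (simp add: meet_def)
    obtain i j where ij: "i \<in> {1..3}" "j \<in> {1..3}" "g s i * g t j - g s j * g t i \<noteq> 0"
      using H0(5) by (auto simp: nonparallel_def)
    have "brk g p q s * (g s i * g t j - g s j * g t i) = 0"
      using eq[OF ij(1)] eq[OF ij(2)] by (simp add: algebra_simps)
    then have bs: "brk g p q s = 0" using ij(3) by simp
    have "brk g p q t * (g s i * g t j - g s j * g t i) = 0"
      using eq[OF ij(1)] eq[OF ij(2)] bs ij(3) by auto
    then have bt: "brk g p q t = 0" using ij(3) by simp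
    have par: "\<not> nonparallel 3 (cross (g p) (g q)) c"
      using H(4) pq by (intro parallel_cross) (simp_all add: kills_def)
    have "nonzero 3 (cross (g p) (g q))" using pq(3) nonzero_cross by blast
    then show ?thesis using parallel_orthogonal[OF _ par] bs bt unfolding brk_def by blast
  qed
  define \<alpha> \<beta> where "\<alpha> = dot 3 k (g t)" and "\<beta> = dot 3 k (g s)"
  \<comment> \<open>The combination with coefficients \<open>dot 3 k (g t)\<close> and
    \<open>- dot 3 k (g s)\<close> lies in the kernel of \<open>k\<close>; if both are 0,
    \<open>g s\<close> itself does.\<close>
  define a b where "a = (if \<alpha> = 0 \<and> \<beta> = 0 then 1 else \<alpha>)" and "b = (if \<alpha> = 0 \<and> \<beta> = 0 then 0 else \<beta>)"
  define u where "u = (\<lambda>i. a * g s i - b * g t i)"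
  have "admissible M g x u" unfolding admissible_def u_def using st by (simp add: dot_linear)
  moreover have "dot 3 k u = 0" unfolding u_def a_def b_def by (simp add: dot_linear \<alpha>_def \<beta>_def)
  moreover have "nonzero 3 u"
  proof (rule ccontr)
    assume "\<not> nonzero 3 u"
    then have z: "a * g s i = b * g t i" if "i \<in> {1..3}" for i using that by (simp add: u_def)
    obtain i j where ij: "i \<in> {1..3}" "j \<in> {1..3}" "g s i * g t j - g s j * g t i \<noteq> 0"
      using H0(5) by (auto simp: nonparallel_def)
    have "a * (g s i * g t j - g s j * g t i) = (a * g s i) * g t j - (a * g s j) * g t i" by (simp add: algebra_simps)
    then have "a = 0" using z[OF ij(1)] z[OF ij(2)] ij(3) by (simp add: algebra_simps)
    have "b * (g s i * g t j - g s j * g t i) = g s i * (b * g t j) - g s j * (b * g t i)" by (simp add: algebra_simps)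
    then have "b = 0" using z[OF ij(1), symmetric] z[OF ij(2), symmetric] ij(3) by (simp add: algebra_simps)
    then show False using \<open>a = 0\<close> by (simp add: a_def b_def split: if_splits)
  qed
  ultimately show ?thesis by blast
qed

text \<open>The vectors of \<open>L\<close> span at most one dimension, which leaves room in
  three-space for a functional that also kills \<open>u\<close>.\<close>

lemma nonplanar_killing:
  assumes "\<not> planar g L" 
  shows "\<exists>k. nonzero 3 k \<and> kills 3 k g L \<and> dot 3 k u = 0"
proof (cases "\<exists>p\<in>L. nonzero 3 (g p)")
  case True
  then obtain p where p: "p \<in> L" "nonzero 3 (g p)" by blast
  obtain k where k: "nonzero 3 k" "kills 3 k (\<lambda>b. if b then g p else u) (UNIV :: bool set)"
    using exists_killing[of "UNIV :: bool set" 3 "\<lambda>b. if b then g p else u"] by auto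
  have kp: "dot 3 k (g p) = 0" and ku: "dot 3 k u = 0" using k(2) unfolding kills_def by (metis UNIV_I)+
  have "dot 3 k (g q) = 0" if "q \<in> L" for q
  proof -
    have "\<not> nonparallel 3 (g p) (g q)" using assms p(1) that unfolding planar_def by blast
    then show ?thesis using parallel_orthogonal[OF p(2), of "g q" k] kp by (simp add: dot_commute)
  qed
  then show ?thesis using k(1) ku unfolding kills_def by blast
next
  case False
  obtain k where k: "nonzero 3 k" "dot 3 u k = 0" using exists_orthogonal by blast
  have "dot 3 k (g q) = 0" if "q \<in> L" for q using False that by (simp add: dot_def)
  then show ?thesis using k unfolding kills_def by (metis dot_commute)
qed

text \<open>Functionals of lines and vectors for the zero columns are chosen together, leaf by leaf.
  At a shared point the vector is already fixed: admissibility makes it fit if the plane of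
  \<open>L\<close> is determined, and otherwise the functional is chosen to fit it. Multiplying the
  new vectors by \<open>t\<close> then gives a curve that leads back to \<open>g\<close> at
  \<open>t = 0\<close>.\<close>

lemma terminal_in_zclosure:
  assumes M: "forest_configuration M"
    and kill: "\<And>H. dependent_hyperplane M H \<Longrightarrow> \<exists>k. nonzero 3 k \<and> kills 3 k g H"
    and terminal: "\<And>x H H' p q s t. x \<in> zero_points M g \<Longrightarrow>
      dependent_hyperplane M H \<Longrightarrow> dependent_hyperplane M H' \<Longrightarrow> H \<noteq> H' \<Longrightarrow> x \<in> H \<Longrightarrow> x \<in> H' \<Longrightarrow>
      p \<in> H \<Longrightarrow> q \<in> H \<Longrightarrow> s \<in> H' \<Longrightarrow> t \<in> H' \<Longrightarrow> \<not> nonzero 3 (meet g p q s t)"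
  shows "g \<in> zclosure M"
proof -
  define Z where "Z = zero_points M g"
  have adm: "\<exists>u. nonzero 3 u \<and> admissible M g x u \<and> dot 3 k u = 0" if "x \<in> Z" for x k
    using exists_admissible[of M x g k] terminal that unfolding Z_def by blast
  define C where "C = (\<lambda>\<K> l u. (\<forall>x\<in>Z. nonzero 3 (u x) \<and> admissible M g x (u x)) \<and>
    (\<forall>H\<in>\<K>. nonzero 3 (l H) \<and> kills 3 (l H) g H \<and> (\<forall>x\<in>Z \<inter> H. dot 3 (l H) (u x) = 0)))"
  have "\<K> \<subseteq> {H. dependent_hyperplane M H} \<Longrightarrow> \<exists>l u. C \<K> l u" if "finite \<K>" for \<K>
    using that
  proof (induction \<K> rule: finite_psubset_induct)
    case (psubset \<K>)
    show ?case
    proof (cases "\<K> = {}")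
      case True
      have "\<exists>u. nonzero 3 u \<and> admissible M g x u" if "x \<in> Z" for x using adm[OF that] by blast
      then obtain u where "\<And>x. x \<in> Z \<Longrightarrow> nonzero 3 (u x) \<and> admissible M g x (u x)" by metis
      then have "C \<K> (\<lambda>_ _. 0) u" using True by (simp add: C_def)
      then show ?thesis by blast
    next
      case False
      then obtain L where L: "L \<in> \<K>" "card (L \<inter> \<Union>(\<K> - {L})) \<le> 1" using forest_leaf[OF M psubset.prems] by blast
      define S where "S = L \<inter> \<Union>(\<K> - {L})"
      have hyp: "dependent_hyperplane M L" using L psubset.prems by blast
      have finS: "finite S" using finite_subset[OF hyperplane_ground[OF hyp]] by (simp add: S_def)
      then have one: "x = y" if "x \<in> S" "y \<in> S" for x y
        using L(2) that card_le_Suc0_iff_eq[OF finS] by (simp add: S_def)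
      have "\<K> - {L} \<subset> \<K>" "\<K> - {L} \<subseteq> {H. dependent_hyperplane M H}" using L psubset.prems by auto
      from psubset.IH[OF this] obtain l u where "C (\<K> - {L}) l u" by blast
      then have u: "\<And>x. x \<in> Z \<Longrightarrow> nonzero 3 (u x)" "\<And>x. x \<in> Z \<Longrightarrow> admissible M g x (u x)"
        and l: "\<And>H. H \<in> \<K> - {L} \<Longrightarrow> nonzero 3 (l H) \<and> kills 3 (l H) g H"
          "\<And>H x. H \<in> \<K> - {L} \<Longrightarrow> x \<in> Z \<Longrightarrow> x \<in> H \<Longrightarrow> dot 3 (l H) (u x) = 0"
        unfolding C_def by blast+
      have "\<exists>k. nonzero 3 k \<and> kills 3 k g L \<and> (\<forall>x\<in>Z \<inter> S. dot 3 k (u x) = 0)"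
      proof (cases "planar g L")
        case True
        obtain k where k: "nonzero 3 k" "kills 3 k g L" using kill[OF hyp] by blast
        have "dot 3 k (u x) = 0" if "x \<in> Z \<inter> S" for x
        proof -
          have "x \<in> Z" "x \<in> L" using that by (simp_all add: S_def)
          then show ?thesis using u(2) hyp True k(2) unfolding admissible_def by blast
        qed
        then show ?thesis using k by blast
      next
        case False
        obtain y where y: "Z \<inter> S \<subseteq> {y}" using one by blast
        obtain k where "nonzero 3 k" "kills 3 k g L" "dot 3 k (u y) = 0" using nonplanar_killing[OF False] by blast
        then show ?thesis using y by blast
      qed
      then obtain k where k: "nonzero 3 k" "kills 3 k g L" "\<And>x. x \<in> Z \<inter> S \<Longrightarrow> dot 3 k (u x) = 0" by blast
      define Q where "Q = (\<lambda>x w. nonzero 3 w \<and> admissible M g x w \<and> dot 3 k w = 0)"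
      have "\<exists>w. Q x w" if "x \<in> Z" for x unfolding Q_def by (rule adm[OF that])
      then obtain w where "\<And>x. x \<in> Z \<Longrightarrow> Q x (w x)" by metis
      then have w: "nonzero 3 (w x) \<and> admissible M g x (w x) \<and> dot 3 k (w x) = 0" if "x \<in> Z" for x
        using that unfolding Q_def by blast
      \<comment> \<open>Only columns of \<open>L\<close> on no earlier line are chosen anew, so the
        conditions on the earlier lines stay valid.\<close>
      define u' where "u' = (\<lambda>x. if x \<in> L - S then w x else u x)"
      define l' where "l' = l(L := k)"
      have u'L: "u' x = w x" if "x \<in> L" "x \<notin> S" for x using that by (simp add: u'_def)
      have u'S: "u' x = u x" if "x \<notin> L \<or> x \<in> S" for x using that by (auto simp: u'_def)
      have "nonzero 3 (u' x) \<and> admissible M g x (u' x)" if "x \<in> Z" for x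
        using u[OF that] w[OF that] unfolding u'_def by (cases "x \<in> L - S") (simp_all only: if_True if_False simp_thms)
      moreover have "nonzero 3 (l' H) \<and> kills 3 (l' H) g H \<and> (\<forall>x\<in>Z \<inter> H. dot 3 (l' H) (u' x) = 0)" if H: "H \<in> \<K>" for H
      proof (cases "H = L")
        case True
        have "dot 3 k (u' x) = 0" if "x \<in> Z \<inter> L" for x
          using w[of x] k(3)[of x] that u'L[of x] u'S[of x] by (cases "x \<in> S") simp_all
        then show ?thesis using k True by (simp add: l'_def)
      next
        case False
        then have HK: "H \<in> \<K> - {L}" using H by simp
        have "dot 3 (l H) (u' x) = 0" if "x \<in> Z \<inter> H" for x
        proof -
          have "x \<notin> L \<or> x \<in> S" using that HK unfolding S_def by blast
          then show ?thesis using l(2)[OF HK, of x] that u'S[of x] by simp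
        qed
        then show ?thesis using l(1)[OF HK] False by (simp add: l'_def)
      qed
      ultimately have "C \<K> l' u'" unfolding C_def by blast
      then show ?thesis by blast
    qed
  qed
  from this[OF finite_hyperplanes[of M]] obtain l u where "C {H. dependent_hyperplane M H} l u" by blast
  then have u: "\<And>x. x \<in> Z \<Longrightarrow> nonzero 3 (u x)"
    and l: "\<And>H. dependent_hyperplane M H \<Longrightarrow> nonzero 3 (l H) \<and> kills 3 (l H) g H"
      "\<And>H x. dependent_hyperplane M H \<Longrightarrow> x \<in> Z \<Longrightarrow> x \<in> H \<Longrightarrow> dot 3 (l H) (u x) = 0"
    unfolding C_def by blast+
  define h where "h = (\<lambda>t x i. if x \<in> Z then t * u x i else g x i)"
  have hZ: "h t x = (\<lambda>i. t * u x i)" if "x \<in> Z" for t x using that by (simp add: h_def)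
  have hN: "h t x = g x" if "x \<notin> Z" for t x using that by (simp add: h_def)
  have "h t \<in> zclosure M" if "t \<noteq> 0" for t
  proof (rule nonzero_in_zclosure[OF M, of _ l])
    fix a assume a: "a \<in> ground M"
    show "nonzero 3 (h t a)"
    proof (cases "a \<in> Z")
      case True
      then show ?thesis using u[OF True] that by (simp add: hZ)
    next
      case False
      then have "nonzero 3 (g a)" using a unfolding Z_def zero_points_def by blast
      then show ?thesis using hN[OF False] by simp
    qed
  next
    fix H assume H: "dependent_hyperplane M H"
    have "dot 3 (l H) (h t x) = 0" if "x \<in> H" for x
    proof (cases "x \<in> Z")
      case True
      then show ?thesis using l(2)[OF H True that] by (simp add: hZ dot_linear)
    next
      case False
      then show ?thesis using l(1)[OF H] that by (simp add: hN kills_def)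
    qed
    then show "nonzero 3 (l H) \<and> kills 3 (l H) (h t) H" using l(1)[OF H] by (simp add: kills_def)
  qed
  then have "\<forall>\<^sub>F t in cofinite. h t \<in> zclosure M"
    by (simp add: eventually_cofinite) (rule finite_subset[of _ "{0}"], auto)
  then have fr: "\<exists>\<^sub>F t in cofinite. h t \<in> zclosure M"
    by (rule eventually_frequently[rotated]) (rule cofinite_complex_neq_bot)
  have "h 0 \<in> zclosure M"
  proof (rule zclosure_curve[OF _ fr])
    show "polyfun (\<lambda>t. h t x i)" for x i
    proof (cases "x \<in> Z")
      case True
      have "polyfun (\<lambda>t. t * u x i)" by (intro polyfun_mult polyfun_const polyfun_id)
      then show ?thesis by (simp only: hZ[OF True])
    next
      case False
      show ?thesis unfolding hN[OF False] by (rule polyfun_const)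
    qed
  qed
  then show ?thesis
  proof (rule zclosure_cong)
    fix a i assume "a \<in> ground M" "i \<in> {1..mrank M}"
    then show "h 0 a i = g a i"
      using forest_paving(2)[OF M] by (cases "a \<in> Z") (auto simp: h_def Z_def zero_points_def)
  qed
qed

lemma G_zero_killing:
  assumes M: "forest_configuration M" and g: "G_zero M g" and H: "dependent_hyperplane M H"
  shows "\<exists>k. nonzero 3 k \<and> kills 3 k g H"
proof (rule exists_killing_of_dependent)
  show "finite H" using finite_subset[OF hyperplane_ground[OF H]] by simp
  fix B assume B: "B \<subseteq> H" "card B = 3"
  then have c: "circuit M B" using H forest_paving(2)[OF M]
    by (simp add: dependent_hyperplane_def all_rank_subsets_circuits_def)
  obtain a b c where abc: "B = {a, b, c}" "a \<noteq> b" "a \<noteq> c" "b \<noteq> c" using B(2) by (auto simp: card_3_iff)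
  then show "lindep 3 g B" using G_zero_brk[OF g, of a b c] c B(2) brk_zero_iff[OF abc(2-4), of g] by simp
qed simp

text \<open>Induction on the number of zero columns. A nonzero replacement \<open>v\<close> at a
  zero column \<open>x\<close> is inserted as \<open>t v\<close>; for \<open>t \<noteq> 0\<close>
  there are fewer zero columns and the generators still vanish, and \<open>t = 0\<close> gives
  \<open>g\<close> back. If no nonzero replacement remains, the terminal case applies.\<close>

theorem G_zero_in_zclosure:
  assumes M: "forest_configuration M" and g: "G_zero M g"
  shows "g \<in> zclosure M"
  using g
proof (induction "card (zero_points M g)" arbitrary: g rule: less_induct)
  case less
  have finZ: "finite (zero_points M g)" by (simp add: zero_points_def)
  show ?case
  proof (cases "\<exists>x\<in>zero_points M g. \<exists>v\<in>meets M g x. nonzero 3 v")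
    case True
    then obtain x v where x: "x \<in> zero_points M g" "v \<in> meets M g x" "nonzero 3 v" by blast
    have "replaces M g (g(x := v))" using x(2) by (simp add: replaces_def)
    then have Gv: "G_zero M (g(x := v))" using G_zero_replaces[OF less.prems] by blast
    define h where "h = (\<lambda>t a i. (if a = x then t else 1) * (g(x := v)) a i)"
    have "h t \<in> zclosure M" if "t \<noteq> 0" for t
    proof (rule less.hyps)
      have nx: "nonzero 3 (h t x)" using x(3) that by (simp add: h_def)
      have hg: "h t a = g a" if "a \<noteq> x" for a using that by (simp add: h_def)
      have "zero_points M (h t) \<subseteq> zero_points M g - {x}"
      proof
        fix a assume a: "a \<in> zero_points M (h t)"
        then have "a \<noteq> x" using nx unfolding zero_points_def by blast
        then show "a \<in> zero_points M g - {x}" using a hg[of a] by (simp add: zero_points_def)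
      qed
      then have "zero_points M (h t) \<subset> zero_points M g" using x(1) by blast
      then show "card (zero_points M (h t)) < card (zero_points M g)" using finZ by (rule psubset_card_mono[rotated])
      show "G_zero M (h t)" unfolding h_def by (rule G_zero_scale[OF Gv])
    qed
    then have "\<forall>\<^sub>F t in cofinite. h t \<in> zclosure M"
      by (simp add: eventually_cofinite) (rule finite_subset[of _ "{0}"], auto)
    then have fr: "\<exists>\<^sub>F t in cofinite. h t \<in> zclosure M"
      by (rule eventually_frequently[rotated]) (rule cofinite_complex_neq_bot)
    have "h 0 \<in> zclosure M"
    proof (rule zclosure_curve[OF _ fr])
      show "polyfun (\<lambda>t. h t a i)" for a i
      proof (cases "a = x")
        case True
        have "polyfun (\<lambda>t. t * (g(x := v)) a i)" by (intro polyfun_mult polyfun_const polyfun_id)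
        then show ?thesis unfolding h_def if_P[OF True] .
      next
        case False
        show ?thesis unfolding h_def if_not_P[OF False] by (rule polyfun_const)
      qed
    qed
    then show ?thesis
    proof (rule zclosure_cong)
      fix a i assume "a \<in> ground M" "i \<in> {1..mrank M}"
      then show "h 0 a i = g a i"
        using forest_paving(2)[OF M] x(1) by (cases "a = x") (auto simp: h_def zero_points_def)
    qed
  next
    case False
    show ?thesis
    proof (rule terminal_in_zclosure[OF M G_zero_killing[OF M less.prems]])
      fix x H H' p q s t
      assume x: "x \<in> zero_points M g" and H: "dependent_hyperplane M H" "dependent_hyperplane M H'" "H \<noteq> H'" "x \<in> H" "x \<in> H'"
        and p: "p \<in> H" "q \<in> H" "s \<in> H'" "t \<in> H'"
      obtain l1 where l1: "l1 \<in> subspaces M" "\<Union>l1 = H" using paving_hyperplane_subspace[OF forest_paving(1)[OF M] H(1)] by blast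
      obtain l2 where l2: "l2 \<in> subspaces M" "\<Union>l2 = H'" using paving_hyperplane_subspace[OF forest_paving(1)[OF M] H(2)] by blast
      have "meet g p q s t \<in> meets M g x"
      proof (rule meetsI)
        show "l1 \<in> subspaces_at M x" "l2 \<in> subspaces_at M x"
          using l1 l2 H(4,5) unfolding subspaces_at_def by blast+
        show "l1 \<noteq> l2" using l1(2) l2(2) H(3) by blast
      qed (use p l1(2) l2(2) in simp_all)
      then show "\<not> nonzero 3 (meet g p q s t)" using False x by blast
    qed
  qed
qed

section \<open>The vanishing ideal of the matroid variety of a forest configuration\<close>

lemma poly_ring_simps [simp]:
  "carrier (poly_ring J) = pring J" "\<zero>\<^bsub>poly_ring J\<^esub> = 0" "\<one>\<^bsub>poly_ring J\<^esub> = 1"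
  "x \<oplus>\<^bsub>poly_ring J\<^esub> y = x + y" "x \<otimes>\<^bsub>poly_ring J\<^esub> y = x * y"
  by (simp_all add: poly_ring_def pring_def)

lemma poly_ring_power: "x [^]\<^bsub>poly_ring J\<^esub> (k::nat) = x ^ k"
  by (induction k) (simp_all add: nat_pow_def mult.commute)

lemma ring_poly_ring: "ring (poly_ring J)"
proof (rule ringI)
  show "abelian_group (poly_ring J)"
  proof (rule abelian_groupI)
    fix x assume "x \<in> carrier (poly_ring J)"
    then show "\<exists>y\<in>carrier (poly_ring J). y \<oplus>\<^bsub>poly_ring J\<^esub> x = \<zero>\<^bsub>poly_ring J\<^esub>"
      by (intro bexI[of _ "- x"]) auto
  qed (auto simp: algebra_simps)
  show "Group.monoid (poly_ring J)"
    by (rule monoidI) (auto simp: algebra_simps)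
qed (simp_all add: algebra_simps)

lemma poly_ideal_of_ideal:
  assumes "ideal I (poly_ring J)"
  shows "poly_ideal J I"
proof -
  interpret ideal I "poly_ring J" by fact
  show ?thesis unfolding poly_ideal_def
    using a_subset additive_subgroup.zero_closed[OF is_additive_subgroup]
      additive_subgroup.a_closed[OF is_additive_subgroup] I_l_closed by auto
qed

lemma ideal_of_poly_ideal:
  assumes "poly_ideal J I"
  shows "ideal I (poly_ring J)"
proof (rule idealI[OF ring_poly_ring])
  interpret R: ring "poly_ring J" by (rule ring_poly_ring)
  note id = poly_idealD[OF assms]
  show "subgroup I (add_monoid (poly_ring J))"
  proof (rule R.add.subgroupI)
    show "I \<subseteq> carrier (poly_ring J)" using id(1) by auto
    show "I \<noteq> {}" using id(2) by auto
    fix a assume a: "a \<in> I"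
    have "- a \<oplus>\<^bsub>poly_ring J\<^esub> a = \<zero>\<^bsub>poly_ring J\<^esub>" by simp
    then have "\<ominus>\<^bsub>poly_ring J\<^esub> a = - a"
      using id(1)[OF a] by (intro R.minus_equality) auto
    then show "\<ominus>\<^bsub>poly_ring J\<^esub> a \<in> I" using id(5)[OF a] by simp
    fix b assume "b \<in> I"
    then show "a \<oplus>\<^bsub>poly_ring J\<^esub> b \<in> I" using id(3)[OF a] by simp
  qed
  fix a x assume "a \<in> I" "x \<in> carrier (poly_ring J)"
  then show "x \<otimes>\<^bsub>poly_ring J\<^esub> a \<in> I" "a \<otimes>\<^bsub>poly_ring J\<^esub> x \<in> I"
    using id(4)[of a x] by (simp_all add: mult.commute)
qed

lemma vanishing_ideal_iff: "P \<in> vanishing_ideal J V \<longleftrightarrow> P \<in> pring J \<and> (\<forall>\<gamma>\<in>V. peval \<gamma> P = 0)"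
  by (simp add: vanishing_ideal_def)

lemma poly_ideal_vanishing: "poly_ideal J (vanishing_ideal J V)"
  unfolding poly_ideal_def by (auto simp: vanishing_ideal_iff peval_add peval_mult)

lemma vanishing_ideal_matroid_variety:
  "vanishing_ideal (matrix_index M) (matroid_variety M) = vanishing_ideal (matrix_index M) (realizations M)"
proof -
  have "realizations M \<subseteq> matroid_variety M"
    by (auto simp: matroid_variety_iff realizations_iff realizes_zclosure)
  then have "vanishing_ideal (matrix_index M) (matroid_variety M) \<subseteq> vanishing_ideal (matrix_index M) (realizations M)"
    unfolding vanishing_ideal_def by blast
  moreover have "P \<in> vanishing_ideal (matrix_index M) (matroid_variety M)"
    if P: "P \<in> vanishing_ideal (matrix_index M) (realizations M)" for P
    unfolding vanishing_ideal_iff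
  proof (intro conjI ballI)
    show "P \<in> pring (matrix_index M)" using P by (simp add: vanishing_ideal_iff)
    fix \<gamma> assume "\<gamma> \<in> matroid_variety M"
    then have "(\<lambda>a i. \<gamma> (i, a)) \<in> zclosure M" by (simp add: matroid_variety_iff)
    then have "ev (\<lambda>a i. \<gamma> (i, a)) P = 0" using P unfolding zclosure_def vanishing_ideal_iff by blast
    then show "peval \<gamma> P = 0" by (simp add: ev_vectors)
  qed
  ultimately show ?thesis by blast
qed

lemma G_gens_mono: "G_gens M j \<subseteq> G_gens M (Suc j)"
proof
  fix P assume "P \<in> G_gens M j"
  moreover have "replacement_subst M Var" by (simp add: replacement_subst_def)
  moreover have "P = psubst Var P" by (simp add: psubst_Var)
  ultimately show "P \<in> G_gens M (Suc j)" by auto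
qed

lemma G_ideal_poly_ideal:
  assumes M: "forest_configuration M"
  shows "poly_ideal (matrix_index M) (G_ideal M)" "G_gens M j \<subseteq> G_ideal M"
proof -
  interpret R: ring "poly_ring (matrix_index M)" by (rule ring_poly_ring)
  define X where "X = (\<lambda>j. genideal (poly_ring (matrix_index M)) (G_gens M j))"
  have sub: "G_gens M j \<subseteq> carrier (poly_ring (matrix_index M))" for j using G_gens_pring[OF M] by auto
  have X: "ideal (X j) (poly_ring (matrix_index M))" "G_gens M j \<subseteq> X j" for j
    unfolding X_def using R.genideal_ideal[OF sub] R.genideal_self[OF sub] by auto
  have "X j \<subseteq> X (Suc j)" for j
    using R.genideal_minimal[OF X(1)[of "Suc j"], of "G_gens M j"] G_gens_mono[of M j] X(2)[of "Suc j"]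
    unfolding X_def by blast
  then have mono: "X i \<subseteq> X j" if "i \<le> j" for i j using lift_Suc_mono_le[of X] that by blast
  have G: "G_ideal M = (\<Union>j. X j)" by (simp add: G_ideal_def X_def)
  note id = poly_ideal_of_ideal[OF X(1)]
  show "poly_ideal (matrix_index M) (G_ideal M)"
    unfolding poly_ideal_def G
  proof (intro conjI ballI)
    show "(\<Union>j. X j) \<subseteq> pring (matrix_index M)" using poly_idealD(1)[OF id] by blast
    show "0 \<in> (\<Union>j. X j)" using poly_idealD(2)[OF id] by blast
  next
    fix a b assume "a \<in> (\<Union>j. X j)" "b \<in> (\<Union>j. X j)"
    then obtain i j where "a \<in> X i" "b \<in> X j" by blast
    then have "a \<in> X (max i j)" "b \<in> X (max i j)" using mono[of i "max i j"] mono[of j "max i j"] by auto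
    then show "a + b \<in> (\<Union>j. X j)" using poly_idealD(3)[OF id] by blast
  next
    fix a p assume "a \<in> (\<Union>j. X j)" and p: "p \<in> pring (matrix_index M)"
    then obtain i where "a \<in> X i" by blast
    then show "p * a \<in> (\<Union>j. X j)" using poly_idealD(4)[OF id _ p] by blast
  qed
  show "G_gens M j \<subseteq> G_ideal M" unfolding G using X(2) by blast
qed

lemma G_ideal_vanishes:
  assumes M: "forest_configuration M"
  shows "G_ideal M \<subseteq> vanishing_ideal (matrix_index M) (realizations M)"
proof -
  interpret R: ring "poly_ring (matrix_index M)" by (rule ring_poly_ring)
  let ?V = "vanishing_ideal (matrix_index M) (realizations M)"
  have "G_gens M j \<subseteq> ?V" for j
  proof
    fix P assume P: "P \<in> G_gens M j"
    have "peval \<gamma> P = 0" if "\<gamma> \<in> realizations M" for \<gamma>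
    proof -
      have "G_zero M (\<lambda>a i. \<gamma> (i, a))" using G_zero_realization[OF M] that realizations_iff by blast
      then have "ev (\<lambda>a i. \<gamma> (i, a)) P = 0" using P unfolding G_zero_def by blast
      then show ?thesis by (simp add: ev_vectors)
    qed
    then show "P \<in> ?V" using G_gens_pring[OF M P] by (simp add: vanishing_ideal_iff)
  qed
  then show ?thesis
    unfolding G_ideal_def using R.genideal_minimal[OF ideal_of_poly_ideal[OF poly_ideal_vanishing]] by blast
qed

text \<open>A common zero of the sum is a zero of every replacement generator, hence lies in the
  closure of the realization space, and the Nullstellensatz turns vanishing there into membership of
  a power. Conversely both summands vanish on realizations, and so does every polynomial with a
  power in their sum.\<close>

theorem forest_vanishing_ideal:
  assumes M: "forest_configuration M"
  shows "vanishing_ideal (matrix_index M) (matroid_variety M) =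
    radical_ideal (poly_ring (matrix_index M))
      (vanishing_ideal (matrix_index M) (circuit_variety M) <+>\<^bsub>poly_ring (matrix_index M)\<^esub> G_ideal M)"
    (is "?L = radical_ideal ?R (?C <+>\<^bsub>?R\<^esub> ?G)")
proof
  let ?J = "matrix_index M"
  have sum_iff: "x \<in> ?C <+>\<^bsub>?R\<^esub> ?G \<longleftrightarrow> (\<exists>a\<in>?C. \<exists>b\<in>?G. x = a + b)" for x
    by (auto simp: set_add_def' )
  have sumI: "a + b \<in> ?C <+>\<^bsub>?R\<^esub> ?G" if "a \<in> ?C" "b \<in> ?G" for a b
    unfolding sum_iff using that by blast
  have idC: "poly_ideal ?J ?C" by (rule poly_ideal_vanishing)
  have idG: "poly_ideal ?J ?G" by (rule G_ideal_poly_ideal(1)[OF M])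
  have idS: "poly_ideal ?J (?C <+>\<^bsub>?R\<^esub> ?G)"
    unfolding poly_ideal_def
  proof (intro conjI ballI)
    show "?C <+>\<^bsub>?R\<^esub> ?G \<subseteq> pring ?J"
    proof
      fix x assume "x \<in> ?C <+>\<^bsub>?R\<^esub> ?G"
      then obtain a b where *: "x = a + b" "a \<in> ?C" "b \<in> ?G" unfolding sum_iff by blast
      show "x \<in> pring ?J" unfolding *(1)
        by (rule pring_add[OF poly_idealD(1)[OF idC *(2)] poly_idealD(1)[OF idG *(3)]])
    qed
    show "0 \<in> ?C <+>\<^bsub>?R\<^esub> ?G" using sumI[OF poly_idealD(2)[OF idC] poly_idealD(2)[OF idG]] by simp
  next
    fix x y assume "x \<in> ?C <+>\<^bsub>?R\<^esub> ?G" "y \<in> ?C <+>\<^bsub>?R\<^esub> ?G"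
    then obtain a b c d where *: "x = a + b" "y = c + d" "a \<in> ?C" "b \<in> ?G" "c \<in> ?C" "d \<in> ?G"
      unfolding sum_iff by blast
    have "x + y = (a + c) + (b + d)" by (simp add: *(1,2) algebra_simps)
    then show "x + y \<in> ?C <+>\<^bsub>?R\<^esub> ?G"
      using sumI[OF poly_idealD(3)[OF idC *(3,5)] poly_idealD(3)[OF idG *(4,6)]] by simp
  next
    fix x p assume "x \<in> ?C <+>\<^bsub>?R\<^esub> ?G" and p: "p \<in> pring ?J"
    then obtain a b where *: "x = a + b" "a \<in> ?C" "b \<in> ?G" unfolding sum_iff by blast
    have "p * x = p * a + p * b" by (simp add: *(1) algebra_simps)
    then show "p * x \<in> ?C <+>\<^bsub>?R\<^esub> ?G"
      using sumI[OF poly_idealD(4)[OF idC *(2) p] poly_idealD(4)[OF idG *(3) p]] by simp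
  qed
  have GS: "b \<in> ?C <+>\<^bsub>?R\<^esub> ?G" if "b \<in> ?G" for b
    using sumI[OF poly_idealD(2)[OF idC] that] by simp
  show "?L \<subseteq> radical_ideal ?R (?C <+>\<^bsub>?R\<^esub> ?G)"
  proof
    fix P assume "P \<in> ?L"
    then have P: "P \<in> pring ?J" "\<forall>\<gamma>\<in>realizations M. peval \<gamma> P = 0"
      unfolding vanishing_ideal_matroid_variety by (simp_all add: vanishing_ideal_iff)
    have "\<exists>k. P ^ k \<in> ?C <+>\<^bsub>?R\<^esub> ?G"
    proof (rule nullstellensatz[OF _ idS P(1)])
      show "finite ?J" by (simp add: matrix_index_def)
      fix \<gamma> assume z: "\<forall>p\<in>?C <+>\<^bsub>?R\<^esub> ?G. peval \<gamma> p = 0"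
      have "G_zero M (\<lambda>a i. \<gamma> (i, a))"
        unfolding G_zero_def ev_vectors using z GS subsetD[OF G_ideal_poly_ideal(2)[OF M]] by simp
      then have "(\<lambda>a i. \<gamma> (i, a)) \<in> zclosure M" by (rule G_zero_in_zclosure[OF M])
      then show "peval \<gamma> P = 0" using P unfolding zclosure_def by (simp add: ev_vectors)
    qed
    then show "P \<in> radical_ideal ?R (?C <+>\<^bsub>?R\<^esub> ?G)"
      using P(1) by (simp add: radical_ideal_def poly_ring_power)
  qed
  show "radical_ideal ?R (?C <+>\<^bsub>?R\<^esub> ?G) \<subseteq> ?L"
  proof
    fix P assume "P \<in> radical_ideal ?R (?C <+>\<^bsub>?R\<^esub> ?G)"
    then obtain k where P: "P \<in> pring ?J" "P ^ k \<in> ?C <+>\<^bsub>?R\<^esub> ?G"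
      unfolding radical_ideal_def poly_ring_power poly_ring_simps by blast
    then obtain a b where ab: "P ^ k = a + b" "a \<in> ?C" "b \<in> ?G" unfolding sum_iff by blast
    have "peval \<gamma> P = 0" if \<gamma>: "\<gamma> \<in> realizations M" for \<gamma>
    proof -
      have "peval \<gamma> a = 0"
        using ab(2) matroid_variety_subset_circuit_variety[OF \<gamma>] by (simp add: vanishing_ideal_iff)
      moreover have "peval \<gamma> b = 0" using ab(3) G_ideal_vanishes[OF M] \<gamma> by (auto simp: vanishing_ideal_iff)
      ultimately have "peval \<gamma> P ^ k = 0" using arg_cong[OF ab(1), of "peval \<gamma>"] by (simp add: peval_power peval_add)
      then show ?thesis by simp
    qed
    then show "P \<in> ?L" unfolding vanishing_ideal_matroid_variety using P(1) by (simp add: vanishing_ideal_iff)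
  qed
qed

theorem theorem1:
  fixes M :: "nat matroid" and n :: nat
  assumes "ground M = {1..n}"
  shows
    "(nilpotent_matroid M \<longrightarrow>
        realizable M \<and> zariski_irreducible (matrix_index M) (realizations M))
     \<and>
     (nilpotent_matroid M \<and> paving M \<and>
      (\<forall>H1 H2 H3. dependent_hyperplane M H1 \<and> dependent_hyperplane M H2 \<and> dependent_hyperplane M H3 \<and>
         H1 \<noteq> H2 \<and> H1 \<noteq> H3 \<and> H2 \<noteq> H3 \<longrightarrow> H1 \<inter> H2 \<inter> H3 = {}) \<longrightarrow>
        matroid_variety M = circuit_variety M)
     \<and>
     (forest_configuration M \<longrightarrow>
        nilpotent_matroid M \<and>
        vanishing_ideal (matrix_index M) (matroid_variety M) =
          radical_ideal (poly_ring (matrix_index M))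
            (vanishing_ideal (matrix_index M) (circuit_variety M)
               <+>\<^bsub>poly_ring (matrix_index M)\<^esub> G_ideal M))"
proof (intro conjI impI)
  assume "nilpotent_matroid M"
  then show "realizable M" "zariski_irreducible (matrix_index M) (realizations M)"
    by (rule nilpotent_realizable, rule nilpotent_irreducible)
next
  assume "nilpotent_matroid M \<and> paving M \<and>
      (\<forall>H1 H2 H3. dependent_hyperplane M H1 \<and> dependent_hyperplane M H2 \<and> dependent_hyperplane M H3 \<and>
         H1 \<noteq> H2 \<and> H1 \<noteq> H3 \<and> H2 \<noteq> H3 \<longrightarrow> H1 \<inter> H2 \<inter> H3 = {})"
  then show "matroid_variety M = circuit_variety M"
    by (intro nilpotent_paving_varieties) blast+
next
  assume "forest_configuration M"
  then show "nilpotent_matroid M"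
    "vanishing_ideal (matrix_index M) (matroid_variety M) =
          radical_ideal (poly_ring (matrix_index M))
            (vanishing_ideal (matrix_index M) (circuit_variety M)
               <+>\<^bsub>poly_ring (matrix_index M)\<^esub> G_ideal M)"
    by (rule forest_nilpotent, rule forest_vanishing_ideal)
qed

end
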